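(* Let $m,n\ge 1$. Every monomial in Plücker coordinates is a linear combination of Non-Crossing Monomials in $R_{m,n}$, and in a unique way. Non-Crossing Monomials form a basis for the coordinate ring $R_{m,n}$ of the Grassmannian $\mathbb{G}_{m,n}$.
   Context: $\mathbb{G}_{m,n}$ is the Grassmannian of $m$-dimensional subspaces of $\mathbb{C}^{m+n}$, represented by $m\times(m+n)$ matrices of rank $m$. For $J=\{j_1<\dots<j_m\}\subset\{1,\dots,m+n\}$, the Plücker coordinate $P_J$ is the $m\times m$ minor on columns $J$. $R_{m,n}=\mathbb{C}[P_J]/I_{m,n}$ is the (homogeneous) coordinate ring of $\mathbb{G}_{m,n}$ in the Plücker embedding, where $I_{m,n}$ is the ideal generated by the Plücker relations; equivalently, $R_{m,n}$ is the subring generated by the maximal minors of a generic $m\times(m+n)$ matrix. A monomial $M=P_{J^1}\cdots P_{J^h}$ is non-crossing (a Non-Crossing Monomial, NCM) if the multiset $\{J^1,\dots,J^h\}$ is semi-noncrossing in the following sense. Two disjoint sets $a=\{a_1<\dots<a_m\}$, $b=\{b_1<\dots<b_m\}$ of integers are non-crossing if for no $1\le k\le m-1$ does $a_k<b_k<a_{k+1}<b_{k+1}$ or $b_k<a_k<b_{k+1}<a_{k+1}$ hold. Let $\mu_v$ be the number of indices $i$ with $v\in J^i$, and let $B_1,\dots,B_{m+n}$ be the consecutive segments of $\{1,\dots,mh\}$ of lengths $\mu_1,\dots,\mu_{m+n}$. The multiset $\{J^1,\dots,J^h\}$ is semi-noncrossing if there is a set partition of $\{1,\dots,mh\}$ into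 $h$ pairwise non-crossing blocks of size $m$, each block containing at most one element of each $B_v$, such that replacing every element of $B_v$ by $v$ (for all $v$) turns the multiset of blocks into $\{J^1,\dots,J^h\}$. The empty monomial $1$ is non-crossing. *)

theory Defs
  imports
    Complex_Main
    "HOL-Library.Poly_Mapping"
    "HOL-Library.Multiset"
    "HOL-Library.Disjoint_Sets"
    "HOL-Algebra.QuotRing"
begin

text \<open>
  Polynomials with complex coefficients in variables from \<open>'v\<close> are finitely supported maps
  from power products \<open>'v \<Rightarrow>\<^sub>0 nat\<close> to coefficients. A Plucker coordinate is the variable
  named by its column set \<open>J\<close>.
\<close>

type_synonym plucker_poly = "(nat set \<Rightarrow>\<^sub>0 nat) \<Rightarrow>\<^sub>0 complex"

definition const_poly :: "complex \<Rightarrow> plucker_poly" where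
  "const_poly c = Poly_Mapping.single 0 c"

definition plucker_var :: "nat set \<Rightarrow> plucker_poly" where
  "plucker_var J = Poly_Mapping.single (Poly_Mapping.single J 1) 1"

definition column_sets :: "nat \<Rightarrow> nat \<Rightarrow> nat set set" where
  "column_sets m n = {J. J \<subseteq> {1..m + n} \<and> card J = m}"

definition plucker_poly_ring :: "nat \<Rightarrow> nat \<Rightarrow> plucker_poly ring" where
  "plucker_poly_ring m n =
     \<lparr>carrier = {p. \<forall>t\<in>Poly_Mapping.keys p. Poly_Mapping.keys t \<subseteq> column_sets m n},
      monoid.mult = (*), one = 1, zero = 0, add = (+)\<rparr>"

text \<open>
  The Plucker coordinate with an arbitrary sequence of columns as its index: it changes sign
  under transpositions and vanishes if a column is repeated. The exponent counts inversions.
\<close>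

definition plucker_seq :: "nat list \<Rightarrow> plucker_poly" where
  "plucker_seq s =
     (if distinct s
      then (-1) ^ card {(p, q). p < q \<and> q < length s \<and> s ! q < s ! p} * plucker_var (set s)
      else 0)"

text \<open>
  The Plucker relation of \<open>i\<^sub>1, \<dots>, i\<^sub>m\<^sub>-\<^sub>1\<close> and \<open>j\<^sub>0, \<dots>, j\<^sub>m\<close> is
  \<open>\<Sum>\<^sub>l (-1)\<^sup>l P(i\<^sub>1, \<dots>, i\<^sub>m\<^sub>-\<^sub>1, j\<^sub>l) P(j\<^sub>0, \<dots>, j\<^sub>l\<^sub>-\<^sub>1, j\<^sub>l\<^sub>+\<^sub>1, \<dots>, j\<^sub>m) = 0\<close>.
\<close>

definition plucker_relation :: "nat list \<Rightarrow> nat list \<Rightarrow> plucker_poly" where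
  "plucker_relation is js =
     (\<Sum>l<length js. (-1) ^ l * plucker_seq (is @ [js ! l])
        * plucker_seq (take l js @ drop (Suc l) js))"

definition plucker_relations :: "nat \<Rightarrow> nat \<Rightarrow> plucker_poly set" where
  "plucker_relations m n =
     {plucker_relation is js | is js.
        length is + 1 = m \<and> set is \<subseteq> {1..m + n} \<and>
        length js = m + 1 \<and> set js \<subseteq> {1..m + n}}"

definition plucker_ideal :: "nat \<Rightarrow> nat \<Rightarrow> plucker_poly set" where
  "plucker_ideal m n = genideal (plucker_poly_ring m n) (plucker_relations m n)"

definition grassmannian_ring :: "nat \<Rightarrow> nat \<Rightarrow> plucker_poly set ring" where
  "grassmannian_ring m n = plucker_poly_ring m n Quot plucker_ideal m n"

definition residue_class :: "nat \<Rightarrow> nat \<Rightarrow> plucker_poly \<Rightarrow> plucker_poly set" where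
  "residue_class m n p = plucker_ideal m n +>\<^bsub>plucker_poly_ring m n\<^esub> p"

text \<open>
  A monomial \<open>P\<^bsub>J\<^sup>1\<^esub> \<cdots> P\<^bsub>J\<^sup>h\<^esub>\<close> is given by the multiset of its column sets.
\<close>

definition plucker_monomials :: "nat \<Rightarrow> nat \<Rightarrow> nat set multiset set" where
  "plucker_monomials m n = {A. set_mset A \<subseteq> column_sets m n}"

definition monomial_poly :: "nat set multiset \<Rightarrow> plucker_poly" where
  "monomial_poly A = (\<Prod>J\<in>#A. plucker_var J)"

definition monomial_class :: "nat \<Rightarrow> nat \<Rightarrow> nat set multiset \<Rightarrow> plucker_poly set" where
  "monomial_class m n A = residue_class m n (monomial_poly A)"

definition scalar_class :: "nat \<Rightarrow> nat \<Rightarrow> complex \<Rightarrow> plucker_poly set" where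
  "scalar_class m n c = residue_class m n (const_poly c)"

text \<open>
  A ring \<open>R\<close> with a structure map \<open>\<phi>\<close> from the complex numbers is regarded as a complex vector
  space. Families, rather than sets, of vectors are used, so that independence of
  \<open>(f i)\<^bsub>i \<in> I\<^esub>\<close> includes injectivity of \<open>f\<close> on \<open>I\<close>.
\<close>

definition lin_comb ::
    "('a, 'b) ring_scheme \<Rightarrow> (complex \<Rightarrow> 'a) \<Rightarrow> ('i \<Rightarrow> 'a) \<Rightarrow> ('i \<Rightarrow>\<^sub>0 complex) \<Rightarrow> 'a" where
  "lin_comb R \<phi> f c =
     (\<Oplus>\<^bsub>R\<^esub>i\<in>Poly_Mapping.keys c. \<phi> (Poly_Mapping.lookup c i) \<otimes>\<^bsub>R\<^esub> f i)"

definition lin_independent ::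
    "('a, 'b) ring_scheme \<Rightarrow> (complex \<Rightarrow> 'a) \<Rightarrow> ('i \<Rightarrow> 'a) \<Rightarrow> 'i set \<Rightarrow> bool" where
  "lin_independent R \<phi> f I \<longleftrightarrow>
     (\<forall>c. Poly_Mapping.keys c \<subseteq> I \<and> lin_comb R \<phi> f c = \<zero>\<^bsub>R\<^esub> \<longrightarrow> c = 0)"

definition is_basis ::
    "('a, 'b) ring_scheme \<Rightarrow> (complex \<Rightarrow> 'a) \<Rightarrow> ('i \<Rightarrow> 'a) \<Rightarrow> 'i set \<Rightarrow> bool" where
  "is_basis R \<phi> f I \<longleftrightarrow>
     lin_independent R \<phi> f I \<and>
     {lin_comb R \<phi> f c | c. Poly_Mapping.keys c \<subseteq> I} = carrier R"

text \<open>
  The increasing enumeration is indexed from \<open>0\<close>, so \<open>k\<close> below is one less than usual.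
\<close>

definition noncrossing :: "nat \<Rightarrow> nat set \<Rightarrow> nat set \<Rightarrow> bool" where
  "noncrossing m a b \<longleftrightarrow>
     (let x = (!) (sorted_list_of_set a); y = (!) (sorted_list_of_set b) in
      \<not> (\<exists>k. k + 1 < m \<and>
            (x k < y k \<and> y k < x (k + 1) \<and> x (k + 1) < y (k + 1) \<or>
             y k < x k \<and> x k < y (k + 1) \<and> y (k + 1) < x (k + 1))))"

definition column_multiplicity :: "nat set multiset \<Rightarrow> nat \<Rightarrow> nat" where
  "column_multiplicity A v = size {#J \<in># A. v \<in> J#}"

definition segment :: "nat set multiset \<Rightarrow> nat \<Rightarrow> nat set" where
  "segment A v =
     {(\<Sum>u=1..<v. column_multiplicity A u) + 1 .. (\<Sum>u=1..v. column_multiplicity A u)}"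

definition semi_noncrossing :: "nat \<Rightarrow> nat \<Rightarrow> nat set multiset \<Rightarrow> bool" where
  "semi_noncrossing m n A \<longleftrightarrow>
     (\<exists>\<B>. partition_on {1..m * size A} \<B> \<and> card \<B> = size A \<and>
        (\<forall>b\<in>\<B>. card b = m) \<and>
        (\<forall>a\<in>\<B>. \<forall>b\<in>\<B>. a \<noteq> b \<longrightarrow> noncrossing m a b) \<and>
        (\<forall>b\<in>\<B>. \<forall>v\<in>{1..m + n}. card (b \<inter> segment A v) \<le> 1) \<and>
        {#{v \<in> {1..m + n}. \<exists>x\<in>b. x \<in> segment A v}. b \<in># mset_set \<B>#} = A)"

definition noncrossing_monomials :: "nat \<Rightarrow> nat \<Rightarrow> nat set multiset set" where
  "noncrossing_monomials m n = {A \<in> plucker_monomials m n. semi_noncrossing m n A}"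

end

theory Submission
  imports
    Defs
    "HOL-Combinatorics.Permutations"
    "HOL-Library.Product_Lexorder"
    "Jordan_Normal_Form.Determinant"
begin

text \<open>
  Order the entries of a generic matrix row by row. In the lexicographic order the leading term
  of a maximal minor is its diagonal term, so the leading term of a monomial records, for every
  \<open>k\<close>, the multiset of the \<open>k\<close>-th elements of its column sets. Non-crossing monomials are
  determined by these row multisets: parenthesis matching is the only non-crossing way to join
  the \<open>k\<close>-th row to the \<open>(k+1)\<close>-st. Chains for the componentwise order (the standard
  monomials) are determined by them too, and every chain has the row multisets of some
  non-crossing monomial. Standard monomials span by straightening, so a triangular substitution
  shows that non-crossing monomials span, while distinct leading terms make them independent.

  For the straightening, give a column set \<open>J\<close> the weight \<open>\<Sum>\<^sub>j\<^sub>\<in>\<^sub>J 2\<^sup>j\<close>. If \<open>J\<close> and \<open>K\<close> are incomparable and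
  \<open>K\<close> is the heavier one, exchanging an initial piece of \<open>K\<close> with all pieces of \<open>J\<close> of the same
  size makes \<open>K\<close> heavier still and hence increases the sum of the squares of the weights.
\<close>

subsection \<open>Non-crossing arrays\<close>

text \<open>Being non-crossing is defined through one partition chosen for the whole multiset, so
  its failure does not hand over two factors that could be rewritten. Failure to be a chain does.
  This is the reason for the detour through standard monomials.

  The ideal is given by generators and is not assumed to be the kernel of the map to minors.
  Straightening works with the relations alone; independence, and the triangularity of the
  substitution, use only that this map kills the ideal.

  The second obstacle is ties: a column may occur in several factors, and the definition spreads it
  over a segment of positions. Arrays of ranks avoid positions altogether. The order within a
  segment has to be chosen only when an array is turned back into blocks.

  The exchange of several entries at once is derived from single exchanges. It comes with a
  factorial, which is invertible in the complex numbers.\<close>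

definition nc_array :: "nat \<Rightarrow> nat \<Rightarrow> (nat \<Rightarrow> nat \<Rightarrow> nat) \<Rightarrow> (nat \<Rightarrow> nat \<Rightarrow> nat) \<Rightarrow> bool" where
  "nc_array m h u \<tau> \<longleftrightarrow>
     (\<forall>k<m. bij_betw (\<tau> k) {..<h} {..<h}) \<and>
     (\<forall>k r. Suc k < m \<longrightarrow> r < h \<longrightarrow> u k (\<tau> k r) < u (Suc k) (\<tau> (Suc k) r)) \<and>
     (\<forall>k r r'. Suc k < m \<longrightarrow> r < h \<longrightarrow> r' < h \<longrightarrow> \<tau> k r < \<tau> k r' \<longrightarrow>
        \<tau> (Suc k) r < \<tau> (Suc k) r' \<longrightarrow> \<not> u k (\<tau> k r') < u (Suc k) (\<tau> (Suc k) r))"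

text \<open>For arrays, \<open>u k\<close> lists row \<open>k\<close> by rank and
  \<open>\<tau> k r\<close> is the rank of the row-\<open>k\<close> entry of block \<open>r\<close>.
  Ranks order equal entries of one row, while different rows are compared by strict inequality of
  values: an equality between rows \<open>k\<close> and \<open>Suc k\<close> is never a
  crossing.\<close>

definition array_columns :: "nat \<Rightarrow> nat \<Rightarrow> (nat \<Rightarrow> nat \<Rightarrow> nat) \<Rightarrow> (nat \<Rightarrow> nat \<Rightarrow> nat) \<Rightarrow> nat set multiset" where
  "array_columns m h u \<tau> = {#(\<lambda>k. u k (\<tau> k r)) ` {..<m}. r \<in># mset_set {..<h}#}"

text \<open>Compare the matchings from the largest \<open>r\<close> down. If
  \<open>f r < g r\<close>, then \<open>f r\<close> is \<open>g q\<close> for some \<open>q\<close>.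
  A \<open>q\<close> below \<open>r\<close> would make \<open>g\<close> cross at the pair
  \<open>q\<close>, \<open>r\<close>; a \<open>q\<close> above \<open>r\<close> has
  \<open>f q = g q = f r\<close> by induction, against injectivity.\<close>

lemma nc_matching_unique:
  fixes f g :: "nat \<Rightarrow> nat" and u w :: "nat \<Rightarrow> nat"
  assumes f: "bij_betw f {..<h} {..<h}" and g: "bij_betw g {..<h} {..<h}"
    and fu: "\<And>r. r < h \<Longrightarrow> u r < w (f r)" and gu: "\<And>r. r < h \<Longrightarrow> u r < w (g r)"
    and fn: "\<And>r r'. r < r' \<Longrightarrow> r' < h \<Longrightarrow> f r < f r' \<Longrightarrow> \<not> u r' < w (f r)"
    and gn: "\<And>r r'. r < r' \<Longrightarrow> r' < h \<Longrightarrow> g r < g r' \<Longrightarrow> \<not> u r' < w (g r)"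
    and r: "r < h"
  shows "f r = g r"
  using r
proof (induction "h - r" arbitrary: r rule: less_induct)
  case (less r)
  have IH: "f q = g q" if "r < q" "q < h" for q
    using less that by auto
  have aux: "\<not> f r < g r"
    if f: "bij_betw f {..<h} {..<h}" and g: "bij_betw g {..<h} {..<h}"
    and fu: "\<And>r. r < h \<Longrightarrow> u r < w (f r)"
    and gn: "\<And>r r'. r < r' \<Longrightarrow> r' < h \<Longrightarrow> g r < g r' \<Longrightarrow> \<not> u r' < w (g r)"
    and IH: "\<And>q. r < q \<Longrightarrow> q < h \<Longrightarrow> f q = g q" for f g :: "nat \<Rightarrow> nat"
  proof
    assume lt: "f r < g r"
    have "f r \<in> g ` {..<h}"
      using f g less.prems by (auto simp: bij_betw_def)
    then obtain q where q: "q < h" "g q = f r" by auto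
    consider "q < r" | "q = r" | "r < q" by linarith
    then show False
    proof cases
      case 1
      then show ?thesis using gn[of q r] q lt less.prems fu[of r] by auto
    next
      case 2
      then show ?thesis using q lt by simp
    next
      case 3
      then have "f q = f r" using IH q by simp
      moreover have "q = r"
        by (rule inj_onD[OF bij_betw_imp_inj_on[OF f] \<open>f q = f r\<close>]) (use q less.prems in auto)
      ultimately show ?thesis using 3 by simp
    qed
  qed
  show ?case
    using aux[OF f g fu gn IH] aux[OF g f gu fn IH[symmetric]] by simp
qed

lemma nc_arrayD:
  assumes "nc_array m h u \<tau>"
  shows "k < m \<Longrightarrow> bij_betw (\<tau> k) {..<h} {..<h}"
    and "Suc k < m \<Longrightarrow> r < h \<Longrightarrow> u k (\<tau> k r) < u (Suc k) (\<tau> (Suc k) r)"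
    and "Suc k < m \<Longrightarrow> r < h \<Longrightarrow> r' < h \<Longrightarrow> \<tau> k r < \<tau> k r' \<Longrightarrow> \<tau> (Suc k) r < \<tau> (Suc k) r' \<Longrightarrow>
      \<not> u k (\<tau> k r') < u (Suc k) (\<tau> (Suc k) r)"
  using assms by (simp_all add: nc_array_def)

text \<open>Consecutive rows are joined by a non-crossing matching of ranks, so the rank of a block
  in row \<open>0\<close> determines its rank in every later row.\<close>

lemma nc_array_unique:
  assumes a: "nc_array m h u \<tau>" and b: "nc_array m h u \<tau>'"
    and "r < h" "r' < h" "\<tau> 0 r = \<tau>' 0 r'" and "k < m"
  shows "\<tau> k r = \<tau>' k r'"
  using assms(3-6)
proof (induction k arbitrary: r r')
  case 0
  then show ?case by simp
next
  case (Suc k)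
  note ks = \<open>Suc k < m\<close>
  have bk: "bij_betw (\<tau> j) {..<h} {..<h}" "bij_betw (\<tau>' j) {..<h} {..<h}" if "j < m" for j
    using a b that by (auto simp: nc_array_def)
  \<comment> \<open>Composing with these inverses turns block numbers into row-\<open>k\<close>
    ranks, so that both arrays become matchings between the same two sequences.\<close>
  define i i' where "i = inv_into {..<h} (\<tau> k)" and "i' = inv_into {..<h} (\<tau>' k)"
  have km: "k < m" using Suc.prems by simp
  have ib: "bij_betw i {..<h} {..<h}" "bij_betw i' {..<h} {..<h}"
    unfolding i_def i'_def using bk[OF km] by (auto intro: bij_betw_inv_into)
  have ir: "i q < h" "\<tau> k (i q) = q" "i' q < h" "\<tau>' k (i' q) = q" if "q < h" for q
    using bk[OF km] that bij_betwE[OF ib(1)] bij_betwE[OF ib(2)] unfolding i_def i'_def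
    by (auto simp: bij_betw_inv_into_right)
  have eq: "(\<tau> (Suc k) \<circ> i) q = (\<tau>' (Suc k) \<circ> i') q" if q: "q < h" for q
  proof (rule nc_matching_unique[where f = "\<tau> (Suc k) \<circ> i" and g = "\<tau>' (Suc k) \<circ> i'"
        and u = "u k" and w = "u (Suc k)" and h = h and r = q])
    show "bij_betw (\<tau> (Suc k) \<circ> i) {..<h} {..<h}"
      by (rule bij_betw_trans[OF ib(1) bk(1)[OF ks]])
    show "bij_betw (\<tau>' (Suc k) \<circ> i') {..<h} {..<h}"
      by (rule bij_betw_trans[OF ib(2) bk(2)[OF ks]])
    show "u k r < u (Suc k) ((\<tau> (Suc k) \<circ> i) r)" if "r < h" for r
      using nc_arrayD(2)[OF a ks ir(1)[OF that]] ir[OF that] by simp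
    show "u k r < u (Suc k) ((\<tau>' (Suc k) \<circ> i') r)" if "r < h" for r
      using nc_arrayD(2)[OF b ks ir(3)[OF that]] ir[OF that] by simp
    show "\<not> u k r' < u (Suc k) ((\<tau> (Suc k) \<circ> i) r)"
      if "r < r'" "r' < h" "(\<tau> (Suc k) \<circ> i) r < (\<tau> (Suc k) \<circ> i) r'" for r r'
      using nc_arrayD(3)[OF a ks, of "i r" "i r'"] ir[of r] ir[of r'] that by simp
    show "\<not> u k r' < u (Suc k) ((\<tau>' (Suc k) \<circ> i') r)"
      if "r < r'" "r' < h" "(\<tau>' (Suc k) \<circ> i') r < (\<tau>' (Suc k) \<circ> i') r'" for r r'
      using nc_arrayD(3)[OF b ks, of "i' r" "i' r'"] ir[of r] ir[of r'] that by simp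
    show "q < h" by (rule q)
  qed
  have k: "\<tau> k r = \<tau>' k r'" using Suc.IH Suc.prems km by blast
  define q where "q = \<tau> k r"
  have "q < h" unfolding q_def using bk[OF km] Suc.prems by (auto simp: bij_betw_def)
  have "i q = r"
    using Suc.prems by (simp add: i_def q_def bij_betw_inv_into_left[OF bk(1)[OF km]])
  moreover have "i' q = r'"
    using Suc.prems by (simp add: i'_def q_def k bij_betw_inv_into_left[OF bk(2)[OF km]])
  ultimately show ?case using eq[OF \<open>q < h\<close>] by simp
qed

lemma array_columns_unique:
  assumes a: "nc_array m h u \<tau>" and b: "nc_array m h u \<tau>'" and m: "m \<ge> 1"
  shows "array_columns m h u \<tau> = array_columns m h u \<tau>'"
proof -
  have bij: "bij_betw (\<tau> 0) {..<h} {..<h}" "bij_betw (\<tau>' 0) {..<h} {..<h}"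
    using a b m by (auto simp: nc_array_def)
  \<comment> \<open>Block numbers are arbitrary: \<open>s\<close> sends a block of the first array
    to the block of the second with the same rank in row \<open>0\<close>.\<close>
  define s where "s = inv_into {..<h} (\<tau>' 0) \<circ> \<tau> 0"
  have s: "bij_betw s {..<h} {..<h}"
    unfolding s_def by (rule bij_betw_trans[OF bij(1) bij_betw_inv_into[OF bij(2)]])
  have s0: "\<tau> 0 r = \<tau>' 0 (s r)" "s r < h" if "r < h" for r
    using bij_betwE[OF bij(1)] bij_betwE[OF s] that
    by (auto simp: s_def bij_betw_inv_into_right[OF bij(2)])
  have "{#(\<lambda>k. u k (\<tau>' k r)) ` {..<m}. r \<in># mset_set {..<h}#}
      = {#(\<lambda>k. u k (\<tau>' k r)) ` {..<m}. r \<in># image_mset s (mset_set {..<h})#}"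
    using s by (simp add: image_mset_mset_set bij_betw_def)
  also have "\<dots> = {#(\<lambda>k. u k (\<tau> k r)) ` {..<m}. r \<in># mset_set {..<h}#}"
    unfolding multiset.map_comp o_def
  proof (rule image_mset_cong, rule image_cong)
    fix r k assume "r \<in># mset_set {..<h}" "k \<in> {..<m}"
    then show "u k (\<tau>' k (s r)) = u k (\<tau> k r)"
      using nc_array_unique[OF a b _ s0(2) s0(1), of r k] by simp
  qed simp
  finally show ?thesis by (simp add: array_columns_def)
qed

text \<open>Extremal choice: among the bijections with \<open>u r < w (f r)\<close>, the identity
  being one, take one with least \<open>\<Sum>r<h. r * f r\<close>. Uncrossing a pair keeps the
  inequalities, because \<open>w\<close> is monotone and the crossing itself supplies
  \<open>u r' < w (f r)\<close>, and it lowers the sum by the rearrangement inequality.\<close>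

lemma nc_matching_exists:
  fixes u w :: "nat \<Rightarrow> nat"
  assumes mono: "\<And>r r'. r \<le> r' \<Longrightarrow> r' < h \<Longrightarrow> u r \<le> u r'" "\<And>r r'. r \<le> r' \<Longrightarrow> r' < h \<Longrightarrow> w r \<le> w r'"
    and lt: "\<And>r. r < h \<Longrightarrow> u r < w r"
  obtains f where "bij_betw f {..<h} {..<h}" "\<And>r. r < h \<Longrightarrow> u r < w (f r)"
    "\<And>r r'. r < r' \<Longrightarrow> r' < h \<Longrightarrow> f r < f r' \<Longrightarrow> \<not> u r' < w (f r)"
proof -
  let ?P = "\<lambda>f. bij_betw f {..<h} {..<h} \<and> (\<forall>r<h. u r < w (f r))"
  let ?M = "\<lambda>f. \<Sum>r<h. r * f r"
  have "?P id" using lt by auto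
  then obtain f where f: "?P f" and least: "\<And>g. ?P g \<Longrightarrow> ?M f \<le> ?M g"
    using ex_has_least_nat[of ?P id ?M] by blast
  have "\<not> u r' < w (f r)" if r: "r < r'" "r' < h" "f r < f r'" for r r'
  proof
    assume lt': "u r' < w (f r)"
    define g where "g = f \<circ> Transposition.transpose r r'"
    have gb: "bij_betw g {..<h} {..<h}"
      unfolding g_def using f r
      by (intro bij_betw_trans[OF permutes_imp_bij[OF permutes_swap_id]]) auto
    have g: "g r = f r'" "g r' = f r" "\<And>q. q \<noteq> r \<Longrightarrow> q \<noteq> r' \<Longrightarrow> g q = f q"
      by (auto simp: g_def)
    have "f r' < h" using f r by (auto simp: bij_betw_def)
    then have "w (f r) \<le> w (f r')" using r mono(2)[of "f r" "f r'"] by simp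
    moreover have "u r < w (f r)" using f r by simp
    ultimately have "u q < w (g q)" if "q < h" for q
      using f g lt' that by (cases "q = r"; cases "q = r'") auto
    then have "?P g" using gb by blast
    then have le: "?M f \<le> ?M g" by (rule least)
    have split: "(\<Sum>q<h. q * F q) = r * F r + r' * F r' + (\<Sum>q\<in>{..<h} - {r,r'}. q * F q)" for F :: "nat \<Rightarrow> nat"
      using r by (subst sum.subset_diff[of "{r,r'}"]) auto
    have "(\<Sum>q\<in>{..<h} - {r,r'}. q * f q) = (\<Sum>q\<in>{..<h} - {r,r'}. q * g q)"
      by (rule sum.cong) (auto simp: g)
    then have "r * f r + r' * f r' \<le> r * f r' + r' * f r"
      using le unfolding split[of f] split[of g] by (simp add: g(1,2))
    \<comment> \<open>With these differences the inequality becomes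
      \<open>Suc a * Suc b \<le> 0\<close>.\<close>
    moreover obtain a where "r' = r + Suc a" using r less_iff_Suc_add by auto
    moreover obtain b where "f r' = f r + Suc b" using r less_iff_Suc_add by auto
    ultimately show False by (simp add: algebra_simps)
  qed
  then show thesis using that f by blast
qed

lemma nc_array_exists:
  assumes mono: "\<And>k r r'. k < m \<Longrightarrow> r \<le> r' \<Longrightarrow> r' < h \<Longrightarrow> u k r \<le> u k r'"
    and lt: "\<And>k r. Suc k < m \<Longrightarrow> r < h \<Longrightarrow> u k r < u (Suc k) r"
  shows "\<exists>\<tau>. nc_array m h u \<tau>"
proof -
  let ?Q = "\<lambda>k f. bij_betw f {..<h} {..<h} \<and> (\<forall>r<h. u k r < u (Suc k) (f r)) \<and>
    (\<forall>r r'. r < r' \<longrightarrow> r' < h \<longrightarrow> f r < f r' \<longrightarrow> \<not> u k r' < u (Suc k) (f r))"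
  have "\<exists>f. ?Q k f" if k: "Suc k < m" for k
  proof -
    have "Suc k < m" "k < m" using k by auto
    note * = mono[OF this(2)] mono[OF this(1)] lt[OF this(1)]
    show ?thesis
    proof (rule nc_matching_exists[of h "u k" "u (Suc k)", OF *])
      fix f assume "bij_betw f {..<h} {..<h}" "\<And>r. r < h \<Longrightarrow> u k r < u (Suc k) (f r)"
        "\<And>r r'. r < r' \<Longrightarrow> r' < h \<Longrightarrow> f r < f r' \<Longrightarrow> \<not> u k r' < u (Suc k) (f r)"
      then show ?thesis by (intro exI[of _ f]) simp
    qed
  qed
  then obtain F where F: "\<And>k. Suc k < m \<Longrightarrow> ?Q k (F k)" by metis
  \<comment> \<open>Blocks are numbered by their rank in row \<open>0\<close>; later rows are
    reached by composing the matchings.\<close>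
  define \<tau> where "\<tau> k = rec_nat id (\<lambda>k g. F k \<circ> g) k" for k
  have \<tau>: "\<tau> 0 = id" "\<tau> (Suc k) = F k \<circ> \<tau> k" for k by (simp_all add: \<tau>_def)
  have b: "bij_betw (\<tau> k) {..<h} {..<h}" if "k < m" for k
    using that
  proof (induction k)
    case (Suc k)
    then show ?case using F[of k] unfolding \<tau> by (intro bij_betw_trans[of _ _ "{..<h}"]) auto
  qed (simp add: \<tau>)
  have l: "\<tau> k r < h" if "k < m" "r < h" for k r
    using b[OF that(1)] that(2) by (auto simp: bij_betw_def)
  have "nc_array m h u \<tau>"
    unfolding nc_array_def using b F l by (simp add: \<tau>)
  then show ?thesis by blast
qed

subsection \<open>Arrays and semi-noncrossing multisets\<close>

definition row_mset :: "nat set multiset \<Rightarrow> nat \<Rightarrow> nat multiset" where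
  "row_mset A k = {#sorted_list_of_set J ! k. J \<in># A#}"

definition sorted_row :: "nat set multiset \<Rightarrow> nat \<Rightarrow> nat \<Rightarrow> nat" where
  "sorted_row A k r = sorted_list_of_multiset (row_mset A k) ! r"

lemma sorted_list_of_set_image_lessThan:
  fixes f :: "nat \<Rightarrow> nat"
  assumes "\<And>k. Suc k < m \<Longrightarrow> f k < f (Suc k)"
  shows "sorted_list_of_set (f ` {..<m}) = map f [0..<m]"
    and "inj_on f {..<m}"
proof -
  have lt: "f i < f j" if "i < j" "j < m" for i j
    using that
  proof (induction j)
    case (Suc j)
    then show ?case using assms[of j] by (cases "i = j") auto
  qed simp
  have "sorted_wrt (<) (map f [0..<m])"
    by (auto simp: sorted_wrt_iff_nth_less intro: lt)
  then have "sorted (map f [0..<m])" "distinct (map f [0..<m])"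
    by (simp_all add: strict_sorted_iff)
  then show "sorted_list_of_set (f ` {..<m}) = map f [0..<m]"
    using sorted_list_of_set.idem_if_sorted_distinct[of "map f [0..<m]"] by (simp add: lessThan_atLeast0)
  show "inj_on f {..<m}"
    using \<open>distinct (map f [0..<m])\<close> by (simp add: distinct_map lessThan_atLeast0)
qed

lemma column_setsD:
  assumes "J \<in> column_sets m n"
  shows "finite J" "card J = m" "J \<subseteq> {1..m + n}"
    "length (sorted_list_of_set J) = m" "set (sorted_list_of_set J) = J"
    "\<And>i j. i < j \<Longrightarrow> j < m \<Longrightarrow> sorted_list_of_set J ! i < sorted_list_of_set J ! j"
proof -
  show f: "finite J" and c: "card J = m" "J \<subseteq> {1..m + n}"
    using assms by (auto simp: column_sets_def intro: finite_subset)
  show l: "length (sorted_list_of_set J) = m" "set (sorted_list_of_set J) = J"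
    using f c by simp_all
  show "sorted_list_of_set J ! i < sorted_list_of_set J ! j" if "i < j" "j < m" for i j
    using sorted_wrt_nth_less[OF strict_sorted_list_of_set, of i j J] that l by simp
qed

lemma column_sets_image:
  assumes "J \<in> column_sets m n"
  shows "(\<lambda>k. sorted_list_of_set J ! k) ` {..<m} = J"
  using column_setsD(4,5)[OF assms] nth_image[of m "sorted_list_of_set J"]
  by (simp add: lessThan_atLeast0)

section \<open>Segments of positions and their columns\<close>

definition cumulative :: "nat set multiset \<Rightarrow> nat \<Rightarrow> nat" where
  "cumulative A v = (\<Sum>u=1..v. column_multiplicity A u)"

lemma segment_Suc: "segment A (Suc v) = {cumulative A v + 1..cumulative A (Suc v)}"
  by (simp add: segment_def cumulative_def atLeastLessThanSuc_atLeastAtMost)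

lemma cumulative_mono: "v \<le> w \<Longrightarrow> cumulative A v \<le> cumulative A w"
  by (auto simp: cumulative_def intro: sum_mono2)

lemma column_multiplicity_add:
  "column_multiplicity (add_mset J A) v = (if v \<in> J then 1 else 0) + column_multiplicity A v"
  by (simp add: column_multiplicity_def)

text \<open>Double counting of the pairs of a factor and a column at most \<open>v\<close> in it.
  This form can be compared with a count of positions.\<close>

lemma cumulative_eq: "cumulative A v = (\<Sum>J\<in>#A. card (J \<inter> {1..v}))"
proof (induction A)
  case empty
  then show ?case by (simp add: cumulative_def column_multiplicity_def)
next
  case (add J A)
  have "(\<Sum>u=1..v. if u \<in> J then 1 else 0 :: nat) = card ({1..v} \<inter> J)"
    by (simp flip: sum.inter_restrict)
  then show ?case using add
    by (simp add: cumulative_def column_multiplicity_add sum.distrib Int_commute)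
qed

lemma cumulative_total:
  assumes "A \<in> plucker_monomials m n"
  shows "cumulative A (m + n) = m * size A"
  using assms
proof (induction A)
  case empty
  then show ?case by (simp add: cumulative_def column_multiplicity_def)
next
  case (add J A)
  then have "J \<inter> {1..m + n} = J" "card J = m" "A \<in> plucker_monomials m n"
    by (auto simp: plucker_monomials_def column_sets_def)
  then show ?case using add.IH by (simp add: cumulative_eq)
qed

text \<open>Taking the least \<open>v\<close> skips the columns that occur in no factor, whose
  segments are empty.\<close>

definition segment_index :: "nat set multiset \<Rightarrow> nat \<Rightarrow> nat" where
  "segment_index A x = (LEAST v. x \<le> cumulative A v)"

lemma segment_index:
  assumes A: "A \<in> plucker_monomials m n" and x: "x \<in> {1..m * size A}"
  shows "segment_index A x \<in> {1..m + n}" "v \<in> {1..m + n} \<Longrightarrow> x \<in> segment A v \<longleftrightarrow> v = segment_index A x"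
proof -
  let ?v = "segment_index A x"
  have le: "x \<le> cumulative A (m + n)" using cumulative_total[OF A] x by simp
  have 1: "x \<le> cumulative A ?v"
    unfolding segment_index_def using le by (rule LeastI)
  have 2: "w < ?v \<Longrightarrow> cumulative A w < x" for w
    unfolding segment_index_def by (metis not_less_Least not_le)
  have "?v \<noteq> 0"
  proof
    assume "?v = 0"
    then show False using 1 x by (simp add: cumulative_def)
  qed
  moreover have "?v \<le> m + n" unfolding segment_index_def using le by (rule Least_le)
  ultimately show "?v \<in> {1..m + n}" by simp
  assume "v \<in> {1..m + n}"
  then obtain w where w: "v = Suc w" by (cases v) auto
  show "x \<in> segment A v \<longleftrightarrow> v = ?v"
  proof
    assume "x \<in> segment A v"
    then have *: "cumulative A w < x" "x \<le> cumulative A v" by (auto simp: w segment_Suc)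
    have "?v \<le> v" using 2[of v] * by linarith
    moreover have "v \<le> ?v" using cumulative_mono[of ?v w A] * 1 w by linarith
    ultimately show "v = ?v" by simp
  next
    assume "v = ?v"
    then have "x \<le> cumulative A (Suc w)" "cumulative A w < x" using 1 2[of w] w by simp_all
    then show "x \<in> segment A v" by (simp add: w segment_Suc)
  qed
qed

lemma segment_index_mono:
  assumes "A \<in> plucker_monomials m n" "y \<in> {1..m * size A}" "x \<le> y"
  shows "segment_index A x \<le> segment_index A y"
proof -
  have "y \<le> cumulative A (m + n)" using cumulative_total[OF assms(1)] assms(2) by simp
  then have "y \<le> cumulative A (segment_index A y)"
    unfolding segment_index_def by (rule LeastI)
  then show ?thesis using assms(3) unfolding segment_index_def[of A x] by (intro Least_le) simp
qed

text \<open>A block meets each segment at most once, so passing from positions to columns is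
  strictly increasing on it, and its \<open>k\<close>-th position goes to the \<open>k\<close>-th
  element of its column set. The rank of that position among the \<open>k\<close>-th positions of
  all blocks defines \<open>\<tau> k\<close>.\<close>

lemma semi_noncrossing_imp_nc_array:
  assumes A: "A \<in> plucker_monomials m n" and nc: "semi_noncrossing m n A" and m: "m \<ge> 1"
  obtains \<tau> where "nc_array m (size A) (sorted_row A) \<tau>" "A = array_columns m (size A) (sorted_row A) \<tau>"
proof -
  obtain \<B> where part: "partition_on {1..m * size A} \<B>" and cB: "card \<B> = size A"
    and cb: "\<And>b. b \<in> \<B> \<Longrightarrow> card b = m"
    and ncr: "\<And>a b. a \<in> \<B> \<Longrightarrow> b \<in> \<B> \<Longrightarrow> a \<noteq> b \<Longrightarrow> noncrossing m a b"
    and le1: "\<And>b v. b \<in> \<B> \<Longrightarrow> v \<in> {1..m + n} \<Longrightarrow> card (b \<inter> segment A v) \<le> 1"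
    and mset: "{#{v \<in> {1..m + n}. \<exists>x\<in>b. x \<in> segment A v}. b \<in># mset_set \<B>#} = A"
    using nc unfolding semi_noncrossing_def by (elim exE conjE) (rule that; simp)
  define h where "h = size A"
  define val where "val = segment_index A"
  define e where "e b k = sorted_list_of_set b ! k" for b :: "nat set" and k
  have sub: "b \<subseteq> {1..m * size A}" if "b \<in> \<B>" for b
    using part that by (auto simp: partition_on_def)
  have finB: "finite \<B>"
    using part by (rule finite_elements[OF finite_atLeastAtMost])
  have finb: "finite b" if "b \<in> \<B>" for b using sub[OF that] finite_subset by blast
  have e_mem: "e b k \<in> b" if "b \<in> \<B>" "k < m" for b k
    using finb[OF that(1)] cb[OF that(1)] that(2) nth_mem[of k "sorted_list_of_set b"]
    by (simp add: e_def)
  have e_less: "e b i < e b j" if "b \<in> \<B>" "i < j" "j < m" for b i j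
    using sorted_wrt_nth_less[OF strict_sorted_list_of_set, of i j b] that cb[OF that(1)] by (simp add: e_def)
  have e_img: "e b ` {..<m} = b" if "b \<in> \<B>" for b
    using finb[OF that] cb[OF that] nth_image[of m "sorted_list_of_set b"] unfolding e_def
    by (simp add: lessThan_atLeast0)
  have e_inj: "inj_on (\<lambda>b. e b k) \<B>" if "k < m" for k
  proof (rule inj_onI)
    fix b b' assume *: "b \<in> \<B>" "b' \<in> \<B>" "e b k = e b' k"
    then show "b = b'"
      using e_mem[OF *(1) that] e_mem[OF *(2) that] part
      unfolding partition_on_def disjoint_def by (metis IntI empty_iff)
  qed
  have e_pos: "e b k \<in> {1..m * size A}" if "b \<in> \<B>" "k < m" for b k
    using e_mem[OF that] sub[OF that(1)] by blast
  have val_less: "val (e b i) < val (e b j)" if b: "b \<in> \<B>" and ij: "i < j" "j < m" for b i j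
  proof -
    have i: "i < m" using ij by simp
    have "val (e b i) \<noteq> val (e b j)"
    proof
      assume eq: "val (e b i) = val (e b j)"
      define v where "v = val (e b i)"
      have v: "v \<in> {1..m + n}" "e b i \<in> segment A v" "e b j \<in> segment A v"
        using segment_index[OF A e_pos[OF b i]] segment_index[OF A e_pos[OF b ij(2)]] eq
        by (auto simp: v_def val_def)
      then have "card {e b i, e b j} \<le> card (b \<inter> segment A v)"
        using finb[OF b] e_mem[OF b i] e_mem[OF b ij(2)] by (intro card_mono) auto
      then show False using le1[OF b v(1)] e_less[OF b ij] by simp
    qed
    moreover have "val (e b i) \<le> val (e b j)"
      unfolding val_def using e_less[OF b ij]
      by (intro segment_index_mono[OF A e_pos[OF b ij(2)]]) simp
    ultimately show ?thesis by simp
  qed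
  have cols: "{v \<in> {1..m + n}. \<exists>x\<in>b. x \<in> segment A v} = (\<lambda>k. val (e b k)) ` {..<m}" if "b \<in> \<B>" for b
  proof -
    have "{v \<in> {1..m + n}. \<exists>x\<in>b. x \<in> segment A v} = val ` b"
      using segment_index[OF A] sub[OF that] unfolding val_def by blast
    then show ?thesis using e_img[OF that] by (metis image_image)
  qed
  have Aeq: "A = {#(\<lambda>k. val (e b k)) ` {..<m}. b \<in># mset_set \<B>#}"
    by (rule trans[OF mset[symmetric]], rule image_mset_cong, rule cols) (simp add: finB)
  have rowm: "row_mset A k = {#val (e b k). b \<in># mset_set \<B>#}" if "k < m" for k
  proof -
    have "sorted_list_of_set ((\<lambda>k. val (e b k)) ` {..<m}) ! k = val (e b k)" if "b \<in> \<B>" for b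
      using sorted_list_of_set_image_lessThan(1)[of m "\<lambda>k. val (e b k)"] val_less[OF that] \<open>k < m\<close> by simp
    then show ?thesis
      unfolding row_mset_def using finB
      by (subst Aeq, unfold multiset.map_comp o_def, intro image_mset_cong) simp
  qed
  define L where "L k = sorted_list_of_set ((\<lambda>b. e b k) ` \<B>)" for k
  have lenL: "length (L k) = h" if "k < m" for k
    using card_image[OF e_inj[OF that]] cB by (simp add: L_def h_def)
  have setL: "set (L k) = (\<lambda>b. e b k) ` \<B>" for k
    using finB by (simp add: L_def)
  have L_less: "L k ! i < L k ! j" if "k < m" "i < j" "j < h" for k i j
    using sorted_wrt_nth_less[OF strict_sorted_list_of_set, of i j "(\<lambda>b. e b k) ` \<B>"] that lenL[OF that(1)] by (simp add: L_def)
  \<comment> \<open>Positions go weakly monotonically to columns, so the increasing list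
    \<open>L k\<close> becomes the sorted row \<open>k\<close>.\<close>
  have rowL: "sorted_row A k r = val (L k ! r)" if k: "k < m" and r: "r < h" for k r
  proof -
    have "L k ! i \<in> {1..m * size A}" if "i < h" for i
      using setL[of k] lenL[OF k] nth_mem[of i "L k"] that e_pos k by auto
    then have "sorted (map val (L k))"
      using L_less[OF k] lenL[OF k] segment_index_mono[OF A]
      by (auto simp: sorted_iff_nth_mono val_def order_le_less)
    moreover have "mset (map val (L k)) = row_mset A k"
    proof -
      have "mset (map val (L k)) = image_mset val (mset_set ((\<lambda>b. e b k) ` \<B>))"
        by (simp add: L_def finB flip: mset_set_set)
      also have "\<dots> = image_mset val {#e b k. b \<in># mset_set \<B>#}"
        by (simp only: image_mset_mset_set[OF e_inj[OF k]])
      also have "\<dots> = row_mset A k"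
        by (simp add: rowm[OF k] multiset.map_comp o_def)
      finally show ?thesis .
    qed
    ultimately have "sorted_list_of_multiset (row_mset A k) = map val (L k)"
      by (metis sorted_list_of_multiset_mset sorted_sort_id)
    then show ?thesis using r lenL[OF k] by (simp add: sorted_row_def)
  qed
  obtain \<beta> where \<beta>: "bij_betw \<beta> {..<h} \<B>"
    using finB cB unfolding h_def by (metis ex_bij_betw_nat_finite lessThan_atLeast0)
  have \<beta>in: "\<beta> r \<in> \<B>" if "r < h" for r using \<beta> that by (auto simp: bij_betw_def)
  define \<tau> where "\<tau> k = inv_into {..<h} ((!) (L k)) \<circ> ((\<lambda>b. e b k) \<circ> \<beta>)" for k
  have bL: "bij_betw ((!) (L k)) {..<h} ((\<lambda>b. e b k) ` \<B>)" if "k < m" for k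
    by (rule bij_betw_nth) (simp_all only: lenL[OF that] setL, simp add: L_def)
  have be: "bij_betw (\<lambda>b. e b k) \<B> ((\<lambda>b. e b k) ` \<B>)" if "k < m" for k
    using e_inj[OF that] by (rule inj_on_imp_bij_betw)
  have b\<tau>: "bij_betw (\<tau> k) {..<h} {..<h}" if "k < m" for k
    unfolding \<tau>_def
    by (rule bij_betw_trans[OF bij_betw_trans[OF \<beta> be[OF that]] bij_betw_inv_into[OF bL[OF that]]])
  have \<tau>h: "\<tau> k r < h" if "k < m" "r < h" for k r
    using bij_betwE[OF b\<tau>[OF that(1)]] that(2) by simp
  have L\<tau>: "L k ! \<tau> k r = e (\<beta> r) k" if "k < m" "r < h" for k r
    using bij_betw_inv_into_right[OF bL[OF that(1)]] \<beta>in[OF that(2)] by (simp add: \<tau>_def)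
  have row\<tau>: "sorted_row A k (\<tau> k r) = val (e (\<beta> r) k)" if "k < m" "r < h" for k r
    using rowL[OF that(1) \<tau>h[OF that]] L\<tau>[OF that] by simp
  have \<tau>less: "e (\<beta> r) k < e (\<beta> r') k" if "k < m" "r < h" "r' < h" "\<tau> k r < \<tau> k r'" for k r r'
    using L_less[OF that(1,4) \<tau>h[OF that(1,3)]] L\<tau>[OF that(1,2)] L\<tau>[OF that(1,3)] by simp
  have arr: "nc_array m h (sorted_row A) \<tau>"
    unfolding nc_array_def
  proof (intro conjI allI impI)
    show "bij_betw (\<tau> k) {..<h} {..<h}" if "k < m" for k by (rule b\<tau>[OF that])
    show "sorted_row A k (\<tau> k r) < sorted_row A (Suc k) (\<tau> (Suc k) r)" if "Suc k < m" "r < h" for k r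
      using row\<tau>[of k r] row\<tau>[of "Suc k" r] val_less[OF \<beta>in[OF that(2)], of k "Suc k"] that by simp
    show "\<not> sorted_row A k (\<tau> k r') < sorted_row A (Suc k) (\<tau> (Suc k) r)"
      if k: "Suc k < m" and r: "r < h" "r' < h" and lt: "\<tau> k r < \<tau> k r'" "\<tau> (Suc k) r < \<tau> (Suc k) r'" for k r r'
    proof
      assume "sorted_row A k (\<tau> k r') < sorted_row A (Suc k) (\<tau> (Suc k) r)"
      then have v: "val (e (\<beta> r') k) < val (e (\<beta> r) (Suc k))"
        using row\<tau>[of k r'] row\<tau>[of "Suc k" r] k r by simp
      \<comment> \<open>Monotonicity is used backwards: a strict inequality of columns forces one of
        positions, so a crossing in the array would be a crossing of blocks.\<close>
      have "e (\<beta> r') k < e (\<beta> r) (Suc k)"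
        using v segment_index_mono[OF A e_pos[of "\<beta> r'" k], of "e (\<beta> r) (Suc k)"] k \<beta>in r
        unfolding val_def by (meson Suc_lessD leD leI)
      moreover have "e (\<beta> r) k < e (\<beta> r') k" "e (\<beta> r) (Suc k) < e (\<beta> r') (Suc k)"
        using \<tau>less[of k r r'] \<tau>less[of "Suc k" r r'] k r lt by auto
      moreover have "\<beta> r \<noteq> \<beta> r'" using calculation by auto
      then have "noncrossing m (\<beta> r) (\<beta> r')" using ncr \<beta>in r by blast
      ultimately show False using k by (auto simp: noncrossing_def e_def Let_def)
    qed
  qed
  have "mset_set \<B> = image_mset \<beta> (mset_set {..<h})"
    using \<beta> by (simp add: image_mset_mset_set bij_betw_def)
  then have "A = {#(\<lambda>k. val (e (\<beta> r) k)) ` {..<m}. r \<in># mset_set {..<h}#}"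
    by (subst Aeq) (simp add: multiset.map_comp o_def)
  also have "\<dots> = array_columns m h (sorted_row A) \<tau>"
    unfolding array_columns_def using row\<tau>
    by (intro image_mset_cong image_cong) auto
  finally show thesis using that arr unfolding h_def by blast
qed

text \<open>Strict growth along a block makes its entries a column set whose \<open>k\<close>-th
  element is the entry in row \<open>k\<close>. Since \<open>\<tau> k\<close> permutes the ranks,
  row \<open>k\<close> is unchanged as a multiset.\<close>

lemma array_columns_props:
  assumes arr: "nc_array m h u \<tau>"
    and range: "\<And>k r. k < m \<Longrightarrow> r < h \<Longrightarrow> u k r \<in> {1..m + n}"
    and A: "A = array_columns m h u \<tau>"
  shows "A \<in> plucker_monomials m n" and "size A = h"
    and "k < m \<Longrightarrow> row_mset A k = image_mset (u k) (mset_set {..<h})"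
proof -
  define c where "c r k = u k (\<tau> k r)" for r k
  have \<tau>h: "\<tau> k r < h" if "k < m" "r < h" for k r
    using bij_betwE[OF nc_arrayD(1)[OF arr that(1)]] that(2) by simp
  have c: "sorted_list_of_set (c r ` {..<m}) = map (c r) [0..<m]" "inj_on (c r) {..<m}" if "r < h" for r
    using sorted_list_of_set_image_lessThan[of m "c r"] nc_arrayD(2)[OF arr _ that] by (auto simp: c_def)
  have Ac: "A = {#c r ` {..<m}. r \<in># mset_set {..<h}#}"
    by (simp add: A array_columns_def c_def)
  have "c r ` {..<m} \<in> column_sets m n" if "r < h" for r
    using card_image[OF c(2)[OF that]] range \<tau>h that by (auto simp: column_sets_def c_def)
  then show "A \<in> plucker_monomials m n"
    by (auto simp: plucker_monomials_def Ac)
  show "size A = h" by (simp add: Ac)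
  assume k: "k < m"
  have "row_mset A k = {#u k (\<tau> k r). r \<in># mset_set {..<h}#}"
    unfolding row_mset_def Ac multiset.map_comp o_def
    using c k by (intro image_mset_cong) (simp add: c_def)
  also have "\<dots> = image_mset (u k) (image_mset (\<tau> k) (mset_set {..<h}))"
    by (simp add: multiset.map_comp o_def)
  also have "image_mset (\<tau> k) (mset_set {..<h}) = mset_set {..<h}"
    using nc_arrayD(1)[OF arr k] by (simp add: image_mset_mset_set bij_betw_def)
  finally show "row_mset A k = image_mset (u k) (mset_set {..<h})" .
qed

text \<open>An array allows an entry of row \<open>k\<close> to equal an entry of row
  \<open>Suc k\<close> in places where a smaller value would cross. Such a tie must not turn into a
  crossing of positions, so among equal values the later row has to come first.\<close>

lemma array_columns_semi_noncrossing:
  assumes arr: "nc_array m h u \<tau>" and m: "m \<ge> 1"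
    and mono: "\<And>k r r'. k < m \<Longrightarrow> r \<le> r' \<Longrightarrow> r' < h \<Longrightarrow> u k r \<le> u k r'"
    and range: "\<And>k r. k < m \<Longrightarrow> r < h \<Longrightarrow> u k r \<in> {1..m + n}"
    and A: "A = array_columns m h u \<tau>"
  shows "semi_noncrossing m n A"
proof -
  note props = array_columns_props[OF arr range A]
  define c where "c r k = u k (\<tau> k r)" for r k
  have \<tau>h: "\<tau> k r < h" if "k < m" "r < h" for k r
    using bij_betwE[OF nc_arrayD(1)[OF arr that(1)]] that(2) by simp
  have \<tau>inj: "r = r'" if "\<tau> k r = \<tau> k r'" "k < m" "r < h" "r' < h" for k r r'
    using inj_onD[OF bij_betw_imp_inj_on[OF nc_arrayD(1)[OF arr that(2)]] that(1)] that by simp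
  have \<tau>surj: "\<exists>q<h. \<tau> k q = r" if "k < m" "r < h" for k r
  proof -
    have "r \<in> \<tau> k ` {..<h}"
      using bij_betw_imp_surj_on[OF nc_arrayD(1)[OF arr that(1)]] that(2) by simp
    then show ?thesis by auto
  qed
  have cless: "c r k < c r (Suc k)" if "Suc k < m" "r < h" for r k
    using nc_arrayD(2)[OF arr that] by (simp add: c_def)
  have cinj: "inj_on (c r) {..<m}" if "r < h" for r
    using sorted_list_of_set_image_lessThan(2)[of m "c r"] cless that by blast
  have Ac: "A = {#c r ` {..<m}. r \<in># mset_set {..<h}#}"
    by (simp add: A array_columns_def c_def)
  \<comment> \<open>Positions are ordered by value, then by decreasing row, then by rank within the row.\<close>
  define off where "off k r = (m - Suc k) * h + r" for k r
  define key where "key k r = u k r * (m * h) + off k r" for k r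
  have off: "off k r < m * h" if "k < m" "r < h" for k r
  proof -
    have "off k r < Suc (m - Suc k) * h" using that by (simp add: off_def)
    also have "\<dots> \<le> m * h" using that by (intro mult_le_mono1) simp
    finally show ?thesis .
  qed
  have key_div: "key k r div (m * h) = u k r" "key k r mod (m * h) = off k r" if "k < m" "r < h" for k r
  proof -
    have *: "(a * N + q) div N = a" "(a * N + q) mod N = q" if "q < N" for a q N :: nat
      using that by auto
    show "key k r div (m * h) = u k r" "key k r mod (m * h) = off k r"
      unfolding key_def by (rule *[OF off[OF that]])+
  qed
  have off_eq: "k = k' \<and> r = r'" if "off k r = off k' r'" "k < m" "r < h" "k' < m" "r' < h" for k r k' r'
  proof -
    have *: "(a * h + q) div h = a" "(a * h + q) mod h = q" if "q < h" for a q
      using that by auto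
    have "m - Suc k = m - Suc k'" "r = r'"
      using arg_cong[OF that(1), of "\<lambda>x. x div h"] arg_cong[OF that(1), of "\<lambda>x. x mod h"] that(3,5)
      by (simp_all only: off_def *)
    then show ?thesis using that by simp
  qed
  have key_eq: "k = k' \<and> r = r'" if "key k r = key k' r'" "k < m" "r < h" "k' < m" "r' < h" for k r k' r'
    using off_eq[OF _ that(2-5)] key_div(2)[OF that(2,3)] key_div(2)[OF that(4,5)] that(1) by metis
  have key_less: "key k r < key k' r'" if "u k r < u k' r'" "k < m" "r < h" "k' < m" "r' < h" for k r k' r'
  proof (rule ccontr)
    assume "\<not> key k r < key k' r'"
    then have "u k' r' \<le> u k r"
      using div_le_mono[of "key k' r'" "key k r" "m * h"] key_div(1)[OF that(2,3)] key_div(1)[OF that(4,5)]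
      by simp
    then show False using that(1) by simp
  qed
  define K where "K = (\<lambda>(k, r). key k r) ` ({..<m} \<times> {..<h})"
  have keyK: "key k r \<in> K" if "k < m" "r < h" for k r
    using that by (auto simp: K_def)
  have finK: "finite K" by (simp add: K_def)
  have "inj_on (\<lambda>(k, r). key k r) ({..<m} \<times> {..<h})"
    by (auto simp: inj_on_def dest: key_eq)
  then have cardK: "card K = m * h" by (simp add: K_def card_image)
  \<comment> \<open>Keys have gaps; counting the keys up to \<open>x\<close> compresses them to the
    positions from \<open>1\<close> to \<open>m * h\<close>.\<close>
  define pos where "pos x = card {y \<in> K. y \<le> x}" for x
  have pos_less: "pos x < pos y" if "x < y" "y \<in> K" for x y
  proof -
    have "{z \<in> K. z \<le> x} \<subseteq> {z \<in> K. z \<le> y}" "y \<in> {z \<in> K. z \<le> y}" "y \<notin> {z \<in> K. z \<le> x}"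
      using that by auto
    then show ?thesis unfolding pos_def using finK by (intro psubset_card_mono) auto
  qed
  have pos_inj: "inj_on pos K"
  proof (rule inj_onI)
    fix x y assume "x \<in> K" "y \<in> K" "pos x = pos y"
    then show "x = y" using pos_less[of x y] pos_less[of y x] by (cases x y rule: linorder_cases) auto
  qed
  have "pos ` K \<subseteq> {1..m * h}"
  proof
    fix i assume "i \<in> pos ` K"
    then obtain x where x: "x \<in> K" "i = pos x" by blast
    have "card {x} \<le> pos x"
      unfolding pos_def using x finK by (intro card_mono) auto
    moreover have "pos x \<le> card K"
      unfolding pos_def using finK by (intro card_mono) auto
    ultimately have "1 \<le> pos x" "pos x \<le> card K" by simp_all
    then show "i \<in> {1..m * h}" using x cardK by simp
  qed
  then have pos_img: "pos ` K = {1..m * h}"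
    using card_image[OF pos_inj] cardK by (intro card_subset_eq) auto
  define P where "P k r = pos (key k r)" for k r
  have P_range: "P k r \<in> {1..m * h}" if "k < m" "r < h" for k r
    using pos_img keyK[OF that] by (auto simp: P_def)
  have P_eq: "k = k' \<and> r = r'" if "P k r = P k' r'" "k < m" "r < h" "k' < m" "r' < h" for k r k' r'
    using inj_onD[OF pos_inj, of "key k r" "key k' r'"] key_eq[of k r k' r'] keyK that by (simp add: P_def)
  have P_less: "key k r < key k' r'" if "P k r < P k' r'" "k < m" "r < h" for k r k' r'
    using that(1) pos_less[of "key k' r'" "key k r"] keyK[OF that(2,3)] unfolding P_def
    by (cases "key k r" "key k' r'" rule: linorder_cases) auto
  \<comment> \<open>The right-hand side counts the positions of value at most \<open>v\<close>. The
    ends of every segment are given by such counts, so an entry of value \<open>v\<close> lands in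
    \<open>segment A v\<close>.\<close>
  have cum: "cumulative A v = card {x \<in> K. x div (m * h) \<le> v}" for v
  proof -
    have "card (c r ` {..<m} \<inter> {1..v}) = card {k \<in> {..<m}. c r k \<le> v}" if "r < h" for r
    proof -
      have "c r ` {..<m} \<inter> {1..v} = c r ` {k \<in> {..<m}. c r k \<le> v}"
        using range \<tau>h that by (fastforce simp: c_def)
      moreover have "{k \<in> {..<m}. c r k \<le> v} \<subseteq> {..<m}" by auto
      ultimately show ?thesis
        using card_image[OF inj_on_subset[OF cinj[OF that]]] by metis
    qed
    then have "cumulative A v = (\<Sum>r<h. card {k \<in> {..<m}. c r k \<le> v})"
      unfolding cumulative_eq Ac multiset.map_comp o_def sum_unfold_sum_mset[symmetric] by simp
    also have "\<dots> = card (SIGMA r:{..<h}. {k \<in> {..<m}. c r k \<le> v})" by simp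
    also have "\<dots> = card {x \<in> K. x div (m * h) \<le> v}"
    proof (rule bij_betw_same_card[of "\<lambda>(r, k). key k (\<tau> k r)"], rule bij_betw_imageI)
      show "inj_on (\<lambda>(r, k). key k (\<tau> k r)) (SIGMA r:{..<h}. {k \<in> {..<m}. c r k \<le> v})"
      proof (rule inj_onI)
        fix x y assume "x \<in> (SIGMA r:{..<h}. {k \<in> {..<m}. c r k \<le> v})" "y \<in> (SIGMA r:{..<h}. {k \<in> {..<m}. c r k \<le> v})"
          and eq: "(\<lambda>(r, k). key k (\<tau> k r)) x = (\<lambda>(r, k). key k (\<tau> k r)) y"
        then obtain r k r' k' where xy: "x = (r, k)" "y = (r', k')" "r < h" "k < m" "r' < h" "k' < m" by auto
        then have "key k (\<tau> k r) = key k' (\<tau> k' r')" using eq by simp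
        then have "k = k'" "\<tau> k r = \<tau> k' r'"
          using key_eq[of k "\<tau> k r" k' "\<tau> k' r'"] xy \<tau>h by blast+
        then show "x = y" using xy \<tau>inj[of k r r'] by simp
      qed
      show "(\<lambda>(r, k). key k (\<tau> k r)) ` (SIGMA r:{..<h}. {k \<in> {..<m}. c r k \<le> v}) = {x \<in> K. x div (m * h) \<le> v}"
      proof (intro equalityI subsetI)
        fix x assume "x \<in> (\<lambda>(r, k). key k (\<tau> k r)) ` (SIGMA r:{..<h}. {k \<in> {..<m}. c r k \<le> v})"
        then show "x \<in> {x \<in> K. x div (m * h) \<le> v}"
          using key_div(1) keyK \<tau>h by (auto simp: c_def)
      next
        fix x assume "x \<in> {x \<in> K. x div (m * h) \<le> v}"
        then obtain k r where x: "x = key k r" "k < m" "r < h" "u k r \<le> v"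
          using key_div(1) by (auto simp: K_def)
        obtain q where q: "q < h" "\<tau> k q = r" using \<tau>surj[OF x(2,3)] by blast
        then have "(q, k) \<in> (SIGMA r:{..<h}. {k \<in> {..<m}. c r k \<le> v})" using x by (simp add: c_def)
        then show "x \<in> (\<lambda>(r, k). key k (\<tau> k r)) ` (SIGMA r:{..<h}. {k \<in> {..<m}. c r k \<le> v})"
          using x q by (intro image_eqI) auto
      qed
    qed
    finally show ?thesis .
  qed
  have P_seg: "P k r \<in> segment A (u k r)" if "k < m" "r < h" for k r
  proof -
    have "u k r \<noteq> 0" using range[OF that] by simp
    then obtain w where w: "u k r = Suc w" by (cases "u k r") auto
    have d: "key k r div (m * h) = Suc w" using key_div(1)[OF that] w by simp
    have "y < key k r" if "y div (m * h) \<le> w" for y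
      using d that div_le_mono[of "key k r" y "m * h"] by linarith
    \<comment> \<open>\<open>P k r\<close> counts the entry itself in addition to all entries of
      smaller value, so it lies strictly above the lower bound.\<close>
    then have "insert (key k r) {x \<in> K. x div (m * h) \<le> w} \<subseteq> {y \<in> K. y \<le> key k r}"
      using keyK[OF that] by (auto intro: less_imp_le)
    then have "card (insert (key k r) {x \<in> K. x div (m * h) \<le> w}) \<le> P k r"
      unfolding P_def pos_def using finK by (intro card_mono) auto
    then have "cumulative A w < P k r" using d finK by (simp add: cum)
    moreover have "{y \<in> K. y \<le> key k r} \<subseteq> {x \<in> K. x div (m * h) \<le> Suc w}"
      using div_le_mono[of _ "key k r" "m * h"] by (auto simp: d)
    then have "P k r \<le> cumulative A (Suc w)"
      unfolding P_def pos_def cum using finK by (intro card_mono) auto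
    ultimately show ?thesis by (simp add: w segment_Suc)
  qed
  have P_seg_iff: "P k r \<in> segment A v \<longleftrightarrow> v = u k r" if "k < m" "r < h" "v \<in> {1..m + n}" for k r v
    using segment_index(2)[OF props(1), of "P k r"] P_range[OF that(1,2)] P_seg[OF that(1,2)]
      range[OF that(1,2)] that(3) by (simp add: props(2))
  define b where "b r = (\<lambda>k. P k (\<tau> k r)) ` {..<m}" for r
  have bsort: "sorted_list_of_set (b r) ! k = P k (\<tau> k r)" "card (b r) = m" if r: "r < h" and k: "k < m" for r k
  proof -
    have "P k (\<tau> k r) < P (Suc k) (\<tau> (Suc k) r)" if "Suc k < m" for k
      unfolding P_def using cless[OF that r] that r \<tau>h
      by (intro pos_less key_less keyK) (auto simp: c_def)
    note * = sorted_list_of_set_image_lessThan[of m "\<lambda>k. P k (\<tau> k r)", OF this]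
    show "sorted_list_of_set (b r) ! k = P k (\<tau> k r)" "card (b r) = m"
      using *(1) k card_image[OF *(2)] by (simp_all add: b_def)
  qed
  have b_disj: "r = r'" if x: "x \<in> b r" "x \<in> b r'" and r: "r < h" "r' < h" for x r r'
  proof -
    obtain i j where ij: "i < m" "x = P i (\<tau> i r)" "j < m" "x = P j (\<tau> j r')"
      using x by (auto simp: b_def)
    have "P i (\<tau> i r) = P j (\<tau> j r')" using ij by simp
    then have "i = j" "\<tau> i r = \<tau> j r'"
      using P_eq[of i "\<tau> i r" j "\<tau> j r'"] ij r \<tau>h by blast+
    then show ?thesis using \<tau>inj[of i r r'] ij r by simp
  qed
  have b_ne: "b r \<noteq> {}" for r using m by (auto simp: b_def lessThan_empty_iff)
  have b_inj: "inj_on b {..<h}"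
  proof (rule inj_onI)
    fix r r' assume "r \<in> {..<h}" "r' \<in> {..<h}" "b r = b r'"
    moreover obtain x where "x \<in> b r" using b_ne by blast
    ultimately show "r = r'" using b_disj[of x r r'] by simp
  qed
  have "\<Union> (b ` {..<h}) = {1..m * h}"
  proof (intro equalityI subsetI)
    fix x assume "x \<in> \<Union> (b ` {..<h})"
    then show "x \<in> {1..m * h}" using P_range \<tau>h by (auto simp: b_def)
  next
    fix x assume "x \<in> {1..m * h}"
    then obtain k r where x: "x = P k r" "k < m" "r < h"
      unfolding pos_img[symmetric] by (auto simp: K_def P_def)
    obtain q where "q < h" "\<tau> k q = r" using \<tau>surj[OF x(2,3)] by blast
    then show "x \<in> \<Union> (b ` {..<h})" using x by (auto simp: b_def)
  qed
  then have part: "partition_on {1..m * h} (b ` {..<h})"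
    unfolding partition_on_def
  proof (intro conjI disjointI)
    fix p q assume pq: "p \<in> b ` {..<h}" "q \<in> b ` {..<h}" "p \<noteq> q"
    then obtain r r' where r: "p = b r" "q = b r'" "r < h" "r' < h" by auto
    then have "r \<noteq> r'" using pq(3) by blast
    then show "p \<inter> q = {}" using b_disj[OF _ _ r(3,4)] r(1,2) by blast
  next
    show "{} \<notin> b ` {..<h}" using b_ne by (metis imageE)
  qed
  have nc: "noncrossing m (b r) (b r')" if r: "r < h" "r' < h" for r r'
  proof -
    have no: "\<not> (P k (\<tau> k r) < P k (\<tau> k r') \<and> P k (\<tau> k r') < P (Suc k) (\<tau> (Suc k) r) \<and>
        P (Suc k) (\<tau> (Suc k) r) < P (Suc k) (\<tau> (Suc k) r'))"
      if k: "Suc k < m" and r: "r < h" "r' < h" for k r r'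
    proof (intro notI, elim conjE)
      assume lt: "P k (\<tau> k r) < P k (\<tau> k r')" "P k (\<tau> k r') < P (Suc k) (\<tau> (Suc k) r)"
        "P (Suc k) (\<tau> (Suc k) r) < P (Suc k) (\<tau> (Suc k) r')"
      have P_row: "s < s'" if "P i s < P i s'" "i < m" "s < h" "s' < h" for i s s'
      proof (rule ccontr)
        assume "\<not> s < s'"
        then have "key i s' \<le> key i s"
          using mono[of i s' s] that unfolding key_def off_def by (intro add_mono mult_le_mono1) auto
        then show False using P_less[OF that(1-3)] by simp
      qed
      have km: "k < m" using k by simp
      have "\<tau> k r < \<tau> k r'" "\<tau> (Suc k) r < \<tau> (Suc k) r'"
        using P_row lt k km r \<tau>h by blast+
      then have "\<not> u k (\<tau> k r') < u (Suc k) (\<tau> (Suc k) r)"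
        using nc_arrayD(3)[OF arr k r] by blast
      then have "u (Suc k) (\<tau> (Suc k) r) * (m * h) \<le> u k (\<tau> k r') * (m * h)"
        by (intro mult_le_mono1) simp
      \<comment> \<open>Passing from row \<open>k\<close> to row \<open>Suc k\<close> lowers the
        offset by a full \<open>h\<close>, more than a rank below \<open>h\<close> can
        restore.\<close>
      moreover have "off (Suc k) (\<tau> (Suc k) r) < off k (\<tau> k r')"
      proof -
        have "m - Suc k = Suc (m - Suc (Suc k))" using k by simp
        then show ?thesis using \<tau>h[OF k r(1)] by (simp add: off_def)
      qed
      ultimately have "key (Suc k) (\<tau> (Suc k) r) < key k (\<tau> k r')"
        unfolding key_def by (rule add_le_less_mono)
      then show False using P_less[OF lt(2) km \<tau>h[OF km r(2)]] by simp
    qed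
    show ?thesis
      unfolding noncrossing_def Let_def
      using no[OF _ r] no[OF _ r(2) r(1)] bsort(1)[OF r(1)] bsort(1)[OF r(2)] by auto
  qed
  have cards: "card (b r \<inter> segment A v) \<le> 1" if r: "r < h" and v: "v \<in> {1..m + n}" for r v
  proof -
    have "x = y" if x: "x \<in> b r" "x \<in> segment A v" and y: "y \<in> b r" "y \<in> segment A v" for x y
    proof -
      obtain i j where ij: "i < m" "x = P i (\<tau> i r)" "j < m" "y = P j (\<tau> j r)"
        using x y by (auto simp: b_def)
      have "c r i = c r j"
        using P_seg_iff[OF ij(1) \<tau>h[OF ij(1) r] v] P_seg_iff[OF ij(3) \<tau>h[OF ij(3) r] v] x y ij by (simp add: c_def)
      then have "i = j" using inj_onD[OF cinj[OF r]] ij by simp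
      then show ?thesis using ij by simp
    qed
    then show ?thesis
      by (subst One_nat_def, subst card_le_Suc0_iff_eq) (auto simp: b_def)
  qed
  have cols: "{v \<in> {1..m + n}. \<exists>x\<in>b r. x \<in> segment A v} = c r ` {..<m}" if r: "r < h" for r
  proof (intro equalityI subsetI)
    fix v assume "v \<in> {v \<in> {1..m + n}. \<exists>x\<in>b r. x \<in> segment A v}"
    then obtain k where "k < m" "P k (\<tau> k r) \<in> segment A v" "v \<in> {1..m + n}" by (auto simp: b_def)
    then show "v \<in> c r ` {..<m}" using P_seg_iff[OF _ \<tau>h[OF _ r]] by (auto simp: c_def)
  next
    fix v assume "v \<in> c r ` {..<m}"
    then obtain k where k: "k < m" "v = u k (\<tau> k r)" by (auto simp: c_def)
    then show "v \<in> {v \<in> {1..m + n}. \<exists>x\<in>b r. x \<in> segment A v}"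
      using P_seg[OF k(1) \<tau>h[OF k(1) r]] range[OF k(1) \<tau>h[OF k(1) r]] by (auto simp: b_def)
  qed
  have mset: "{#{v \<in> {1..m + n}. \<exists>x\<in>b. x \<in> segment A v}. b \<in># mset_set (b ` {..<h})#} = A"
    unfolding image_mset_mset_set[OF b_inj, symmetric] multiset.map_comp o_def
    by (rule trans[OF _ Ac[symmetric]], rule image_mset_cong, rule cols) simp
  show ?thesis
    unfolding semi_noncrossing_def
  proof (intro exI[of _ "b ` {..<h}"] conjI ballI impI)
    show "partition_on {1..m * size A} (b ` {..<h})" using part props(2) by simp
    show "card (b ` {..<h}) = size A" using card_image[OF b_inj] props(2) by simp
    show "card B = m" if "B \<in> b ` {..<h}" for B using that bsort(2)[of _ 0] m by auto
    show "noncrossing m B B'" if "B \<in> b ` {..<h}" "B' \<in> b ` {..<h}" for B B'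
      using that nc by blast
    show "card (B \<inter> segment A v) \<le> 1" if "B \<in> b ` {..<h}" "v \<in> {1..m + n}" for B v
      using that cards by blast
    show "{#{v \<in> {1..m + n}. \<exists>x\<in>b. x \<in> segment A v}. b \<in># mset_set (b ` {..<h})#} = A" by (rule mset)
  qed
qed

subsection \<open>Exchange relations\<close>

fun inv_count :: "nat list \<Rightarrow> nat" where
  "inv_count [] = 0"
| "inv_count (x # xs) = length (filter (\<lambda>y. y < x) xs) + inv_count xs"

lemma inv_count_eq_card: "card {(p, q). p < q \<and> q < length s \<and> s ! q < s ! p} = inv_count s"
proof (induction s)
  case (Cons x s)
  let ?A = "{q. q < length s \<and> s ! q < x}" and ?B = "{(p, q). p < q \<and> q < length s \<and> s ! q < s ! p}"
  let ?f = "\<lambda>q. (0 :: nat, Suc q)" and ?g = "\<lambda>(p, q). (Suc p, Suc q)"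
  have eq: "{(p, q). p < q \<and> q < length (x # s) \<and> (x # s) ! q < (x # s) ! p} = ?f ` ?A \<union> ?g ` ?B" (is "?L = ?R")
  proof (intro equalityI subsetI)
    fix z assume "z \<in> ?L"
    then obtain p q where z: "z = (p, q)" "p < q" "q < Suc (length s)" "(x # s) ! q < (x # s) ! p" by auto
    then obtain q' where q': "q = Suc q'" by (cases q) auto
    show "z \<in> ?R"
    proof (cases p)
      case 0
      then show ?thesis using z q' by auto
    next
      case (Suc p')
      then have "(p', q') \<in> ?B" using z q' by simp
      then show ?thesis using z(1) q' Suc by (intro UnI2 image_eqI[of _ _ "(p', q')"]) auto
    qed
  qed auto
  have "finite ?B" by (rule finite_subset[of _ "{..<length s} \<times> {..<length s}"]) auto
  moreover have "finite ?A" by simp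
  ultimately have "card ?L = card (?f ` ?A) + card (?g ` ?B)"
    unfolding eq by (intro card_Un_disjoint) auto
  also have "card (?f ` ?A) = card ?A" by (rule card_image) (auto simp: inj_on_def)
  also have "card (?g ` ?B) = card ?B" by (rule card_image) (auto simp: inj_on_def)
  finally show ?case using Cons by (simp add: length_filter_conv_card)
qed simp

lemma plucker_seq_eq:
  "plucker_seq s = (if distinct s then (-1) ^ inv_count s * plucker_var (set s) else 0)"
  by (simp add: plucker_seq_def inv_count_eq_card)

lemma inv_count_swap:
  "b < a \<Longrightarrow> inv_count (us @ a # b # vs) = Suc (inv_count (us @ b # a # vs))"
  by (induction us) auto

text \<open>One notion for formal Plucker coordinates and for minors, hence the arbitrary target
  ring. Adjacent entries suffice, since every other move is a sequence of adjacent swaps.\<close>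

definition alternating :: "(nat list \<Rightarrow> 'r::comm_ring_1) \<Rightarrow> bool" where
  "alternating F \<longleftrightarrow> (\<forall>us a b vs. F (us @ a # b # vs) = - F (us @ b # a # vs))"

lemma alternatingD: "alternating F \<Longrightarrow> F (us @ a # b # vs) = - F (us @ b # a # vs)"
  unfolding alternating_def by blast

lemma alternating_plucker_seq: "alternating plucker_seq"
  unfolding alternating_def
proof (intro allI)
  fix us vs :: "nat list" and a b :: nat
  show "plucker_seq (us @ a # b # vs) = - plucker_seq (us @ b # a # vs)"
  proof (cases a b rule: linorder_cases)
    case less
    then show ?thesis using inv_count_swap[of a b us vs]
      by (auto simp: plucker_seq_eq insert_commute)
  next
    case equal
    then show ?thesis by (simp add: plucker_seq_eq)
  next
    case greater
    then show ?thesis using inv_count_swap[of b a us vs]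
      by (auto simp: plucker_seq_eq insert_commute)
  qed
qed

lemma alternating_move:
  assumes "alternating F"
  shows "F (us @ a # vs @ ws) = (-1) ^ length vs * F (us @ vs @ a # ws)"
proof (induction vs arbitrary: us)
  case (Cons b vs)
  have "F (us @ a # b # vs @ ws) = - F (us @ b # a # vs @ ws)"
    by (rule alternatingD[OF assms])
  also have "F (us @ b # a # vs @ ws) = (-1) ^ length vs * F (us @ b # vs @ a # ws)"
    using Cons[of "us @ [b]"] by simp
  finally show ?case by simp
qed simp

text \<open>Carrying one entry across the middle part and the other one back gives the same sign
  twice; the adjacent swap in between leaves the minus.\<close>

lemma alternating_transpose:
  assumes "alternating F" "i < j" "j < m"
  shows "F (map (x \<circ> Transposition.transpose i j) [0..<m]) = - F (map x [0..<m])"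
proof -
  let ?a = "map x [0..<i]" and ?b = "map x [Suc i..<j]" and ?c = "map x [Suc j..<m]"
  have split: "[0..<m] = [0..<i] @ i # [Suc i..<j] @ j # [Suc j..<m]"
    using assms(2,3) upt_add_eq_append[of 0 i "m - i"] upt_add_eq_append[of "Suc i" j "m - j"]
    by (simp add: upt_conv_Cons)
  have x: "map x [0..<m] = ?a @ x i # ?b @ x j # ?c"
    by (simp add: split)
  have y: "map (x \<circ> Transposition.transpose i j) [0..<m] = ?a @ x j # ?b @ x i # ?c"
    unfolding split using assms(2) by (auto simp: Transposition.transpose_def)
  have "F (?a @ x j # ?b @ x i # ?c) = (-1) ^ length ?b * F (?a @ ?b @ x j # x i # ?c)"
    by (rule alternating_move[OF assms(1)])
  also have "F (?a @ ?b @ x j # x i # ?c) = - F (?a @ ?b @ x i # x j # ?c)"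
    using alternatingD[OF assms(1), of "?a @ ?b" "x j" "x i" ?c] by simp
  also have "(-1) ^ length ?b * - F (?a @ ?b @ x i # x j # ?c) = - F (?a @ x i # ?b @ x j # ?c)"
    by (simp add: alternating_move[OF assms(1)])
  finally show ?thesis by (simp only: x y)
qed

section \<open>Plucker relations as exchanges of entries\<close>

definition plucker_fun :: "nat \<Rightarrow> (nat \<Rightarrow> nat) \<Rightarrow> plucker_poly" where
  "plucker_fun m x = plucker_seq (map x [0..<m])"

lemma upt_split: "k < m \<Longrightarrow> [0..<m] = [0..<k] @ k # [Suc k..<m]"
  using upt_add_eq_append[of 0 k "m - k"] by (simp add: upt_conv_Cons)

lemma map_fun_upd_upt:
  "k < m \<Longrightarrow> map (x(k := z)) [0..<m] = map x [0..<k] @ z # map x [Suc k..<m]"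
  by (simp add: upt_split)

text \<open>The term \<open>l = 0\<close> of this relation is the product of the two coordinates,
  and every other term swaps \<open>y k\<close> with an entry of \<open>x\<close>. Each term puts
  the missing entry of \<open>y\<close> back at position \<open>k\<close>, which explains the common
  sign; the sign of moving \<open>y k\<close> into position \<open>p\<close> of \<open>x\<close>
  cancels against the sign of the relation.\<close>

lemma plucker_relation_exchange:
  fixes x y :: "nat \<Rightarrow> nat"
  assumes "k < m"
  defines "ks \<equiv> map y ([0..<k] @ [Suc k..<m])" and "js \<equiv> y k # map x [0..<m]"
  shows "plucker_relation ks js = (-1) ^ (m - Suc k) *
    (plucker_fun m x * plucker_fun m y - (\<Sum>p<m. plucker_fun m (x(p := y k)) * plucker_fun m (y(k := x p))))"
proof -
  define e :: plucker_poly where "e = (-1) ^ (m - Suc k)"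
  have ee: "e * e = 1" by (simp add: e_def flip: power_add mult_2)
  have "plucker_fun m (y(k := z)) = e * plucker_seq (ks @ [z])" for z
    using alternating_move[OF alternating_plucker_seq, of "map y [0..<k]" z "map y [Suc k..<m]" "[]"] assms(1)
    by (simp add: plucker_fun_def map_fun_upd_upt e_def ks_def)
  then have ks: "plucker_seq (ks @ [z]) = e * plucker_fun m (y(k := z))" for z
    using ee by (simp flip: mult.assoc)
  have len: "length js = Suc m" by (simp add: js_def)
  have js: "plucker_seq (take (Suc p) js @ drop (Suc (Suc p)) js) = (-1) ^ p * plucker_fun m (x(p := y k))" if "p < m" for p
    using alternating_move[OF alternating_plucker_seq, of "[]" "y k" "map x [0..<p]" "map x [Suc p..<m]"] that
    by (simp add: plucker_fun_def map_fun_upd_upt js_def take_map drop_map)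
  have "plucker_relation ks js = e * plucker_fun m y * plucker_fun m x
      + (\<Sum>p<m. (-1) ^ Suc p * plucker_seq (ks @ [js ! Suc p]) * plucker_seq (take (Suc p) js @ drop (Suc (Suc p)) js))"
    unfolding plucker_relation_def len sum.lessThan_Suc_shift
    by (simp add: ks js_def) (simp add: plucker_fun_def)
  also have "(\<Sum>p<m. (-1) ^ Suc p * plucker_seq (ks @ [js ! Suc p]) * plucker_seq (take (Suc p) js @ drop (Suc (Suc p)) js))
     = (\<Sum>p<m. - e * (plucker_fun m (x(p := y k)) * plucker_fun m (y(k := x p))))"
  proof (rule sum.cong)
    fix p assume "p \<in> {..<m}"
    then have p: "p < m" by simp
    have "js ! Suc p = x p" using p by (simp add: js_def)
    moreover have "(-1) ^ p * ((-1) ^ p * (z :: plucker_poly)) = z" for z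
      by (simp flip: mult.assoc power_add mult_2)
    ultimately show "(-1) ^ Suc p * plucker_seq (ks @ [js ! Suc p]) * plucker_seq (take (Suc p) js @ drop (Suc (Suc p)) js)
      = - e * (plucker_fun m (x(p := y k)) * plucker_fun m (y(k := x p)))"
      unfolding js[OF p] ks by (simp add: mult_ac)
  qed simp
  also have "e * plucker_fun m y * plucker_fun m x + \<dots> =
      e * (plucker_fun m x * plucker_fun m y - (\<Sum>p<m. plucker_fun m (x(p := y k)) * plucker_fun m (y(k := x p))))"
    by (simp add: sum_distrib_left sum_negf algebra_simps)
  finally show ?thesis by (simp add: e_def)
qed

text \<open>The entries of \<open>y\<close> are used in the order of their positions, while new
  positions of \<open>x\<close> are put at the front of the list; hence the partner of position
  \<open>i\<close> of \<open>y\<close> is \<open>rev ps ! i\<close>. Lists with repetitions are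
  meaningful too, as successive swaps.\<close>

fun exchange :: "nat list \<Rightarrow> (nat \<Rightarrow> nat) \<times> (nat \<Rightarrow> nat) \<Rightarrow> (nat \<Rightarrow> nat) \<times> (nat \<Rightarrow> nat)" where
  "exchange [] z = z"
| "exchange (p # ps) z =
     (let (x, y) = exchange ps z in (x(p := y (length ps)), y(length ps := x p)))"

lemma exchange_nth:
  assumes "distinct ps"
  shows "q \<notin> set ps \<Longrightarrow> fst (exchange ps (x, y)) q = x q"
    and "i < length ps \<Longrightarrow> fst (exchange ps (x, y)) (rev ps ! i) = y i"
    and "i < length ps \<Longrightarrow> snd (exchange ps (x, y)) i = x (rev ps ! i)"
    and "length ps \<le> i \<Longrightarrow> snd (exchange ps (x, y)) i = y i"
proof -
  have "(\<forall>q. q \<notin> set ps \<longrightarrow> fst (exchange ps (x, y)) q = x q) \<and>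
    (\<forall>i<length ps. fst (exchange ps (x, y)) (rev ps ! i) = y i) \<and>
    (\<forall>i<length ps. snd (exchange ps (x, y)) i = x (rev ps ! i)) \<and>
    (\<forall>i\<ge>length ps. snd (exchange ps (x, y)) i = y i)"
    using assms
  proof (induction ps)
    case (Cons p ps)
    then have p: "p \<notin> set ps" and d: "distinct ps" by auto
    have "rev ps ! i \<noteq> p" if "i < length ps" for i
      using p nth_mem[of i "rev ps"] that by auto
    then show ?case using Cons.IH[OF d] p
      by (auto simp: case_prod_unfold Let_def nth_append less_Suc_eq)
  qed simp
  then show "q \<notin> set ps \<Longrightarrow> fst (exchange ps (x, y)) q = x q"
    "i < length ps \<Longrightarrow> fst (exchange ps (x, y)) (rev ps ! i) = y i"
    "i < length ps \<Longrightarrow> snd (exchange ps (x, y)) i = x (rev ps ! i)"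
    "length ps \<le> i \<Longrightarrow> snd (exchange ps (x, y)) i = y i" by blast+
qed

text \<open>Position \<open>rev ps ! j\<close> already holds \<open>y j\<close>. Using it again puts
  \<open>y (length ps)\<close> there and moves \<open>y j\<close> to position
  \<open>length ps\<close> of the second factor, as if the two entries had been interchanged
  beforehand.\<close>

lemma exchange_repeat:
  assumes d: "distinct ps" and j: "j < length ps"
  shows "exchange (rev ps ! j # ps) (x, y) = exchange ps (x, y \<circ> Transposition.transpose j (length ps))"
proof -
  let ?k = "length ps" and ?y = "y \<circ> Transposition.transpose j (length ps)"
  let ?L = "exchange (rev ps ! j # ps) (x, y)" and ?R = "exchange ps (x, ?y)"
  have L: "fst ?L = (fst (exchange ps (x, y)))(rev ps ! j := y ?k)"
    "snd ?L = (snd (exchange ps (x, y)))(?k := y j)"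
    using exchange_nth[OF d, where x = x and y = y] j by (auto simp: case_prod_unfold Let_def)
  have "fst ?L q = fst ?R q" for q
  proof (cases "q \<in> set ps")
    case True
    then obtain i where i: "i < ?k" "q = rev ps ! i" by (metis in_set_conv_nth length_rev set_rev)
    have "rev ps ! i = rev ps ! j \<longleftrightarrow> i = j" using d i j by (simp add: nth_eq_iff_index_eq)
    then show ?thesis unfolding L using i j exchange_nth(2)[OF d, of i]
      by (auto simp: Transposition.transpose_def)
  next
    case False
    then show ?thesis unfolding L using j exchange_nth(1)[OF d False] nth_mem[of j "rev ps"] by auto
  qed
  moreover have "snd ?L i = snd ?R i" for i
    unfolding L using exchange_nth(3,4)[OF d] j
    by (cases "i < ?k") (auto simp: Transposition.transpose_def)
  ultimately show ?thesis by (intro prod_eqI ext) auto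
qed

text \<open>Ordered choices instead of sets of positions: this is the source of the factorials
  below.\<close>

definition exchange_lists :: "nat \<Rightarrow> nat \<Rightarrow> nat list set" where
  "exchange_lists m k = {ps. distinct ps \<and> length ps = k \<and> set ps \<subseteq> {..<m}}"

lemma finite_exchange_lists: "finite (exchange_lists m k)"
  by (rule finite_subset[OF _ finite_lists_length_eq[of "{..<m}" k]]) (auto simp: exchange_lists_def)

lemma sum_exchange_lists_Suc:
  "(\<Sum>ps\<in>exchange_lists m (Suc k). g ps) = (\<Sum>ps\<in>exchange_lists m k. \<Sum>p\<in>{..<m} - set ps. g (p # ps))"
proof -
  let ?S = "SIGMA ps:exchange_lists m k. {..<m} - set ps"
  have "exchange_lists m (Suc k) = (\<lambda>(ps, p). p # ps) ` ?S"
  proof (intro equalityI subsetI)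
    fix qs assume "qs \<in> exchange_lists m (Suc k)"
    then obtain p ps where "qs = p # ps" "(ps, p) \<in> ?S"
      by (cases qs) (auto simp: exchange_lists_def)
    then show "qs \<in> (\<lambda>(ps, p). p # ps) ` ?S" by force
  qed (auto simp: exchange_lists_def)
  moreover have "inj_on (\<lambda>(ps, p). p # ps) ?S" by (auto simp: inj_on_def)
  ultimately have "(\<Sum>ps\<in>exchange_lists m (Suc k). g ps) = (\<Sum>(ps, p)\<in>?S. g (p # ps))"
    by (simp add: sum.reindex case_prod_unfold)
  then show ?thesis by (simp add: sum.Sigma finite_exchange_lists)
qed

text \<open>Each step only swaps two entries between the factors. Applied to
  \<open>g v = 2 ^ v\<close>, this preserves the total weight of the pair.\<close>

lemma exchange_preserves:
  assumes "set ps \<subseteq> {..<m}" "length ps \<le> m"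
  shows "(\<Sum>p<m. g (fst (exchange ps (x, y)) p)) + (\<Sum>p<m. g (snd (exchange ps (x, y)) p))
    = (\<Sum>p<m. g (x p)) + (\<Sum>p<m. g (y p) :: nat)"
  using assms
proof (induction ps)
  case (Cons q ps)
  obtain X Y where XY: "exchange ps (x, y) = (X, Y)" by force
  have q: "q < m" "length ps < m" using Cons.prems by auto
  have upd: "(\<Sum>p<m. g ((X(i := z)) p)) + g (X i) = (\<Sum>p<m. g (X p)) + g z" if "i < m" for X i z
  proof -
    have "(\<Sum>p\<in>{..<m} - {i}. g ((X(i := z)) p)) = (\<Sum>p\<in>{..<m} - {i}. g (X p))"
      by (rule sum.cong) auto
    then show ?thesis using that by (simp add: sum.remove[of "{..<m}" i])
  qed
  have "(\<Sum>p<m. g (X p)) + (\<Sum>p<m. g (Y p)) = (\<Sum>p<m. g (x p)) + (\<Sum>p<m. g (y p))"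
    using Cons XY by simp
  then show ?case
    unfolding exchange.simps XY Let_def prod.case fst_conv snd_conv
    using upd[OF q(1), of X "Y (length ps)"] upd[OF q(2), of Y "X q"] by linarith
qed simp

lemma exchange_range:
  assumes "x ` {..<m} \<subseteq> V" "y ` {..<m} \<subseteq> V" "set ps \<subseteq> {..<m}" "length ps \<le> m"
  shows "fst (exchange ps (x, y)) ` {..<m} \<subseteq> V" "snd (exchange ps (x, y)) ` {..<m} \<subseteq> V"
proof -
  have "fst (exchange ps (x, y)) ` {..<m} \<subseteq> V \<and> snd (exchange ps (x, y)) ` {..<m} \<subseteq> V"
    using assms(3,4)
  proof (induction ps)
    case (Cons q ps)
    then show ?case by (auto simp: case_prod_unfold Let_def)
  qed (use assms in simp)
  then show "fst (exchange ps (x, y)) ` {..<m} \<subseteq> V" "snd (exchange ps (x, y)) ` {..<m} \<subseteq> V" by auto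
qed

text \<open>Lets the exchange identities be derived modulo any such set; the straightening takes the
  Plucker ideal.\<close>

definition additive_subgroup_set :: "'r::ab_group_add set \<Rightarrow> bool" where
  "additive_subgroup_set W \<longleftrightarrow> 0 \<in> W \<and> (\<forall>a\<in>W. \<forall>b\<in>W. a - b \<in> W)"

lemma additive_subgroup_set:
  assumes "additive_subgroup_set W"
  shows "0 \<in> W" "a \<in> W \<Longrightarrow> b \<in> W \<Longrightarrow> a - b \<in> W" "a \<in> W \<Longrightarrow> b \<in> W \<Longrightarrow> a + b \<in> W"
    "(\<And>i. i \<in> S \<Longrightarrow> g i \<in> W) \<Longrightarrow> (\<Sum>i\<in>S. g i) \<in> W"
proof -
  show 0: "0 \<in> W" and minus: "a \<in> W \<Longrightarrow> b \<in> W \<Longrightarrow> a - b \<in> W" for a b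
    using assms by (auto simp: additive_subgroup_set_def)
  show add: "a \<in> W \<Longrightarrow> b \<in> W \<Longrightarrow> a + b \<in> W" for a b
    using minus[of a "0 - b"] minus[of 0 b] 0 by simp
  show "(\<Sum>i\<in>S. g i) \<in> W" if "\<And>i. i \<in> S \<Longrightarrow> g i \<in> W"
    using that by (induction S rule: infinite_finite_induct) (auto intro: 0 add)
qed

text \<open>
  Exchanging one more position in every term of the \<open>k\<close>-fold exchange yields the
  \<open>(k+1)\<close>-fold exchange, plus terms in which a position is used twice; the latter are \<open>k\<close>-fold
  exchanges with two entries of the second factor transposed.
\<close>

lemma multiple_exchange:
  fixes f :: "(nat \<Rightarrow> nat) \<Rightarrow> (nat \<Rightarrow> nat) \<Rightarrow> 'r::{comm_ring_1, ring_char_0}"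
  assumes W: "additive_subgroup_set W"
    and alt: "\<And>x y i j. i < j \<Longrightarrow> j < m \<Longrightarrow> f x (y \<circ> Transposition.transpose i j) = - f x y"
    and ex: "\<And>x y k. k < m \<Longrightarrow> x ` {..<m} \<subseteq> V \<Longrightarrow> y ` {..<m} \<subseteq> V \<Longrightarrow>
      f x y - (\<Sum>p<m. f (x(p := y k)) (y(k := x p))) \<in> W"
    and "k \<le> m" and "x ` {..<m} \<subseteq> V" and "y ` {..<m} \<subseteq> V"
  shows "fact k * f x y - (\<Sum>ps\<in>exchange_lists m k. case_prod f (exchange ps (x, y))) \<in> W"
  using assms(4-6)
proof (induction k arbitrary: y)
  case 0
  have "exchange_lists m 0 = {[]}" by (auto simp: exchange_lists_def)
  then show ?case using additive_subgroup_set(1)[OF W] by simp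
next
  case (Suc k)
  define E where "E k y = (\<Sum>ps\<in>exchange_lists m k. case_prod f (exchange ps (x, y)))" for k y
  let ?t = "\<lambda>j. y \<circ> Transposition.transpose j k"
  have km: "k < m" using Suc.prems by simp
  have range_t: "?t j ` {..<m} \<subseteq> V" if "j < k" for j
  proof
    fix v assume "v \<in> ?t j ` {..<m}"
    then obtain i where "i < m" "v = y (Transposition.transpose j k i)" by auto
    moreover have "Transposition.transpose j k i < m" using \<open>i < m\<close> that km by (auto simp: Transposition.transpose_def)
    ultimately show "v \<in> V" using Suc.prems(3) by auto
  qed
  have "(\<Sum>ps\<in>exchange_lists m k. case_prod f (exchange ps (x, y)) - (\<Sum>p<m. case_prod f (exchange (p # ps) (x, y)))) \<in> W"
  proof (rule additive_subgroup_set(4)[OF W])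
    fix ps assume "ps \<in> exchange_lists m k"
    then have ps: "distinct ps" "length ps = k" "set ps \<subseteq> {..<m}" by (auto simp: exchange_lists_def)
    obtain X Y where XY: "exchange ps (x, y) = (X, Y)" by force
    have "X ` {..<m} \<subseteq> V" "Y ` {..<m} \<subseteq> V"
      using exchange_range[of x m V y ps] Suc.prems ps XY by auto
    from ex[OF km this] show "case_prod f (exchange ps (x, y)) - (\<Sum>p<m. case_prod f (exchange (p # ps) (x, y))) \<in> W"
      using XY ps by simp
  qed
  also have "(\<Sum>ps\<in>exchange_lists m k. case_prod f (exchange ps (x, y)) - (\<Sum>p<m. case_prod f (exchange (p # ps) (x, y))))
    = (\<Sum>ps\<in>exchange_lists m k. case_prod f (exchange ps (x, y)) -
        ((\<Sum>p\<in>{..<m} - set ps. case_prod f (exchange (p # ps) (x, y))) + (\<Sum>j<k. case_prod f (exchange ps (x, ?t j)))))"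
  proof (rule sum.cong)
    fix ps assume "ps \<in> exchange_lists m k"
    then have ps: "distinct ps" "length ps = k" "set ps \<subseteq> {..<m}" by (auto simp: exchange_lists_def)
    let ?g = "\<lambda>p. case_prod f (exchange (p # ps) (x, y))"
    have "(\<Sum>p<m. ?g p) = (\<Sum>p\<in>{..<m} - set ps. ?g p) + (\<Sum>p\<in>set ps. ?g p)"
      using ps(3) by (rule sum.subset_diff) simp
    also have "(\<Sum>p\<in>set ps. ?g p) = (\<Sum>j<k. ?g (rev ps ! j))"
    proof (rule sum.reindex_bij_betw[symmetric])
      show "bij_betw ((!) (rev ps)) {..<k} (set ps)"
        using bij_betw_nth[of "rev ps" "{..<k}" "set ps"] ps by simp
    qed
    also have "\<dots> = (\<Sum>j<k. case_prod f (exchange ps (x, ?t j)))"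
    proof (rule sum.cong)
      fix j assume "j \<in> {..<k}"
      then show "?g (rev ps ! j) = case_prod f (exchange ps (x, ?t j))"
        using exchange_repeat[OF ps(1), of j x y] ps(2) by (simp del: exchange.simps)
    qed simp
    finally show "case_prod f (exchange ps (x, y)) - (\<Sum>p<m. ?g p) = case_prod f (exchange ps (x, y)) -
        ((\<Sum>p\<in>{..<m} - set ps. ?g p) + (\<Sum>j<k. case_prod f (exchange ps (x, ?t j))))" by simp
  qed simp
  also have "\<dots> = E k y - (E (Suc k) y + (\<Sum>j<k. E k (?t j)))"
    unfolding E_def sum_subtractf sum.distrib sum_exchange_lists_Suc
    by (subst sum.swap) (rule refl)
  finally have 1: "E k y - (E (Suc k) y + (\<Sum>j<k. E k (?t j))) \<in> W" .
  have 2: "fact k * f x y - E k y \<in> W"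
    unfolding E_def using Suc by simp
  \<comment> \<open>Each of the \<open>k\<close> transposed second factors changes the sign of
    \<open>f\<close>, so the repeated positions contribute \<open>k * fact k\<close>, which raises
    \<open>fact k\<close> to \<open>fact (Suc k)\<close>.\<close>
  have "(\<Sum>j<k. fact k * f x (?t j) - E k (?t j)) \<in> W"
    unfolding E_def using Suc.prems(2) range_t km by (intro additive_subgroup_set(4)[OF W] Suc.IH) auto
  also have "(\<Sum>j<k. fact k * f x (?t j) - E k (?t j)) = - (of_nat k * fact k * f x y) - (\<Sum>j<k. E k (?t j))"
    using alt km by (simp add: sum_subtractf)
  finally have 3: "- (of_nat k * fact k * f x y) - (\<Sum>j<k. E k (?t j)) \<in> W" .
  have "(fact k * f x y - E k y) + (E k y - (E (Suc k) y + (\<Sum>j<k. E k (?t j))))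
      - (- (of_nat k * fact k * f x y) - (\<Sum>j<k. E k (?t j))) \<in> W"
    by (rule additive_subgroup_set(2)[OF W additive_subgroup_set(3)[OF W 2 1] 3])
  also have "(fact k * f x y - E k y) + (E k y - (E (Suc k) y + (\<Sum>j<k. E k (?t j))))
      - (- (of_nat k * fact k * f x y) - (\<Sum>j<k. E k (?t j))) = fact (Suc k) * f x y - E (Suc k) y"
    by (simp add: algebra_simps)
  finally show ?case by (simp add: E_def)
qed

section \<open>Binary weights and the straightening of a pair\<close>

definition column_weight :: "nat set \<Rightarrow> nat" where
  "column_weight J = (\<Sum>j\<in>J. 2 ^ j)"

text \<open>The reason for powers of two: a single element outweighs every set of smaller
  elements.\<close>

lemma sum_power2_less:
  assumes "finite J" "\<And>j. j \<in> J \<Longrightarrow> j \<le> b"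
  shows "(\<Sum>j\<in>J. 2 ^ j) < (2::nat) ^ Suc b"
proof -
  have "(\<Sum>j\<in>J. 2 ^ j) \<le> (\<Sum>j\<in>{..<Suc b}. (2::nat) ^ j)"
    using assms by (intro sum_mono2) (auto simp: less_Suc_eq_le)
  also have "\<dots> < 2 ^ Suc b"
    using sum_power2[of "Suc b"] by (simp add: lessThan_atLeast0)
  finally show ?thesis .
qed

lemma plucker_fun_cases:
  assumes "x ` {..<m} \<subseteq> {1..m + n}"
  shows "plucker_fun m x = 0 \<or> inj_on x {..<m} \<and> x ` {..<m} \<in> column_sets m n \<and>
    (plucker_fun m x = plucker_var (x ` {..<m}) \<or> plucker_fun m x = - plucker_var (x ` {..<m}))"
proof (cases "inj_on x {..<m}")
  case True
  then have "x ` {..<m} \<in> column_sets m n" using assms by (simp add: column_sets_def card_image)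
  moreover have "set (map x [0..<m]) = x ` {..<m}" by (simp add: lessThan_atLeast0)
  moreover have "(- 1) ^ i = (1 :: plucker_poly) \<or> (- 1) ^ i = (-1 :: plucker_poly)" for i
    by (cases "even i") auto
  ultimately show ?thesis
    using True unfolding plucker_fun_def plucker_seq_eq by (metis mult_1 mult_minus1)
next
  case False
  then have "\<not> distinct (map x [0..<m])" by (simp add: distinct_map lessThan_atLeast0)
  then show ?thesis by (simp add: plucker_fun_def plucker_seq_eq)
qed

lemma plucker_fun_nth:
  assumes "J \<in> column_sets m n"
  shows "plucker_fun m (\<lambda>k. sorted_list_of_set J ! k) = plucker_var J"
proof -
  have J: "finite J" "card J = m" using assms by (auto simp: column_sets_def intro: finite_subset)
  then have "map (\<lambda>k. sorted_list_of_set J ! k) [0..<m] = sorted_list_of_set J"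
    by (metis length_sorted_list_of_set map_nth)
  moreover have "inv_count xs = 0" if "sorted xs" for xs
    using that by (induction xs) (auto simp: filter_empty_conv not_less)
  ultimately show ?thesis using J by (simp add: plucker_fun_def plucker_seq_eq)
qed

text \<open>At position \<open>k\<close> the set \<open>K\<close> has the smaller entry, so its
  first \<open>Suc k\<close> entries are exchanged with \<open>Suc k\<close> entries of
  \<open>J\<close>. At least one incoming entry comes from a position \<open>p \<ge> k\<close> of
  \<open>J\<close> and therefore exceeds all outgoing ones, so its binary weight alone beats theirs.
  The total weight of the pair does not change.\<close>

lemma straighten_pair:
  assumes W: "additive_subgroup_set W" and rel: "plucker_relations m n \<subseteq> W"
    and J: "J \<in> column_sets m n" and K: "K \<in> column_sets m n"
    and k: "k < m" "sorted_list_of_set K ! k < sorted_list_of_set J ! k"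
  obtains S :: "nat list set" and t where "finite S"
    "fact (Suc k) * (plucker_var J * plucker_var K) - sum t S \<in> W"
    "\<And>s. s \<in> S \<Longrightarrow> t s = 0 \<or> (\<exists>J' K'. J' \<in> column_sets m n \<and> K' \<in> column_sets m n \<and>
        (t s = plucker_var J' * plucker_var K' \<or> t s = - (plucker_var J' * plucker_var K')) \<and>
        column_weight J' + column_weight K' = column_weight J + column_weight K \<and>
        column_weight K < column_weight K')"
proof -
  define x y where "x = (\<lambda>i. sorted_list_of_set J ! i)" and "y = (\<lambda>i. sorted_list_of_set K ! i)"
  have fin: "finite J" "finite K" using J K by (auto simp: column_sets_def intro: finite_subset)
  have card: "card J = m" "card K = m" using J K by (auto simp: column_sets_def)
  have img: "x ` {..<m} = J" "y ` {..<m} = K"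
    using fin card nth_image[of m "sorted_list_of_set J"] nth_image[of m "sorted_list_of_set K"]
    by (simp_all add: x_def y_def lessThan_atLeast0)
  have x_less: "x i < x j" and y_less: "y i < y j" if "i < j" "j < m" for i j
    using sorted_wrt_nth_less[OF strict_sorted_list_of_set, of i j J]
      sorted_wrt_nth_less[OF strict_sorted_list_of_set, of i j K] that card by (auto simp: x_def y_def)
  have inj: "inj_on x {..<m}" "inj_on y {..<m}"
    using card img by (auto intro: eq_card_imp_inj_on)
  have range: "x ` {..<m} \<subseteq> {1..m + n}" "y ` {..<m} \<subseteq> {1..m + n}"
    using J K unfolding img by (auto simp: column_sets_def)
  define f where "f x y = plucker_fun m x * plucker_fun m y" for x y
  define t where "t ps = case_prod f (exchange ps (x, y))" for ps
  have mult: "(-1) ^ i * a \<in> W" if "a \<in> W" for i and a :: plucker_poly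
    using additive_subgroup_set(2)[OF W additive_subgroup_set(1)[OF W] that] that by (cases "even i") auto
  have main: "fact (Suc k) * f x y - sum t (exchange_lists m (Suc k)) \<in> W"
    unfolding t_def
  proof (rule multiple_exchange[OF W, where V = "{1..m + n}"])
    show "f x (y \<circ> Transposition.transpose i j) = - f x y" if "i < j" "j < m" for x y i j
      using alternating_transpose[OF alternating_plucker_seq that, of y] by (simp add: f_def plucker_fun_def)
    show "f x y - (\<Sum>p<m. f (x(p := y k)) (y(k := x p))) \<in> W"
      if k: "k < m" and r: "x ` {..<m} \<subseteq> {1..m + n}" "y ` {..<m} \<subseteq> {1..m + n}" for x y k
    proof -
      let ?is = "map y ([0..<k] @ [Suc k..<m])" and ?js = "y k # map x [0..<m]"
      have "plucker_relation ?is ?js \<in> plucker_relations m n"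
        unfolding plucker_relations_def
      proof (intro CollectI exI conjI)
        show "length ?is + 1 = m" "length ?js = m + 1" using k by auto
        show "set ?is \<subseteq> {1..m + n}" "set ?js \<subseteq> {1..m + n}" using k r by auto
      qed simp
      then have "(-1) ^ (m - Suc k) * plucker_relation ?is ?js \<in> W" using rel mult by blast
      then show ?thesis
        unfolding plucker_relation_exchange[OF k] f_def
        by (simp flip: mult.assoc power_add mult_2)
    qed
  qed (use k range in auto)
  have "t ps = 0 \<or> (\<exists>J' K'. J' \<in> column_sets m n \<and> K' \<in> column_sets m n \<and>
        (t ps = plucker_var J' * plucker_var K' \<or> t ps = - (plucker_var J' * plucker_var K')) \<and>
        column_weight J' + column_weight K' = column_weight J + column_weight K \<and>
        column_weight K < column_weight K')" if "ps \<in> exchange_lists m (Suc k)" for ps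
  proof (cases "t ps = 0")
    case False
    have ps: "distinct ps" "length ps = Suc k" "set ps \<subseteq> {..<m}" using that by (auto simp: exchange_lists_def)
    obtain X Y where XY: "exchange ps (x, y) = (X, Y)" by force
    have r: "X ` {..<m} \<subseteq> {1..m + n}" "Y ` {..<m} \<subseteq> {1..m + n}"
      using exchange_range[OF range ps(3)] ps(2) k XY by auto
    have t: "t ps = plucker_fun m X * plucker_fun m Y" by (simp add: t_def XY f_def)
    then have "plucker_fun m X \<noteq> 0" "plucker_fun m Y \<noteq> 0" using False by auto
    then have X: "inj_on X {..<m}" "X ` {..<m} \<in> column_sets m n"
      "plucker_fun m X = plucker_var (X ` {..<m}) \<or> plucker_fun m X = - plucker_var (X ` {..<m})"
      and Y: "inj_on Y {..<m}" "Y ` {..<m} \<in> column_sets m n"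
      "plucker_fun m Y = plucker_var (Y ` {..<m}) \<or> plucker_fun m Y = - plucker_var (Y ` {..<m})"
      using plucker_fun_cases[OF r(1)] plucker_fun_cases[OF r(2)] by blast+
    have w: "column_weight (z ` {..<m}) = (\<Sum>p<m. 2 ^ z p)" if "inj_on z {..<m}" for z
      using that by (simp add: column_weight_def sum.reindex)
    have "column_weight (X ` {..<m}) + column_weight (Y ` {..<m}) = column_weight J + column_weight K"
      using exchange_preserves[OF ps(3), of "\<lambda>v. 2 ^ v" x y] ps(2) k XY w[OF X(1)] w[OF Y(1)]
        w[OF inj(1)] w[OF inj(2)] img by simp
    moreover have "column_weight K < column_weight (Y ` {..<m})"
    proof -
      \<comment> \<open>Pigeonhole: \<open>Suc k\<close> distinct positions do not all fit below
        \<open>k\<close>.\<close>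
      have "\<not> set ps \<subseteq> {..<k}"
        using card_mono[of "{..<k}" "set ps"] distinct_card[OF ps(1)] ps(2) by auto
      then obtain p where p: "p \<in> set ps" "k \<le> p" by (meson lessThan_iff not_less subsetI)
      then obtain i where i: "i < Suc k" "rev ps ! i = p"
        using ps(2) by (metis in_set_conv_nth length_rev set_rev)
      have Yi: "Y i = x p" using exchange_nth(3)[OF ps(1), of i x y] i ps(2) XY by simp
      have "p < m" using p ps(3) by auto
      then have "x k \<le> x p" using p x_less[of k p] by (cases "k = p") auto
      then have "y k < Y i" using k Yi by (simp add: x_def y_def)
      have split: "(\<Sum>p<m. g p) = (\<Sum>p<Suc k. g p) + (\<Sum>p\<in>{Suc k..<m}. g p)" for g :: "nat \<Rightarrow> nat"
        using k by (simp add: lessThan_atLeast0 sum.atLeastLessThan_concat del: sum.lessThan_Suc sum.op_ivl_Suc)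
      \<comment> \<open>All outgoing entries together weigh less than the one incoming entry
        \<open>Y i\<close>.\<close>
      have "(\<Sum>p<Suc k. (2::nat) ^ y p) = (\<Sum>v\<in>y ` {..<Suc k}. 2 ^ v)"
        using inj_on_subset[OF inj(2), of "{..<Suc k}"] k by (subst sum.reindex) auto
      also have "\<dots> < 2 ^ Suc (y k)"
      proof (rule sum_power2_less)
        fix v assume "v \<in> y ` {..<Suc k}"
        then obtain j where "v = y j" "j \<le> k" by (auto simp: less_Suc_eq_le)
        then show "v \<le> y k" using y_less[of j k] k by (cases "j = k") auto
      qed simp
      also have "\<dots> \<le> 2 ^ Y i" using \<open>y k < Y i\<close> by (intro power_increasing) auto
      also have "\<dots> \<le> (\<Sum>p<Suc k. 2 ^ Y p)" using i by (intro member_le_sum) auto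
      finally have "(\<Sum>p<Suc k. (2::nat) ^ y p) < (\<Sum>p<Suc k. 2 ^ Y p)" .
      moreover have "(\<Sum>p\<in>{Suc k..<m}. (2::nat) ^ Y p) = (\<Sum>p\<in>{Suc k..<m}. 2 ^ y p)"
        using exchange_nth(4)[OF ps(1), of _ x y] ps(2) XY by (intro sum.cong) auto
      ultimately have "(\<Sum>p<m. (2::nat) ^ y p) < (\<Sum>p<m. 2 ^ Y p)"
        unfolding split by linarith
      then show ?thesis using w[OF inj(2)] w[OF Y(1)] img by simp
    qed
    moreover have "t ps = plucker_var (X ` {..<m}) * plucker_var (Y ` {..<m}) \<or>
        t ps = - (plucker_var (X ` {..<m}) * plucker_var (Y ` {..<m}))"
      using X(3) Y(3) unfolding t by auto
    ultimately show ?thesis using X(2) Y(2) by blast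
  qed simp
  moreover have "f x y = plucker_var J * plucker_var K"
    using plucker_fun_nth[OF J] plucker_fun_nth[OF K] by (simp add: f_def x_def y_def)
  ultimately show thesis
    using main by (intro that[OF finite_exchange_lists[of m "Suc k"], of t]) auto
qed

subsection \<open>The generic matrix\<close>

type_synonym 'v complex_poly = "('v \<Rightarrow>\<^sub>0 nat) \<Rightarrow>\<^sub>0 complex"

definition power_product :: "('u \<Rightarrow> 'v complex_poly) \<Rightarrow> ('u \<Rightarrow>\<^sub>0 nat) \<Rightarrow> 'v complex_poly" where
  "power_product g t = (\<Prod>x\<in>Poly_Mapping.keys t. g x ^ Poly_Mapping.lookup t x)"

definition poly_subst :: "('u \<Rightarrow> 'v complex_poly) \<Rightarrow> 'u complex_poly \<Rightarrow> 'v complex_poly" where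
  "poly_subst g p = (\<Sum>t\<in>Poly_Mapping.keys p. Poly_Mapping.single 0 (Poly_Mapping.lookup p t) * power_product g t)"

lemma power_product_superset:
  "finite X \<Longrightarrow> Poly_Mapping.keys t \<subseteq> X \<Longrightarrow> power_product g t = (\<Prod>x\<in>X. g x ^ Poly_Mapping.lookup t x)"
  unfolding power_product_def by (rule prod.mono_neutral_left) (auto simp: in_keys_iff)

lemma power_product_add: "power_product g (s + t) = power_product g s * power_product g t"
proof -
  let ?X = "Poly_Mapping.keys s \<union> Poly_Mapping.keys t"
  have "Poly_Mapping.keys (s + t) \<subseteq> ?X" by (rule keys_add)
  then show ?thesis
    by (simp add: power_product_superset[of ?X] lookup_add power_add prod.distrib)
qed

lemma power_product_0 [simp]: "power_product g 0 = 1"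
  by (simp add: power_product_def)

lemma power_product_single [simp]: "power_product g (Poly_Mapping.single x 1) = g x"
  by (simp add: power_product_def)

lemma poly_subst_superset:
  "finite T \<Longrightarrow> Poly_Mapping.keys p \<subseteq> T \<Longrightarrow>
    poly_subst g p = (\<Sum>t\<in>T. Poly_Mapping.single 0 (Poly_Mapping.lookup p t) * power_product g t)"
  unfolding poly_subst_def by (rule sum.mono_neutral_left) (auto simp: in_keys_iff)

lemma poly_subst_add: "poly_subst g (p + q) = poly_subst g p + poly_subst g q"
proof -
  let ?X = "Poly_Mapping.keys p \<union> Poly_Mapping.keys q"
  have "Poly_Mapping.keys (p + q) \<subseteq> ?X" by (rule keys_add)
  then show ?thesis
    by (simp add: poly_subst_superset[of ?X] lookup_add single_add sum.distrib distrib_right)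
qed

lemma poly_subst_0 [simp]: "poly_subst g 0 = 0"
  by (simp add: poly_subst_def)

lemma poly_subst_sum: "poly_subst g (sum f S) = (\<Sum>i\<in>S. poly_subst g (f i))"
  by (induction S rule: infinite_finite_induct) (simp_all add: poly_subst_add)

lemma poly_subst_single: "poly_subst g (Poly_Mapping.single t c) = Poly_Mapping.single 0 c * power_product g t"
  by (simp add: poly_subst_def)

lemma poly_mapping_sum_singles:
  "p = (\<Sum>t\<in>Poly_Mapping.keys p. Poly_Mapping.single t (Poly_Mapping.lookup p t))"
  by (rule poly_mapping_eqI) (auto simp: lookup_sum lookup_single when_def in_keys_iff)

lemma poly_subst_mult:
  fixes g :: "'u \<Rightarrow> 'v complex_poly"
  shows "poly_subst g (p * q) = poly_subst g p * poly_subst g q"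
proof -
  have "poly_subst g (Poly_Mapping.single s c * Poly_Mapping.single t d)
      = poly_subst g (Poly_Mapping.single s c) * poly_subst g (Poly_Mapping.single t d)" for s t c d
  proof -
    have const: "Poly_Mapping.single (0 :: 'v \<Rightarrow>\<^sub>0 nat) (c * d) = Poly_Mapping.single 0 c * Poly_Mapping.single 0 d"
      by (simp add: mult_single)
    show ?thesis
      by (simp only: mult_single[of s c t d] poly_subst_single power_product_add const mult_ac)
  qed
  then show ?thesis
    by (subst (1) poly_mapping_sum_singles[of p], subst (1) poly_mapping_sum_singles[of q],
        subst (3) poly_mapping_sum_singles[of p], subst (3) poly_mapping_sum_singles[of q])
      (simp add: sum_product poly_subst_sum)
qed

lemma poly_subst_1 [simp]: "poly_subst (g :: 'u \<Rightarrow> 'v complex_poly) 1 = 1"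
proof -
  have "(1 :: 'u complex_poly) = Poly_Mapping.single 0 1" by simp
  then show ?thesis by (metis poly_subst_single power_product_0 mult_1_right single_one)
qed

lemma poly_subst_minus: "poly_subst g (- p) = - poly_subst g p"
  using poly_subst_add[of g p "- p"] by (simp add: eq_neg_iff_add_eq_0 add.commute)

lemma poly_subst_power: "poly_subst g (p ^ k) = poly_subst g p ^ k"
  by (induction k) (simp_all add: poly_subst_mult)

section \<open>Minors of the generic matrix and the Plucker relations between them\<close>

definition matrix_var :: "nat \<Rightarrow> nat \<Rightarrow> (nat \<times> nat) complex_poly" where
  "matrix_var i j = Poly_Mapping.single (Poly_Mapping.single (i, j) 1) 1"

text \<open>The columns form a list, possibly unsorted or with repetitions, to match
  \<open>plucker_seq\<close>.\<close>

definition minor_mat :: "nat list \<Rightarrow> (nat \<times> nat) complex_poly mat" where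
  "minor_mat s = mat (length s) (length s) (\<lambda>(i, k). matrix_var i (s ! k))"

definition minor :: "nat list \<Rightarrow> (nat \<times> nat) complex_poly" where
  "minor s = det (minor_mat s)"

lemma minor_mat_carrier: "length s = m \<Longrightarrow> minor_mat s \<in> carrier_mat m m"
  by (simp add: minor_mat_def)

lemma alternating_minor: "alternating minor"
  unfolding alternating_def
proof (intro allI)
  fix us vs :: "nat list" and a b :: nat
  let ?s = "us @ a # b # vs" and ?s' = "us @ b # a # vs"
  let ?k = "length us" and ?n = "length ?s"
  have "minor_mat ?s' = swapcols ?k (Suc ?k) (minor_mat ?s)"
  proof (rule eq_matI)
    fix i j assume ij: "i < dim_row (swapcols ?k (Suc ?k) (minor_mat ?s))" "j < dim_col (swapcols ?k (Suc ?k) (minor_mat ?s))"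
    then have "i < ?n" "j < ?n" by (auto simp: minor_mat_def)
    moreover have "?s' ! j = (if ?k = j then ?s ! Suc ?k else if Suc ?k = j then ?s ! ?k else ?s ! j)"
      by (auto simp: nth_append nth_Cons')
    ultimately show "minor_mat ?s' $$ (i, j) = swapcols ?k (Suc ?k) (minor_mat ?s) $$ (i, j)"
      by (auto simp: minor_mat_def)
  qed (auto simp: minor_mat_def)
  then have "minor ?s' = - minor ?s"
    unfolding minor_def
    by (simp only:) (rule det_swapcols[of _ ?n], auto simp: minor_mat_carrier)
  then show "minor ?s = - minor ?s'" by simp
qed

lemma minor_not_distinct:
  assumes "\<not> distinct s"
  shows "minor s = 0"
proof -
  obtain i j where ij: "i < length s" "j < length s" "i \<noteq> j" "s ! i = s ! j"
    using assms by (auto simp: distinct_conv_nth)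
  have "col (minor_mat s) i = col (minor_mat s) j"
    using ij by (intro eq_vecI) (auto simp: minor_mat_def)
  then show ?thesis
    unfolding minor_def using ij by (intro det_identical_columns[of _ "length s" i j]) (auto simp: minor_mat_carrier)
qed

text \<open>Induction on the number of inversions: an unsorted list has an adjacent descent, and
  swapping it removes one inversion and changes the sign.\<close>

lemma minor_sort:
  assumes "distinct s"
  shows "minor s = (-1) ^ inv_count s * minor (sorted_list_of_set (set s))"
  using assms
proof (induction "inv_count s" arbitrary: s)
  case 0
  have "sorted xs" if "inv_count xs = 0" for xs
    using that by (induction xs) (auto simp: filter_empty_conv not_less)
  then have "sorted_list_of_set (set s) = s"
    using 0 by (simp add: sorted_list_of_set.idem_if_sorted_distinct)
  then show ?case using 0(1) by simp
next
  case (Suc c)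
  have "\<exists>us a b vs. xs = us @ a # b # vs \<and> b < a" if "inv_count xs \<noteq> 0" for xs
    using that
  proof (induction xs)
    case (Cons x xs)
    show ?case
    proof (cases "inv_count xs = 0")
      case False
      then obtain us a b vs where "xs = us @ a # b # vs" "b < a" using Cons.IH by blast
      then show ?thesis by (intro exI[of _ "x # us"]) auto
    next
      case True
      have "sorted xs" using True by (induction xs) (auto simp: filter_empty_conv not_less)
      moreover obtain y where y: "y \<in> set xs" "y < x"
        using Cons.prems True by (auto simp: filter_empty_conv)
      ultimately obtain b vs where "xs = b # vs" "b < x" by (cases xs) auto
      then show ?thesis by (intro exI[of _ "[]"]) auto
    qed
  qed simp
  then obtain us a b vs where s: "s = us @ a # b # vs" "b < a" using Suc(2) by (metis Zero_not_Suc)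
  let ?t = "us @ b # a # vs"
  have inv: "inv_count s = Suc (inv_count ?t)" unfolding s(1) by (rule inv_count_swap[OF s(2)])
  have "minor s = - minor ?t" unfolding s(1) by (rule alternatingD[OF alternating_minor])
  also have "minor ?t = (-1) ^ inv_count ?t * minor (sorted_list_of_set (set ?t))"
    using Suc inv s by (intro Suc.hyps(1)) auto
  also have "set ?t = set s" using s by auto
  finally show ?case unfolding inv by simp
qed

definition minor_hom :: "plucker_poly \<Rightarrow> (nat \<times> nat) complex_poly" where
  "minor_hom = poly_subst (\<lambda>J. minor (sorted_list_of_set J))"

lemmas minor_hom_simps =
  poly_subst_add[where g = "\<lambda>J. minor (sorted_list_of_set J)", folded minor_hom_def]
  poly_subst_mult[where g = "\<lambda>J. minor (sorted_list_of_set J)", folded minor_hom_def]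
  poly_subst_sum[where g = "\<lambda>J. minor (sorted_list_of_set J)", folded minor_hom_def]
  poly_subst_minus[where g = "\<lambda>J. minor (sorted_list_of_set J)", folded minor_hom_def]
  poly_subst_power[where g = "\<lambda>J. minor (sorted_list_of_set J)", folded minor_hom_def]
  poly_subst_0[where g = "\<lambda>J. minor (sorted_list_of_set J)", folded minor_hom_def]
  poly_subst_1[where g = "\<lambda>J. minor (sorted_list_of_set J)", folded minor_hom_def]

lemma minor_hom_plucker_var: "minor_hom (plucker_var J) = minor (sorted_list_of_set J)"
  unfolding minor_hom_def plucker_var_def poly_subst_single by (simp del: One_nat_def)

lemma minor_hom_const: "minor_hom (const_poly c) = Poly_Mapping.single 0 c"
  unfolding minor_hom_def const_poly_def poly_subst_single by simp

lemma minor_hom_plucker_seq: "minor_hom (plucker_seq s) = minor s"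
  using minor_sort[of s] minor_not_distinct[of s]
  by (simp add: plucker_seq_eq minor_hom_simps minor_hom_plucker_var)

text \<open>Expand the first factor along its last column, the only one that depends on
  \<open>l\<close>. The coefficient of each cofactor is then the expansion of a determinant with two
  equal rows.\<close>

lemma minor_hom_plucker_relation:
  assumes "length ks + 1 = m" "length js = m + 1"
  shows "minor_hom (plucker_relation ks js) = 0"
proof -
  define A where "A z = minor_mat (ks @ [z])" for z
  have A: "A z \<in> carrier_mat m m" for z using assms by (simp add: A_def minor_mat_carrier)
  have del: "mat_delete (A z) i (m - 1) = mat_delete (A 0) i (m - 1)" for z i
    unfolding mat_delete_def A_def minor_mat_def using assms
    by (intro eq_matI) (auto simp: nth_append)
  then have cof: "cofactor (A z) i (m - 1) = cofactor (A 0) i (m - 1)" for z i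
    by (simp only: cofactor_def del[of z i])
  have exp: "minor (ks @ [z]) = (\<Sum>i<m. matrix_var i z * cofactor (A 0) i (m - 1))" for z
  proof -
    have "minor (ks @ [z]) = (\<Sum>i<m. A z $$ (i, m - 1) * cofactor (A z) i (m - 1))"
      unfolding minor_def A_def[symmetric] using assms by (intro laplace_expansion_column[OF A]) simp
    also have "\<dots> = (\<Sum>i<m. matrix_var i z * cofactor (A 0) i (m - 1))"
    proof (rule sum.cong)
      fix i assume "i \<in> {..<m}"
      then have "A z $$ (i, m - 1) = matrix_var i z"
        using assms by (auto simp: A_def minor_mat_def nth_append)
      then show "A z $$ (i, m - 1) * cofactor (A z) i (m - 1) = matrix_var i z * cofactor (A 0) i (m - 1)"
        by (simp only: cof[of z])
    qed simp
    finally show ?thesis .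
  qed
  have zero: "(\<Sum>l<Suc m. (-1) ^ l * matrix_var i (js ! l) * minor (take l js @ drop (Suc l) js)) = 0"
    if i: "i < m" for i
  proof -
    \<comment> \<open>The generic matrix on the columns \<open>js\<close>, with a second copy of row
      \<open>i\<close> on top.\<close>
    define B where "B = mat (Suc m) (Suc m) (\<lambda>(r, c). matrix_var (if r = 0 then i else r - 1) (js ! c))"
    have B: "B \<in> carrier_mat (Suc m) (Suc m)" by (simp add: B_def)
    have "det B = 0"
      using i by (intro det_identical_rows[OF B, of 0 "Suc i"] eq_vecI) (auto simp: B_def)
    moreover have "det B = (\<Sum>l<Suc m. B $$ (0, l) * cofactor B 0 l)"
      by (rule laplace_expansion_row[OF B]) simp
    moreover have "B $$ (0, l) * cofactor B 0 l = (-1) ^ l * matrix_var i (js ! l) * minor (take l js @ drop (Suc l) js)"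
      if l: "l < Suc m" for l
    proof -
      have "mat_delete B 0 l = minor_mat (take l js @ drop (Suc l) js)"
        unfolding mat_delete_def B_def minor_mat_def using l assms
        by (intro eq_matI) (auto simp: nth_append min_def)
      then show ?thesis using l by (simp add: cofactor_def minor_def B_def)
    qed
    ultimately show ?thesis by simp
  qed
  have "minor_hom (plucker_relation ks js)
    = (\<Sum>l<Suc m. (-1) ^ l * minor (ks @ [js ! l]) * minor (take l js @ drop (Suc l) js))"
    using assms by (simp add: plucker_relation_def minor_hom_simps minor_hom_plucker_seq del: sum.lessThan_Suc)
  also have "\<dots> = (\<Sum>l<Suc m. \<Sum>i<m. cofactor (A 0) i (m - 1) *
      ((-1) ^ l * matrix_var i (js ! l) * minor (take l js @ drop (Suc l) js)))"
    unfolding exp sum_distrib_left sum_distrib_right by (intro sum.cong refl) (simp add: mult_ac)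
  also have "\<dots> = (\<Sum>i<m. cofactor (A 0) i (m - 1) *
      (\<Sum>l<Suc m. (-1) ^ l * matrix_var i (js ! l) * minor (take l js @ drop (Suc l) js)))"
    unfolding sum_distrib_left by (rule sum.swap)
  also have "\<dots> = 0" using zero by simp
  finally show ?thesis .
qed

section \<open>Monic leading terms\<close>

definition monic_at :: "('a::linorder \<Rightarrow>\<^sub>0 'b::zero_neq_one) \<Rightarrow> 'a \<Rightarrow> bool" where
  "monic_at p t \<longleftrightarrow> Poly_Mapping.lookup p t = 1 \<and> (\<forall>s\<in>Poly_Mapping.keys p. s \<le> t)"

text \<open>The order on exponents is compatible with addition, so the leading pair is the only pair
  of terms that reaches \<open>s + t\<close>.\<close>

lemma monic_at_mult:
  fixes p q :: "'v::linorder complex_poly"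
  assumes "monic_at p s" "monic_at q t"
  shows "monic_at (p * q) (s + t)"
proof -
  have le: "a + b \<le> s + t" "a + b = s + t \<Longrightarrow> a = s \<and> b = t"
    if "a \<in> Poly_Mapping.keys p" "b \<in> Poly_Mapping.keys q" for a b
  proof -
    have ab: "a \<le> s" "b \<le> t" using assms that by (auto simp: monic_at_def)
    then show "a + b \<le> s + t" by (rule add_mono)
    assume eq: "a + b = s + t"
    have "\<not> a < s"
    proof
      assume "a < s"
      then have "a + b < s + t" by (rule add_less_le_mono[OF _ ab(2)])
      then show False using eq by simp
    qed
    then have "a = s" using ab(1) unfolding order_le_less by blast
    then show "a = s \<and> b = t" using eq by auto
  qed
  have "Poly_Mapping.keys (p * q) \<subseteq> {a + b | a b. a \<in> Poly_Mapping.keys p \<and> b \<in> Poly_Mapping.keys q}"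
    by (rule keys_mult)
  then have "\<forall>u\<in>Poly_Mapping.keys (p * q). u \<le> s + t" using le(1) by blast
  moreover have "Poly_Mapping.lookup (p * q) (s + t) = 1"
  proof -
    have "p * q = (\<Sum>a\<in>Poly_Mapping.keys p. \<Sum>b\<in>Poly_Mapping.keys q.
        Poly_Mapping.single (a + b) (Poly_Mapping.lookup p a * Poly_Mapping.lookup q b))"
      by (subst (1) poly_mapping_sum_singles[of p], subst (1) poly_mapping_sum_singles[of q])
        (simp add: sum_product mult_single)
    then have "Poly_Mapping.lookup (p * q) (s + t) = (\<Sum>a\<in>Poly_Mapping.keys p. \<Sum>b\<in>Poly_Mapping.keys q.
        Poly_Mapping.lookup p a * Poly_Mapping.lookup q b when a + b = s + t)"
      by (simp add: lookup_sum lookup_single)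
    also have "\<dots> = (\<Sum>a\<in>Poly_Mapping.keys p. \<Sum>b\<in>Poly_Mapping.keys q.
        (Poly_Mapping.lookup q b when b = t) * (Poly_Mapping.lookup p a when a = s))"
      using le(2) by (intro sum.cong refl) (auto simp: when_def)
    also have "\<dots> = 1"
      using assms by (simp add: monic_at_def when_def in_keys_iff flip: sum_product sum_distrib_left sum_distrib_right)
    finally show ?thesis .
  qed
  ultimately show ?thesis by (simp add: monic_at_def)
qed

subsection \<open>Leading terms\<close>

definition diagonal_exponent :: "nat list \<Rightarrow> (nat \<times> nat) \<Rightarrow>\<^sub>0 nat" where
  "diagonal_exponent s = (\<Sum>i<length s. Poly_Mapping.single (i, s ! i) 1)"

lemma lookup_sum_single_pair:
  fixes f :: "nat \<Rightarrow> 'a"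
  shows "Poly_Mapping.lookup (\<Sum>i<m. Poly_Mapping.single (i, f i) (1::nat)) (j, v) = (if j < m \<and> f j = v then 1 else 0)"
proof -
  have "Poly_Mapping.lookup (\<Sum>i<m. Poly_Mapping.single (i, f i) (1::nat)) (j, v)
      = (\<Sum>i<m. if i = j then (if f j = v then 1 else 0) else 0)"
    unfolding lookup_sum by (intro sum.cong) (auto simp: lookup_single when_def)
  then show ?thesis by simp
qed

lemma prod_single_one:
  "(\<Prod>i\<in>S. Poly_Mapping.single (f i) 1) = (Poly_Mapping.single (\<Sum>i\<in>S. f i) 1 :: 'v complex_poly)"
  by (induction S rule: infinite_finite_induct) (simp_all add: mult_single)

text \<open>Exponents are compared at the smallest variable where they differ, and variables by
  their row first. Let \<open>i\<close> be the first row moved by \<open>p\<close>. The indices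
  below \<open>i\<close> are fixed and hence taken, so \<open>p i > i\<close>, and the diagonal
  exponent wins at the variable \<open>(i, s ! i)\<close>.\<close>

lemma permuted_exponent_less:
  assumes p: "p permutes {0..<length s}" "p \<noteq> id" and s: "sorted_wrt (<) s"
  shows "(\<Sum>i<length s. Poly_Mapping.single (i, s ! p i) (1::nat)) < diagonal_exponent s"
proof -
  define i where "i = (LEAST i. p i \<noteq> i)"
  have "\<exists>i. p i \<noteq> i" using p(2) by auto
  then have i: "p i \<noteq> i" unfolding i_def by (rule LeastI_ex)
  have below: "p j = j" if "j < i" for j
    using not_less_Least[of j "\<lambda>i. p i \<noteq> i"] that unfolding i_def by blast
  have iN: "i < length s" using i p(1) by (metis permutes_not_in atLeastLessThan_iff zero_le)
  then have pN: "p i < length s" using permutes_in_image[OF p(1), of i] by simp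
  have "\<not> p i < i"
    using below[of "p i"] permutes_inj[OF p(1)] i by (auto dest: injD)
  then have less: "s ! i < s ! p i"
    using i sorted_wrt_nth_less[OF s, of i "p i"] pN by simp
  show ?thesis
    unfolding less_poly_mapping.rep_eq diagonal_exponent_def
  proof (rule less_funI, intro exI[of _ "(i, s ! i)"] conjI allI impI)
    show "Poly_Mapping.lookup (\<Sum>i<length s. Poly_Mapping.single (i, s ! p i) (1::nat)) (i, s ! i)
      < Poly_Mapping.lookup (\<Sum>i<length s. Poly_Mapping.single (i, s ! i) 1) (i, s ! i)"
      unfolding lookup_sum_single_pair using less iN by simp
    fix k assume k: "k < (i, s ! i)"
    obtain j v where jv: "k = (j, v)" by force
    then have "j < i \<or> j = i \<and> v < s ! i" using k by (auto simp: less_prod_def)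
    then show "Poly_Mapping.lookup (\<Sum>i<length s. Poly_Mapping.single (i, s ! p i) (1::nat)) k
      = Poly_Mapping.lookup (\<Sum>i<length s. Poly_Mapping.single (i, s ! i) 1) k"
      unfolding jv lookup_sum_single_pair using below less by auto
  qed
qed

text \<open>In the Leibniz formula only the identity permutation reaches the diagonal exponent, and
  its sign is \<open>1\<close>.\<close>

lemma monic_at_minor:
  assumes s: "sorted_wrt (<) s"
  shows "monic_at (minor s) (diagonal_exponent s)"
proof -
  let ?P = "{p. p permutes {0..<length s}}"
  define e where "e p = (\<Sum>i<length s. Poly_Mapping.single (i, s ! p i) (1::nat))" for p :: "nat \<Rightarrow> nat"
  have e_id: "e id = diagonal_exponent s" by (simp add: e_def diagonal_exponent_def)
  have "minor s = (\<Sum>p\<in>?P. of_int (sign p) * (\<Prod>i = 0..<length s. minor_mat s $$ (i, p i)))"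
    unfolding minor_def by (rule det_def') (simp add: minor_mat_carrier)
  also have "\<dots> = (\<Sum>p\<in>?P. Poly_Mapping.single (e p) (of_int (sign p)))"
  proof (rule sum.cong)
    fix p assume "p \<in> ?P"
    then have "p i < length s" if "i < length s" for i
      using permutes_in_image[of p "{0..<length s}" i] that by simp
    then have "(\<Prod>i = 0..<length s. minor_mat s $$ (i, p i)) = (\<Prod>i<length s. Poly_Mapping.single (Poly_Mapping.single (i, s ! p i) 1) 1)"
      by (intro prod.cong) (auto simp: minor_mat_def matrix_var_def)
    then have "(\<Prod>i = 0..<length s. minor_mat s $$ (i, p i)) = Poly_Mapping.single (e p) 1"
      by (simp add: prod_single_one e_def)
    moreover have "(of_int (sign p) :: (nat \<times> nat) complex_poly) = Poly_Mapping.single 0 (of_int (sign p))" by simp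
    ultimately show "of_int (sign p) * (\<Prod>i = 0..<length s. minor_mat s $$ (i, p i)) = Poly_Mapping.single (e p) (of_int (sign p))"
      by (simp only: mult_single) simp
  qed simp
  finally have eq: "minor s = (\<Sum>p\<in>?P. Poly_Mapping.single (e p) (of_int (sign p)))" .
  have fin: "finite ?P" by (rule finite_permutations) simp
  have le: "e p < e id" if "p \<in> ?P" "p \<noteq> id" for p
    using permuted_exponent_less[OF _ that(2) s] that(1) by (simp add: e_id) (simp add: e_def)
  have "Poly_Mapping.lookup (minor s) (e id) = (\<Sum>p\<in>?P. if p = id then 1 else 0)"
    unfolding eq lookup_sum
  proof (rule sum.cong)
    fix p assume p: "p \<in> ?P"
    show "Poly_Mapping.lookup (Poly_Mapping.single (e p) (of_int (sign p))) (e id) = (if p = id then 1 else 0 :: complex)"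
      using le[OF p] by (cases "p = id") (auto simp: lookup_single when_def sign_id)
  qed simp
  also have "\<dots> = 1" using fin by (simp add: permutes_id)
  finally have "Poly_Mapping.lookup (minor s) (e id) = 1" .
  moreover have "t \<le> e id" if "t \<in> Poly_Mapping.keys (minor s)" for t
  proof -
    have "t \<in> (\<Union>p\<in>?P. Poly_Mapping.keys (Poly_Mapping.single (e p) (of_int (sign p) :: complex)))"
      using that keys_sum[of "\<lambda>p. Poly_Mapping.single (e p) (of_int (sign p) :: complex)" ?P] unfolding eq by blast
    then obtain p where "p \<in> ?P" "t = e p" by (auto split: if_splits)
    then show ?thesis using le[of p] by (cases "p = id") (auto intro: less_imp_le)
  qed
  ultimately show ?thesis unfolding monic_at_def e_id by blast
qed

definition leading_exponent :: "nat set multiset \<Rightarrow> (nat \<times> nat) \<Rightarrow>\<^sub>0 nat" where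
  "leading_exponent A = (\<Sum>J\<in>#A. diagonal_exponent (sorted_list_of_set J))"

lemma monomial_poly_add: "monomial_poly (add_mset J A) = plucker_var J * monomial_poly A"
  by (simp add: monomial_poly_def)

lemma monic_at_monomial: "monic_at (minor_hom (monomial_poly A)) (leading_exponent A)"
proof (induction A)
  case empty
  have "monic_at (1 :: (nat \<times> nat) complex_poly) 0"
    by (simp add: monic_at_def lookup_one)
  then show ?case by (simp add: monomial_poly_def leading_exponent_def minor_hom_simps)
next
  case (add J A)
  then show ?case
    unfolding monomial_poly_add minor_hom_simps minor_hom_plucker_var
    using monic_at_mult[OF monic_at_minor[OF strict_sorted_list_of_set[of J]] add]
    by (simp add: leading_exponent_def)
qed

lemma lookup_leading_exponent:
  assumes "A \<in> plucker_monomials m n"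
  shows "Poly_Mapping.lookup (leading_exponent A) (i, v) = (if i < m then count (row_mset A i) v else 0)"
  using assms
proof (induction A)
  case (add J A)
  then have J: "J \<in> column_sets m n" and A: "A \<in> plucker_monomials m n" by (auto simp: plucker_monomials_def)
  have "Poly_Mapping.lookup (diagonal_exponent (sorted_list_of_set J)) (i, v)
      = (if i < m \<and> sorted_list_of_set J ! i = v then 1 else 0)"
    unfolding diagonal_exponent_def lookup_sum_single_pair column_setsD(4)[OF J] by (rule refl)
  then show ?case using add.IH[OF A] by (simp add: leading_exponent_def row_mset_def lookup_add)
qed (simp add: leading_exponent_def row_mset_def)

text \<open>The exponent of the variable \<open>(k, v)\<close> counts how often \<open>v\<close> is
  the \<open>k\<close>-th element of a factor, so leading terms and row multisets are the same
  data.\<close>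

lemma leading_exponent_eq_iff:
  assumes A: "A \<in> plucker_monomials m n" and B: "B \<in> plucker_monomials m n"
  shows "leading_exponent A = leading_exponent B \<longleftrightarrow> (\<forall>k<m. row_mset A k = row_mset B k)"
proof
  assume eq: "leading_exponent A = leading_exponent B"
  show "\<forall>k<m. row_mset A k = row_mset B k"
  proof (intro allI impI multiset_eqI)
    fix k v assume "k < m"
    then show "count (row_mset A k) v = count (row_mset B k) v"
      using lookup_leading_exponent[OF A, of k v] lookup_leading_exponent[OF B, of k v] eq by simp
  qed
next
  assume "\<forall>k<m. row_mset A k = row_mset B k"
  then show "leading_exponent A = leading_exponent B"
    by (intro poly_mapping_eqI) (auto simp: lookup_leading_exponent[OF A] lookup_leading_exponent[OF B])
qed

section \<open>Monomials with prescribed row multisets\<close>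

lemma size_row_mset [simp]: "size (row_mset A k) = size A"
  by (simp add: row_mset_def)

lemma noncrossing_monomial_unique:
  assumes A: "A \<in> noncrossing_monomials m n" and B: "B \<in> noncrossing_monomials m n" and m: "m \<ge> 1"
    and eq: "leading_exponent A = leading_exponent B"
  shows "A = B"
proof -
  have A': "A \<in> plucker_monomials m n" "semi_noncrossing m n A"
    and B': "B \<in> plucker_monomials m n" "semi_noncrossing m n B"
    using A B by (auto simp: noncrossing_monomials_def)
  have rows: "row_mset A k = row_mset B k" if "k < m" for k
    using eq that leading_exponent_eq_iff[OF A'(1) B'(1)] by blast
  have size: "size A = size B" using rows[of 0] m by (metis size_row_mset Suc_le_lessD One_nat_def)
  have row: "sorted_row A k r = sorted_row B k r" if "k < m" for k r
    using rows[OF that] by (simp add: sorted_row_def)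
  obtain \<tau> where \<tau>: "nc_array m (size A) (sorted_row A) \<tau>" "A = array_columns m (size A) (sorted_row A) \<tau>"
    using semi_noncrossing_imp_nc_array[OF A' m] .
  obtain \<tau>' where \<tau>': "nc_array m (size B) (sorted_row B) \<tau>'" "B = array_columns m (size B) (sorted_row B) \<tau>'"
    using semi_noncrossing_imp_nc_array[OF B' m] .
  \<comment> \<open>Equal row multisets give equal sorted rows, so both monomials come from arrays
    over the same rows.\<close>
  have "nc_array m (size A) (sorted_row A) \<tau>'"
    using \<tau>'(1) row unfolding nc_array_def size by (simp add: Suc_lessD)
  moreover have "array_columns m (size B) (sorted_row B) \<tau>' = array_columns m (size A) (sorted_row A) \<tau>'"
    unfolding array_columns_def size using row by (intro image_mset_cong image_cong) auto
  ultimately show ?thesis using array_columns_unique[OF \<tau>(1) _ m] \<tau>(2) \<tau>'(2) by metis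
qed

definition column_le :: "nat \<Rightarrow> nat set \<Rightarrow> nat set \<Rightarrow> bool" where
  "column_le m J K \<longleftrightarrow> (\<forall>k<m. sorted_list_of_set J ! k \<le> sorted_list_of_set K ! k)"

text \<open>With the factors as columns, these are the semistandard tableaux all of whose columns
  have length \<open>m\<close>.\<close>

definition standard_monomials :: "nat \<Rightarrow> nat \<Rightarrow> nat set multiset set" where
  "standard_monomials m n =
     {A \<in> plucker_monomials m n. \<forall>J\<in>#A. \<forall>K\<in>#A. column_le m J K \<or> column_le m K J}"

text \<open>Sorting by the sum of the entries sorts a chain componentwise: if two sets compare
  against the order of their sums, then the sums are equal and so are all entries.\<close>

lemma standard_monomial_list:
  assumes "A \<in> standard_monomials m n"
  shows "\<exists>Js. mset Js = A \<and> length Js = size A \<and> (\<forall>k<m. \<forall>r'<size A. \<forall>r\<le>r'.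
    sorted_list_of_set (Js ! r) ! k \<le> sorted_list_of_set (Js ! r') ! k)"
proof -
  define f where "f J = (\<Sum>k<m. sorted_list_of_set J ! k)" for J :: "nat set"
  obtain Ks where Ks: "mset Ks = A" using ex_mset by blast
  define Js where "Js = sort_key f Ks"
  have Js: "mset Js = A" by (simp add: Js_def Ks)
  then have len: "length Js = size A" by (metis size_mset)
  have "sorted_list_of_set (Js ! r) ! k \<le> sorted_list_of_set (Js ! r') ! k"
    if k: "k < m" and r: "r \<le> r'" "r' < size A" for k r r'
  proof -
    have mem: "Js ! r \<in># A" "Js ! r' \<in># A" using Js len r by (auto simp flip: Js)
    have fle: "f (Js ! r) \<le> f (Js ! r')"
    proof -
      have "sorted (map f Js)" unfolding Js_def by (rule sorted_sort_key)
      then show ?thesis using sorted_nth_mono[of "map f Js" r r'] r len by simp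
    qed
    consider "column_le m (Js ! r) (Js ! r')" | "column_le m (Js ! r') (Js ! r)"
      using assms mem by (auto simp: standard_monomials_def)
    then show ?thesis
    proof cases
      case 1
      then show ?thesis using k by (simp add: column_le_def)
    next
      case 2
      then have le: "\<And>k. k \<in> {..<m} \<Longrightarrow> sorted_list_of_set (Js ! r') ! k \<le> sorted_list_of_set (Js ! r) ! k"
        by (simp add: column_le_def)
      then have "f (Js ! r') \<le> f (Js ! r)" unfolding f_def by (rule sum_mono)
      then have eq: "f (Js ! r') = f (Js ! r)" using fle by simp
      have "sorted_list_of_set (Js ! r') ! k = sorted_list_of_set (Js ! r) ! k"
        by (rule sum_mono_inv[OF eq[unfolded f_def] le]) (use k in auto)
      then show ?thesis by simp
    qed
  qed
  then show ?thesis using Js len by blast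
qed

text \<open>When the factors are listed as a chain, every row is already sorted, so the
  \<open>r\<close>-th factor consists of the \<open>r\<close>-th entries of the sorted rows.\<close>

lemma standard_monomial_eq:
  assumes A: "A \<in> standard_monomials m n"
  shows "A = mset (map (\<lambda>r. (\<lambda>k. sorted_row A k r) ` {..<m}) [0..<size A])"
proof -
  obtain Js where Js: "mset Js = A" "length Js = size A"
    "\<forall>k<m. \<forall>r'<size A. \<forall>r\<le>r'. sorted_list_of_set (Js ! r) ! k \<le> sorted_list_of_set (Js ! r') ! k"
    using standard_monomial_list[OF A] by (elim exE conjE) (rule that)
  have row: "sorted_row A k r = sorted_list_of_set (Js ! r) ! k" if "k < m" "r < size A" for k r
  proof -
    have "sorted (map (\<lambda>J. sorted_list_of_set J ! k) Js)"
      using Js(2) Js(3) that(1) by (simp add: sorted_iff_nth_mono)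
    moreover have "mset (map (\<lambda>J. sorted_list_of_set J ! k) Js) = row_mset A k"
      by (simp add: row_mset_def Js(1))
    ultimately have "sorted_list_of_multiset (row_mset A k) = map (\<lambda>J. sorted_list_of_set J ! k) Js"
      by (metis sorted_list_of_multiset_mset sorted_sort_id)
    then show ?thesis using that(2) Js(2) by (simp add: sorted_row_def)
  qed
  have "Js = map (\<lambda>r. (\<lambda>k. sorted_row A k r) ` {..<m}) [0..<size A]"
  proof (rule nth_equalityI)
    fix r assume r: "r < length Js"
    then have "Js ! r \<in># A" using Js(1) by auto
    then have "Js ! r \<in> column_sets m n" using A by (auto simp: standard_monomials_def plucker_monomials_def)
    then have "Js ! r = (\<lambda>k. sorted_list_of_set (Js ! r) ! k) ` {..<m}" by (simp add: column_sets_image)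
    also have "\<dots> = (\<lambda>k. sorted_row A k r) ` {..<m}" using row r Js(2) by (intro image_cong) auto
    finally show "Js ! r = map (\<lambda>r. (\<lambda>k. sorted_row A k r) ` {..<m}) [0..<size A] ! r" using r Js(2) by simp
  qed (simp add: Js(2))
  then show ?thesis using Js(1) by simp
qed

lemma standard_monomial_unique:
  assumes A: "A \<in> standard_monomials m n" and B: "B \<in> standard_monomials m n" and m: "m \<ge> 1"
    and eq: "leading_exponent A = leading_exponent B"
  shows "A = B"
proof -
  have AB: "A \<in> plucker_monomials m n" "B \<in> plucker_monomials m n"
    using A B by (auto simp: standard_monomials_def)
  have rows: "row_mset A k = row_mset B k" if "k < m" for k
    using eq that leading_exponent_eq_iff[OF AB] by blast
  have size: "size A = size B" using rows[of 0] m by (metis size_row_mset Suc_le_lessD One_nat_def)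
  have "mset (map (\<lambda>r. (\<lambda>k. sorted_row A k r) ` {..<m}) [0..<size A])
      = mset (map (\<lambda>r. (\<lambda>k. sorted_row B k r) ` {..<m}) [0..<size B])"
    unfolding size using rows by (intro arg_cong[of _ _ mset] map_cong image_cong) (auto simp: sorted_row_def)
  then show ?thesis using standard_monomial_eq[OF A] standard_monomial_eq[OF B] by simp
qed

text \<open>Listing the chain increasingly gives monotone rows in which each entry is smaller than
  the one at the same rank in the next row. This is the admissible matching from which non-crossing
  ones are obtained, and rematching leaves the row multisets unchanged.\<close>

lemma noncrossing_monomial_exists:
  assumes A: "A \<in> standard_monomials m n" and m: "m \<ge> 1"
  obtains B where "B \<in> noncrossing_monomials m n" "leading_exponent B = leading_exponent A"
proof -
  obtain Js where Js: "mset Js = A" "length Js = size A"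
    "\<forall>k<m. \<forall>r'<size A. \<forall>r\<le>r'. sorted_list_of_set (Js ! r) ! k \<le> sorted_list_of_set (Js ! r') ! k"
    using standard_monomial_list[OF A] by (elim exE conjE) (rule that)
  define h where "h = size A"
  define u where "u = (\<lambda>k r. sorted_list_of_set (Js ! r) ! k)"
  have AP: "A \<in> plucker_monomials m n" using A by (simp add: standard_monomials_def)
  have col: "Js ! r \<in> column_sets m n" if "r < h" for r
  proof -
    have "Js ! r \<in># A" using that Js(1,2) nth_mem_mset[of r Js] by (simp add: h_def)
    then show ?thesis using AP by (auto simp: plucker_monomials_def)
  qed
  have mono: "u k r \<le> u k r'" if "k < m" "r \<le> r'" "r' < h" for k r r'
    using Js(3) that by (simp add: u_def h_def)
  have range: "u k r \<in> {1..m + n}" if "k < m" "r < h" for k r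
  proof -
    have "u k r \<in> Js ! r"
      using column_setsD(4,5)[OF col[OF that(2)]] that(1) nth_mem[of k "sorted_list_of_set (Js ! r)"] by (simp add: u_def)
    then show ?thesis using column_setsD(3)[OF col[OF that(2)]] by blast
  qed
  have lt: "u k r < u (Suc k) r" if "Suc k < m" "r < h" for k r
    using column_setsD(6)[OF col[OF that(2)], of k "Suc k"] that(1) by (simp add: u_def)
  obtain \<tau> where \<tau>: "nc_array m h u \<tau>"
    using nc_array_exists[of m h u, OF mono] lt by blast
  define B where "B = array_columns m h u \<tau>"
  have BP: "B \<in> plucker_monomials m n"
    by (rule array_columns_props(1)[OF \<tau> _ B_def]; rule range; assumption)
  have rowB: "row_mset B k = image_mset (u k) (mset_set {..<h})" if "k < m" for k
    by (rule array_columns_props(3)[OF \<tau> _ B_def that]; rule range; assumption)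
  have "semi_noncrossing m n B"
    by (rule array_columns_semi_noncrossing[OF \<tau> m _ _ B_def]; (rule mono | rule range); assumption)
  then have "B \<in> noncrossing_monomials m n" using BP by (simp add: noncrossing_monomials_def)
  moreover have "row_mset B k = row_mset A k" if "k < m" for k
  proof -
    have "A = image_mset ((!) Js) (mset_set {..<h})"
    proof -
      have "A = mset (map ((!) Js) [0..<h])" unfolding h_def Js(2)[symmetric] map_nth Js(1) by (rule refl)
      then show ?thesis by (simp add: lessThan_atLeast0)
    qed
    then have "row_mset A k = image_mset (u k) (mset_set {..<h})"
      unfolding row_mset_def by (simp add: multiset.map_comp o_def u_def)
    then show ?thesis using rowB[OF that] by simp
  qed
  ultimately show thesis
    using that leading_exponent_eq_iff[OF BP AP] by blast
qed

subsection \<open>The ideal of Plucker relations\<close>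

text \<open>A linear combination before passing to residue classes, so that it can be mapped to
  minors.\<close>

definition mono_comb :: "(nat set multiset \<Rightarrow>\<^sub>0 complex) \<Rightarrow> plucker_poly" where
  "mono_comb c = (\<Sum>A\<in>Poly_Mapping.keys c. const_poly (Poly_Mapping.lookup c A) * monomial_poly A)"

lemma const_poly_simps:
  "const_poly 0 = 0" "const_poly 1 = 1" "const_poly (a + b) = const_poly a + const_poly b"
  "const_poly (a * b) = const_poly a * const_poly b" "const_poly (- a) = - const_poly a"
  by (simp_all add: const_poly_def single_add single_uminus mult_single)

lemma const_poly_fact: "(fact k :: plucker_poly) = const_poly (fact k)"
proof -
  have "(fact k :: plucker_poly) = of_nat (fact k)" by simp
  also have "\<dots> = const_poly (of_nat (fact k))" unfolding const_poly_def by (rule single_of_nat[symmetric])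
  finally show ?thesis by simp
qed

lemma mono_comb_superset:
  "finite S \<Longrightarrow> Poly_Mapping.keys c \<subseteq> S \<Longrightarrow>
    mono_comb c = (\<Sum>A\<in>S. const_poly (Poly_Mapping.lookup c A) * monomial_poly A)"
  unfolding mono_comb_def by (rule sum.mono_neutral_left) (auto simp: in_keys_iff const_poly_simps)

lemma mono_comb_add: "mono_comb (c + d) = mono_comb c + mono_comb d"
proof -
  let ?S = "Poly_Mapping.keys c \<union> Poly_Mapping.keys d"
  have "Poly_Mapping.keys (c + d) \<subseteq> ?S" by (rule keys_add)
  then show ?thesis
    by (simp add: mono_comb_superset[of ?S] lookup_add const_poly_simps sum.distrib distrib_right)
qed

lemma mono_comb_diff: "mono_comb (c - d) = mono_comb c - mono_comb d"
  using mono_comb_add[of "c - d" d] by simp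

lemma mono_comb_single: "mono_comb (Poly_Mapping.single A a) = const_poly a * monomial_poly A"
  by (simp add: mono_comb_def const_poly_simps)

lemma mono_comb_0 [simp]: "mono_comb 0 = 0"
  by (simp add: mono_comb_def)

lemma mono_comb_scale:
  "mono_comb (Poly_Mapping.map ((*) a) c) = const_poly a * mono_comb c"
  "Poly_Mapping.keys (Poly_Mapping.map ((*) a) c) \<subseteq> Poly_Mapping.keys c"
proof -
  have l: "Poly_Mapping.lookup (Poly_Mapping.map ((*) a) c) A = a * Poly_Mapping.lookup c A" for A
    by (simp add: map.rep_eq when_def)
  then show k: "Poly_Mapping.keys (Poly_Mapping.map ((*) a) c) \<subseteq> Poly_Mapping.keys c"
    by (auto simp: in_keys_iff)
  show "mono_comb (Poly_Mapping.map ((*) a) c) = const_poly a * mono_comb c"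
    using mono_comb_superset[OF finite_keys k]
    by (simp add: l const_poly_simps sum_distrib_left mult.assoc mono_comb_def[of c])
qed

lemma lookup_single_zero_mult:
  "Poly_Mapping.lookup (Poly_Mapping.single 0 a * p) t = a * Poly_Mapping.lookup p (t :: 'v \<Rightarrow>\<^sub>0 nat)"
  for p :: "'v complex_poly"
  unfolding mult_map_scale_conv_mult[symmetric] by (simp add: map.rep_eq when_def)

lemma minor_hom_mono_comb:
  "minor_hom (mono_comb c) =
    (\<Sum>A\<in>Poly_Mapping.keys c. Poly_Mapping.single 0 (Poly_Mapping.lookup c A) * minor_hom (monomial_poly A))"
  by (simp add: mono_comb_def minor_hom_simps minor_hom_const)

text \<open>The largest leading exponent belongs to one term only and lies above all exponents of
  the others, so its coefficient cannot cancel.\<close>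

lemma mono_comb_leading:
  assumes "c \<noteq> 0" and inj: "inj_on leading_exponent (Poly_Mapping.keys c)"
  obtains T where "T \<in> Poly_Mapping.keys c"
    "\<And>A. A \<in> Poly_Mapping.keys c \<Longrightarrow> leading_exponent A \<le> leading_exponent T"
    "Poly_Mapping.lookup (minor_hom (mono_comb c)) (leading_exponent T) \<noteq> 0"
proof -
  let ?K = "Poly_Mapping.keys c"
  have ne: "leading_exponent ` ?K \<noteq> {}" "finite (leading_exponent ` ?K)" using assms(1) by auto
  then have "Max (leading_exponent ` ?K) \<in> leading_exponent ` ?K" by (intro Max_in)
  then obtain T where T: "T \<in> ?K" "Max (leading_exponent ` ?K) = leading_exponent T" by auto
  have max: "leading_exponent A \<le> leading_exponent T" if "A \<in> ?K" for A
    using Max_ge[OF ne(2), of "leading_exponent A"] that T(2) by simp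
  have "Poly_Mapping.lookup (minor_hom (mono_comb c)) (leading_exponent T)
    = (\<Sum>A\<in>?K. if A = T then Poly_Mapping.lookup c T else 0)"
    unfolding minor_hom_mono_comb lookup_sum lookup_single_zero_mult
  proof (rule sum.cong)
    fix A assume A: "A \<in> ?K"
    show "Poly_Mapping.lookup c A * Poly_Mapping.lookup (minor_hom (monomial_poly A)) (leading_exponent T)
      = (if A = T then Poly_Mapping.lookup c T else 0)"
    proof (cases "A = T")
      case True
      then show ?thesis using monic_at_monomial[of T] by (simp add: monic_at_def)
    next
      case False
      then have "leading_exponent A \<noteq> leading_exponent T" using inj A T(1) by (auto dest: inj_onD)
      then have "\<not> leading_exponent T \<le> leading_exponent A" using max[OF A] by simp
      then have "leading_exponent T \<notin> Poly_Mapping.keys (minor_hom (monomial_poly A))"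
        using monic_at_monomial[of A] unfolding monic_at_def by blast
      then show ?thesis using False by (simp add: in_keys_iff)
    qed
  qed simp
  also have "\<dots> = Poly_Mapping.lookup c T" using T(1) by simp
  also have "\<dots> \<noteq> 0" using T(1) by (simp add: in_keys_iff)
  finally show thesis using that T(1) max by blast
qed

section \<open>The polynomial ring in the Plucker coordinates\<close>

lemma in_plucker_poly_ring:
  "p \<in> carrier (plucker_poly_ring m n) \<longleftrightarrow> (\<forall>t\<in>Poly_Mapping.keys p. Poly_Mapping.keys t \<subseteq> column_sets m n)"
  by (simp add: plucker_poly_ring_def)

lemma plucker_poly_ring_simps [simp]:
  "x \<otimes>\<^bsub>plucker_poly_ring m n\<^esub> y = x * y" "x \<oplus>\<^bsub>plucker_poly_ring m n\<^esub> y = x + y"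
  "\<one>\<^bsub>plucker_poly_ring m n\<^esub> = 1" "\<zero>\<^bsub>plucker_poly_ring m n\<^esub> = 0"
  by (simp_all add: plucker_poly_ring_def)

lemma plucker_poly_ring_closed:
  shows "0 \<in> carrier (plucker_poly_ring m n)" "1 \<in> carrier (plucker_poly_ring m n)"
    "const_poly a \<in> carrier (plucker_poly_ring m n)"
    "J \<in> column_sets m n \<Longrightarrow> plucker_var J \<in> carrier (plucker_poly_ring m n)"
    "p \<in> carrier (plucker_poly_ring m n) \<Longrightarrow> q \<in> carrier (plucker_poly_ring m n) \<Longrightarrow> p + q \<in> carrier (plucker_poly_ring m n)"
    "p \<in> carrier (plucker_poly_ring m n) \<Longrightarrow> q \<in> carrier (plucker_poly_ring m n) \<Longrightarrow> p * q \<in> carrier (plucker_poly_ring m n)"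
    "p \<in> carrier (plucker_poly_ring m n) \<Longrightarrow> - p \<in> carrier (plucker_poly_ring m n)"
    "p \<in> carrier (plucker_poly_ring m n) \<Longrightarrow> p ^ k \<in> carrier (plucker_poly_ring m n)"
    "(\<And>i. i \<in> S \<Longrightarrow> f i \<in> carrier (plucker_poly_ring m n)) \<Longrightarrow> sum f S \<in> carrier (plucker_poly_ring m n)"
proof -
  let ?C = "carrier (plucker_poly_ring m n)"
  show 0: "0 \<in> ?C" by (simp add: in_plucker_poly_ring)
  show c: "const_poly a \<in> ?C" for a by (simp add: in_plucker_poly_ring const_poly_def)
  from c[of 1] show 1: "1 \<in> ?C" by (simp add: const_poly_simps)
  show "J \<in> column_sets m n \<Longrightarrow> plucker_var J \<in> ?C" by (simp add: in_plucker_poly_ring plucker_var_def)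
  show add: "p + q \<in> ?C" if "p \<in> ?C" "q \<in> ?C" for p q
    using that keys_add[of p q] unfolding in_plucker_poly_ring by blast
  show mult: "p * q \<in> ?C" if pq: "p \<in> ?C" "q \<in> ?C" for p q
    unfolding in_plucker_poly_ring
  proof
    fix t assume "t \<in> Poly_Mapping.keys (p * q)"
    then obtain a b where "t = a + b" "a \<in> Poly_Mapping.keys p" "b \<in> Poly_Mapping.keys q"
      using keys_mult[of p q] by blast
    then show "Poly_Mapping.keys t \<subseteq> column_sets m n"
      using pq keys_add[of a b] unfolding in_plucker_poly_ring by blast
  qed
  show "- p \<in> ?C" if "p \<in> ?C" for p
    using mult[OF c[of "-1"] that] by (simp add: const_poly_simps)
  show "p ^ k \<in> ?C" if "p \<in> ?C" for p k
    by (induction k) (simp_all add: 1 mult that)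
  show "sum f S \<in> ?C" if "\<And>i. i \<in> S \<Longrightarrow> f i \<in> ?C"
    using that by (induction S rule: infinite_finite_induct) (simp_all add: 0 add)
qed

lemma plucker_poly_cring: "cring (plucker_poly_ring m n)"
proof (rule cringI)
  show "abelian_group (plucker_poly_ring m n)"
  proof (rule abelian_groupI)
    show "\<exists>y\<in>carrier (plucker_poly_ring m n). y \<oplus>\<^bsub>plucker_poly_ring m n\<^esub> x = \<zero>\<^bsub>plucker_poly_ring m n\<^esub>"
      if "x \<in> carrier (plucker_poly_ring m n)" for x
      using plucker_poly_ring_closed(7)[OF that] by (intro bexI[of _ "- x"]) simp_all
  qed (simp_all add: plucker_poly_ring_closed add_ac)
  show "Group.comm_monoid (plucker_poly_ring m n)"
    by (rule comm_monoidI) (simp_all add: plucker_poly_ring_closed mult_ac)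
qed (simp add: distrib_right)

lemma plucker_poly_ring_uminus:
  assumes "p \<in> carrier (plucker_poly_ring m n)"
  shows "\<ominus>\<^bsub>plucker_poly_ring m n\<^esub> p = - p"
proof -
  interpret cring "plucker_poly_ring m n" by (rule plucker_poly_cring)
  show ?thesis
    using minus_equality[of "- p" p] assms plucker_poly_ring_closed(7)[OF assms] by simp
qed

lemma plucker_relations_carrier: "plucker_relations m n \<subseteq> carrier (plucker_poly_ring m n)"
proof
  fix p assume "p \<in> plucker_relations m n"
  then obtain ks js where p: "p = plucker_relation ks js" and
    len: "length ks + 1 = m" "length js = m + 1" and
    sub: "set ks \<subseteq> {1..m + n}" "set js \<subseteq> {1..m + n}"
    unfolding plucker_relations_def by blast
  have seq: "plucker_seq s \<in> carrier (plucker_poly_ring m n)" if "length s = m" "set s \<subseteq> {1..m + n}" for s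
  proof (cases "distinct s")
    case True
    then have "set s \<in> column_sets m n" using that by (simp add: column_sets_def distinct_card)
    then show ?thesis
      using True by (simp add: plucker_seq_eq plucker_poly_ring_closed)
  next
    case False
    then show ?thesis by (simp add: plucker_seq_eq plucker_poly_ring_closed)
  qed
  show "p \<in> carrier (plucker_poly_ring m n)"
    unfolding p plucker_relation_def
  proof (rule plucker_poly_ring_closed(9))
    fix l assume l: "l \<in> {..<length js}"
    have "js ! l \<in> {1..m + n}" using l sub(2) nth_mem[of l js] by blast
    then have "plucker_seq (ks @ [js ! l]) \<in> carrier (plucker_poly_ring m n)"
      using len sub(1) by (intro seq) simp_all
    moreover have "plucker_seq (take l js @ drop (Suc l) js) \<in> carrier (plucker_poly_ring m n)"
      using len sub l set_take_subset[of l js] set_drop_subset[of "Suc l" js] by (intro seq) auto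
    ultimately show "(- 1) ^ l * plucker_seq (ks @ [js ! l]) * plucker_seq (take l js @ drop (Suc l) js)
      \<in> carrier (plucker_poly_ring m n)"
      by (intro plucker_poly_ring_closed)
  qed
qed

section \<open>The ideal and its vanishing on minors\<close>

lemma plucker_ideal_ideal: "ideal (plucker_ideal m n) (plucker_poly_ring m n)"
proof -
  interpret cring "plucker_poly_ring m n" by (rule plucker_poly_cring)
  show ?thesis
    unfolding plucker_ideal_def by (rule genideal_ideal[OF plucker_relations_carrier])
qed

lemma plucker_relations_ideal: "plucker_relations m n \<subseteq> plucker_ideal m n"
proof -
  interpret cring "plucker_poly_ring m n" by (rule plucker_poly_cring)
  show ?thesis
    unfolding plucker_ideal_def by (rule genideal_self[OF plucker_relations_carrier])
qed

lemma plucker_ideal_closed: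
  shows "p \<in> plucker_ideal m n \<Longrightarrow> p \<in> carrier (plucker_poly_ring m n)"
    and "additive_subgroup_set (plucker_ideal m n)"
    and "p \<in> plucker_ideal m n \<Longrightarrow> q \<in> carrier (plucker_poly_ring m n) \<Longrightarrow> q * p \<in> plucker_ideal m n"
proof -
  interpret ideal "plucker_ideal m n" "plucker_poly_ring m n" by (rule plucker_ideal_ideal)
  show carr: "p \<in> carrier (plucker_poly_ring m n)" if "p \<in> plucker_ideal m n" for p
    using a_Hcarr[OF that] .
  show "q * p \<in> plucker_ideal m n" if "p \<in> plucker_ideal m n" "q \<in> carrier (plucker_poly_ring m n)" for p q
    using I_l_closed[OF that] by simp
  have "a - b \<in> plucker_ideal m n" if "a \<in> plucker_ideal m n" "b \<in> plucker_ideal m n" for a b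
    using additive_subgroup.a_closed[OF is_additive_subgroup that(1) I_l_closed[OF that(2) plucker_poly_ring_closed(3)[of "-1"]]]
    by (simp add: const_poly_simps)
  moreover have "0 \<in> plucker_ideal m n"
    using additive_subgroup.zero_closed[OF is_additive_subgroup] by simp
  ultimately show "additive_subgroup_set (plucker_ideal m n)" by (auto simp: additive_subgroup_set_def)
qed

text \<open>The polynomials of the ring that vanish on minors form an ideal containing the
  generators, hence also the ideal that these generate.\<close>

lemma minor_hom_plucker_ideal:
  assumes "p \<in> plucker_ideal m n"
  shows "minor_hom p = 0"
proof -
  interpret cring "plucker_poly_ring m n" by (rule plucker_poly_cring)
  let ?K = "{p \<in> carrier (plucker_poly_ring m n). minor_hom p = 0}"
  have "ideal ?K (plucker_poly_ring m n)"
  proof (rule idealI)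
    show "ring (plucker_poly_ring m n)" by (rule ring_axioms)
    show "subgroup ?K (add_monoid (plucker_poly_ring m n))"
    proof (rule add.subgroupI)
      show "?K \<noteq> {}" using plucker_poly_ring_closed(1) by (auto simp: minor_hom_simps intro!: exI[of _ 0])
      show "\<ominus>\<^bsub>plucker_poly_ring m n\<^esub> a \<in> ?K" if "a \<in> ?K" for a
        using that by (auto simp: plucker_poly_ring_uminus plucker_poly_ring_closed minor_hom_simps)
    qed (auto simp: plucker_poly_ring_closed minor_hom_simps)
  qed (auto simp: plucker_poly_ring_closed minor_hom_simps)
  moreover have "plucker_relations m n \<subseteq> ?K"
    using plucker_relations_carrier minor_hom_plucker_relation by (fastforce simp: plucker_relations_def)
  ultimately have "plucker_ideal m n \<subseteq> ?K"
    unfolding plucker_ideal_def by (rule genideal_minimal)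
  then show ?thesis using assms by blast
qed

subsection \<open>Straightening\<close>

text \<open>Span modulo the ideal, kept on representatives so that no arithmetic of residue classes
  enters the straightening.\<close>

definition spanned :: "nat \<Rightarrow> nat \<Rightarrow> nat set multiset set \<Rightarrow> plucker_poly set" where
  "spanned m n N = {p. \<exists>c. Poly_Mapping.keys c \<subseteq> N \<and> p - mono_comb c \<in> plucker_ideal m n}"

lemma spanned_0: "0 \<in> spanned m n N"
  unfolding spanned_def using additive_subgroup_set(1)[OF plucker_ideal_closed(2)]
  by (intro CollectI exI[of _ 0]) simp

lemma spanned_monomial: "A \<in> N \<Longrightarrow> monomial_poly A \<in> spanned m n N"
  unfolding spanned_def using additive_subgroup_set(1)[OF plucker_ideal_closed(2)]
  by (intro CollectI exI[of _ "Poly_Mapping.single A 1"]) (simp add: mono_comb_single const_poly_simps)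

lemma spanned_add:
  assumes "p \<in> spanned m n N" "q \<in> spanned m n N"
  shows "p + q \<in> spanned m n N"
proof -
  obtain c d where c: "Poly_Mapping.keys c \<subseteq> N" "p - mono_comb c \<in> plucker_ideal m n"
    and d: "Poly_Mapping.keys d \<subseteq> N" "q - mono_comb d \<in> plucker_ideal m n"
    using assms unfolding spanned_def by blast
  have "(p - mono_comb c) + (q - mono_comb d) \<in> plucker_ideal m n"
    by (rule additive_subgroup_set(3)[OF plucker_ideal_closed(2) c(2) d(2)])
  moreover have "Poly_Mapping.keys (c + d) \<subseteq> N" using keys_add[of c d] c(1) d(1) by blast
  ultimately show ?thesis
    unfolding spanned_def by (intro CollectI exI[of _ "c + d"]) (simp add: mono_comb_add algebra_simps)
qed

lemma spanned_scale:
  assumes "p \<in> spanned m n N"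
  shows "const_poly a * p \<in> spanned m n N"
proof -
  obtain c where c: "Poly_Mapping.keys c \<subseteq> N" "p - mono_comb c \<in> plucker_ideal m n"
    using assms unfolding spanned_def by blast
  let ?d = "Poly_Mapping.map ((*) a) c"
  have "const_poly a * (p - mono_comb c) \<in> plucker_ideal m n"
    by (rule plucker_ideal_closed(3)[OF c(2) plucker_poly_ring_closed(3)])
  moreover have "Poly_Mapping.keys ?d \<subseteq> N" using mono_comb_scale(2)[of a c] c(1) by blast
  ultimately show ?thesis
    unfolding spanned_def by (intro CollectI exI[of _ ?d]) (simp add: mono_comb_scale(1) right_diff_distrib)
qed

lemma spanned_minus: "p \<in> spanned m n N \<Longrightarrow> - p \<in> spanned m n N"
  using spanned_scale[of p m n N "-1"] by (simp add: const_poly_simps)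

lemma spanned_sum:
  "(\<And>i. i \<in> S \<Longrightarrow> f i \<in> spanned m n N) \<Longrightarrow> sum f S \<in> spanned m n N"
  by (induction S rule: infinite_finite_induct) (simp_all add: spanned_0 spanned_add)

lemma spanned_cong:
  assumes "p - q \<in> plucker_ideal m n" "q \<in> spanned m n N"
  shows "p \<in> spanned m n N"
proof -
  obtain c where c: "Poly_Mapping.keys c \<subseteq> N" "q - mono_comb c \<in> plucker_ideal m n"
    using assms unfolding spanned_def by blast
  have "(p - q) + (q - mono_comb c) \<in> plucker_ideal m n"
    by (rule additive_subgroup_set(3)[OF plucker_ideal_closed(2) assms(1) c(2)])
  then show ?thesis using c(1) unfolding spanned_def by auto
qed

lemma spanned_mono_comb:
  "(\<And>A. A \<in> Poly_Mapping.keys c \<Longrightarrow> monomial_poly A \<in> spanned m n N) \<Longrightarrow> mono_comb c \<in> spanned m n N"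
  unfolding mono_comb_def by (intro spanned_sum spanned_scale)

lemma spanned_trans:
  assumes "p \<in> spanned m n N" "\<And>A. A \<in> N \<Longrightarrow> monomial_poly A \<in> spanned m n N'"
  shows "p \<in> spanned m n N'"
proof -
  obtain c where c: "Poly_Mapping.keys c \<subseteq> N" "p - mono_comb c \<in> plucker_ideal m n"
    using assms(1) unfolding spanned_def by blast
  show ?thesis using c assms(2) by (intro spanned_cong[OF c(2)] spanned_mono_comb) blast
qed

lemma monomial_poly_carrier:
  "A \<in> plucker_monomials m n \<Longrightarrow> monomial_poly A \<in> carrier (plucker_poly_ring m n)"
proof (induction A)
  case empty
  then show ?case by (simp add: monomial_poly_def plucker_poly_ring_closed)
next
  case (add J A)
  then show ?case
    by (simp add: monomial_poly_add plucker_monomials_def plucker_poly_ring_closed)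
qed

lemma mono_comb_carrier:
  "Poly_Mapping.keys c \<subseteq> plucker_monomials m n \<Longrightarrow> mono_comb c \<in> carrier (plucker_poly_ring m n)"
  unfolding mono_comb_def by (intro plucker_poly_ring_closed monomial_poly_carrier) blast

section \<open>Straightening to standard monomials\<close>

definition weight_square :: "nat set multiset \<Rightarrow> nat" where
  "weight_square A = (\<Sum>J\<in>#A. column_weight J ^ 2)"

text \<open>In a fixed degree the sum of squares is bounded, so its increase yields a terminating
  measure.\<close>

lemma weight_square_bound:
  assumes "A \<in> plucker_monomials m n"
  shows "weight_square A \<le> (2 ^ Suc (m + n)) ^ 2 * size A"
  using assms
proof (induction A)
  case (add J A)
  then have "J \<in> column_sets m n" by (simp add: plucker_monomials_def)
  then have "column_weight J \<le> 2 ^ Suc (m + n)"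
    unfolding column_weight_def using column_setsD(1,3)
    by (intro less_imp_le[OF sum_power2_less]) fastforce+
  then have "column_weight J ^ 2 \<le> (2 ^ Suc (m + n)) ^ 2" by (rule power_mono) simp
  then show ?case using add by (simp add: weight_square_def plucker_monomials_def)
qed (simp add: weight_square_def)

text \<open>If \<open>d\<close> units move from \<open>a\<close> to \<open>b\<close>, the sum of
  squares grows by \<open>2 * d * (b - a')\<close>, and \<open>a' = a - d < b\<close>.\<close>

lemma sum_squares_increase:
  fixes a b a' b' :: nat
  assumes "a' + b' = a + b" "b < b'" "a \<le> b"
  shows "a ^ 2 + b ^ 2 < a' ^ 2 + b' ^ 2"
proof -
  obtain d where d: "b' = b + d" "d > 0" using assms(2) less_imp_add_positive by blast
  then have a: "a = a' + d" using assms(1) by simp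
  have "d * a' < d * b" using a d assms(3) by simp
  moreover have "a ^ 2 + b ^ 2 = a' ^ 2 + b ^ 2 + d ^ 2 + 2 * (d * a')"
    by (simp add: a power2_eq_square algebra_simps)
  moreover have "a' ^ 2 + b' ^ 2 = a' ^ 2 + b ^ 2 + d ^ 2 + 2 * (d * b)"
    by (simp add: d power2_eq_square algebra_simps)
  ultimately show ?thesis by linarith
qed

text \<open>Exchanges keep the number of factors. This fixes the bound in the measure, and it is
  recorded in the conclusion so that a single finite set of standard monomials serves the later
  induction.\<close>

lemma straighten:
  assumes "A \<in> plucker_monomials m n"
  shows "monomial_poly A \<in> spanned m n {S \<in> standard_monomials m n. size S = size A}"
  using assms
proof (induction "(2 ^ Suc (m + n)) ^ 2 * size A - weight_square A" arbitrary: A rule: less_induct)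
  case (less A)
  let ?N = "{S \<in> standard_monomials m n. size S = size A}"
  show ?case
  proof (cases "A \<in> standard_monomials m n")
    case True
    then show ?thesis by (intro spanned_monomial) simp
  next
    case False
    \<comment> \<open>Incomparability is symmetric, so \<open>K\<close> may be taken as the heavier
      set and still has an entry below the corresponding one of \<open>J\<close>.\<close>
    have "\<exists>J K. J \<in># A \<and> K \<in># A \<and> \<not> column_le m J K \<and> \<not> column_le m K J \<and> column_weight J \<le> column_weight K"
    proof -
      obtain J K where *: "J \<in># A" "K \<in># A" "\<not> column_le m J K" "\<not> column_le m K J"
        using False less.prems by (auto simp: standard_monomials_def)
      have "column_weight J \<le> column_weight K \<or> column_weight K \<le> column_weight J" by (rule linear)
      then show ?thesis using * by blast
    qed
    then obtain J K where JK: "J \<in># A" "K \<in># A" "\<not> column_le m J K" "\<not> column_le m K J"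
      "column_weight J \<le> column_weight K" by blast
    have "J \<noteq> K" using JK(3) by (auto simp: column_le_def)
    obtain A1 where A1: "A = add_mset J A1" using multi_member_split[OF JK(1)] by blast
    then have "K \<in># A1" using JK(2) \<open>J \<noteq> K\<close> by simp
    from multi_member_split[OF this] obtain B where "A1 = add_mset K B" by blast
    then have A: "A = add_mset J (add_mset K B)" using A1 by simp
    have cols: "J \<in> column_sets m n" "K \<in> column_sets m n" and B: "B \<in> plucker_monomials m n"
      using less.prems unfolding A by (auto simp: plucker_monomials_def)
    obtain k where k: "k < m" "sorted_list_of_set K ! k < sorted_list_of_set J ! k"
      using JK(3) by (auto simp: column_le_def not_le)
    obtain S :: "nat list set" and t where S: "finite S"
      and rel: "fact (Suc k) * (plucker_var J * plucker_var K) - sum t S \<in> plucker_ideal m n"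
      and t: "\<And>s. s \<in> S \<Longrightarrow> t s = 0 \<or> (\<exists>J' K'. J' \<in> column_sets m n \<and> K' \<in> column_sets m n \<and>
        (t s = plucker_var J' * plucker_var K' \<or> t s = - (plucker_var J' * plucker_var K')) \<and>
        column_weight J' + column_weight K' = column_weight J + column_weight K \<and>
        column_weight K < column_weight K')"
      by (rule straighten_pair[OF plucker_ideal_closed(2) plucker_relations_ideal cols k]) (rule that)
    have "monomial_poly B * (fact (Suc k) * (plucker_var J * plucker_var K) - sum t S) \<in> plucker_ideal m n"
      by (rule plucker_ideal_closed(3)[OF rel monomial_poly_carrier[OF B]])
    then have red: "fact (Suc k) * monomial_poly A - (\<Sum>s\<in>S. t s * monomial_poly B) \<in> plucker_ideal m n"
      unfolding A monomial_poly_add by (simp add: algebra_simps sum_distrib_left)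
    have "(\<Sum>s\<in>S. t s * monomial_poly B) \<in> spanned m n ?N"
    proof (rule spanned_sum)
      fix s assume "s \<in> S"
      then consider "t s = 0" | J' K' where "J' \<in> column_sets m n" "K' \<in> column_sets m n"
        "t s = plucker_var J' * plucker_var K' \<or> t s = - (plucker_var J' * plucker_var K')"
        "column_weight J' + column_weight K' = column_weight J + column_weight K"
        "column_weight K < column_weight K'"
        using t by blast
      then show "t s * monomial_poly B \<in> spanned m n ?N"
      proof cases
        case 1
        then show ?thesis by (simp add: spanned_0)
      next
        case 2
        define A' where "A' = add_mset J' (add_mset K' B)"
        have A': "A' \<in> plucker_monomials m n" "size A' = size A"
          using 2 B by (auto simp: A'_def A plucker_monomials_def)
        have "weight_square A < weight_square A'"
          using sum_squares_increase[OF 2(4,5) JK(5)] by (simp add: A A'_def weight_square_def)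
        then have "monomial_poly A' \<in> spanned m n {S \<in> standard_monomials m n. size S = size A'}"
          using weight_square_bound[OF A'(1)] A' by (intro less.hyps) simp_all
        then have "monomial_poly A' \<in> spanned m n ?N" by (simp add: A'(2))
        moreover have "t s * monomial_poly B = monomial_poly A' \<or> t s * monomial_poly B = - monomial_poly A'"
          using 2(3) by (auto simp: A'_def monomial_poly_add mult.assoc)
        ultimately show ?thesis using spanned_minus by auto
      qed
    qed
    then have "fact (Suc k) * monomial_poly A \<in> spanned m n ?N" by (rule spanned_cong[OF red])
    \<comment> \<open>The multiple exchange straightens only a factorial multiple of the monomial;
      the factor is divided out in the complex numbers.\<close>
    then have "const_poly (inverse (fact (Suc k))) * (fact (Suc k) * monomial_poly A) \<in> spanned m n ?N"
      by (rule spanned_scale)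
    moreover have "const_poly (inverse (fact (Suc k))) * (fact (Suc k) * monomial_poly A) = monomial_poly A"
    proof -
      have "const_poly (inverse (fact (Suc k))) * fact (Suc k) = 1"
        unfolding const_poly_fact const_poly_simps(4)[symmetric]
        by (simp add: const_poly_simps(2) del: fact_Suc)
      then show ?thesis by (simp only: mult.assoc[symmetric] mult_1)
    qed
    ultimately show ?thesis by simp
  qed
qed

section \<open>From standard to non-crossing monomials\<close>

lemma finite_standard_monomials: "finite {S \<in> standard_monomials m n. size S = h}"
proof -
  have "finite (column_sets m n)" unfolding column_sets_def by (rule finite_subset[of _ "Pow {1..m + n}"]) auto
  then have "finite {S. set_mset S \<subseteq> column_sets m n \<and> size S = h}"
    by (rule finite_multisets_of_size[unfolded multisets_of_size_def])
  then show ?thesis by (rule finite_subset[rotated]) (auto simp: standard_monomials_def plucker_monomials_def)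
qed

lemma minor_hom_diff: "minor_hom (p - q) = minor_hom p - minor_hom q"
  using minor_hom_simps(1)[of "p - q" q] by simp

lemma monomial_poly_independent:
  assumes "mono_comb c \<in> plucker_ideal m n" "inj_on leading_exponent (Poly_Mapping.keys c)"
  shows "c = 0"
proof (rule ccontr)
  assume "c \<noteq> 0"
  then obtain T where "Poly_Mapping.lookup (minor_hom (mono_comb c)) (leading_exponent T) \<noteq> 0"
    using mono_comb_leading assms(2) by metis
  then show False using minor_hom_plucker_ideal[OF assms(1)] by simp
qed

lemma size_leading_exponent:
  assumes "A \<in> plucker_monomials m n" "B \<in> plucker_monomials m n" "m \<ge> 1"
    "leading_exponent A = leading_exponent B"
  shows "size A = size B"
proof -
  have "row_mset A 0 = row_mset B 0" using leading_exponent_eq_iff[OF assms(1,2)] assms(3,4) by simp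
  then show ?thesis by (metis size_row_mset)
qed

text \<open>Straighten the non-crossing monomial \<open>B\<close> that has the leading term of
  \<open>T\<close>. Modulo the ideal, \<open>B\<close> turns out to be \<open>T\<close> plus a
  combination of standard monomials with smaller leading terms. Solving for \<open>T\<close> permits
  induction on the number of standard monomials of the same degree with smaller leading
  term.\<close>

lemma standard_spanned_noncrossing:
  assumes "S \<in> standard_monomials m n" and m: "m \<ge> 1"
  shows "monomial_poly S \<in> spanned m n (noncrossing_monomials m n)"
proof -
  define F where "F = {T \<in> standard_monomials m n. size T = size S}"
  have fin: "finite F" unfolding F_def by (rule finite_standard_monomials)
  have SF: "S \<in> F" using assms by (simp add: F_def)
  have inj: "inj_on leading_exponent F"
    by (rule inj_onI) (use standard_monomial_unique[OF _ _ m] in \<open>auto simp: F_def\<close>)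
  have "monomial_poly T \<in> spanned m n (noncrossing_monomials m n)" if "T \<in> F" for T
    using that
  proof (induction "card {U \<in> F. leading_exponent U < leading_exponent T}" arbitrary: T rule: less_induct)
    case (less T)
    then have T: "T \<in> standard_monomials m n" "size T = size S" by (auto simp: F_def)
    then have TP: "T \<in> plucker_monomials m n" by (simp add: standard_monomials_def)
    obtain B where B: "B \<in> noncrossing_monomials m n" "leading_exponent B = leading_exponent T"
      using noncrossing_monomial_exists[OF T(1) m] by blast
    have BP: "B \<in> plucker_monomials m n" using B(1) by (simp add: noncrossing_monomials_def)
    have "size B = size S" using size_leading_exponent[OF BP TP m B(2)] T(2) by simp
    then have "monomial_poly B \<in> spanned m n F" using straighten[OF BP] by (simp add: F_def)
    then obtain c where c: "Poly_Mapping.keys c \<subseteq> F" "monomial_poly B - mono_comb c \<in> plucker_ideal m n"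
      unfolding spanned_def by blast
    \<comment> \<open>\<open>T\<close> is removed with coefficient \<open>1\<close>; that it no
      longer occurs in \<open>d\<close> follows only from the comparison of leading terms
      below.\<close>
    define d where "d = c - Poly_Mapping.single T 1"
    have "Poly_Mapping.keys d \<subseteq> Poly_Mapping.keys c \<union> {T}"
      unfolding d_def by (auto simp: in_keys_iff lookup_minus lookup_single when_def split: if_splits)
    then have dF: "Poly_Mapping.keys d \<subseteq> F" using c(1) less.prems by blast
    have rel: "monomial_poly B - monomial_poly T - mono_comb d \<in> plucker_ideal m n"
      using c(2) by (simp add: d_def mono_comb_diff mono_comb_single const_poly_simps)
    have lower: "leading_exponent U < leading_exponent T" if "U \<in> Poly_Mapping.keys d" for U
    proof -
      have "d \<noteq> 0" using that by auto
      then obtain V where V: "\<And>A. A \<in> Poly_Mapping.keys d \<Longrightarrow> leading_exponent A \<le> leading_exponent V"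
        "Poly_Mapping.lookup (minor_hom (mono_comb d)) (leading_exponent V) \<noteq> 0"
        using mono_comb_leading[OF _ inj_on_subset[OF inj dF]] by metis
      have "minor_hom (monomial_poly B - monomial_poly T - mono_comb d) = 0"
        by (rule minor_hom_plucker_ideal[OF rel])
      then have "minor_hom (monomial_poly B) - minor_hom (monomial_poly T) = minor_hom (mono_comb d)"
        by (simp add: minor_hom_diff)
      then have *: "Poly_Mapping.lookup (minor_hom (monomial_poly B)) (leading_exponent V)
          \<noteq> Poly_Mapping.lookup (minor_hom (monomial_poly T)) (leading_exponent V)"
        using V(2) lookup_minus[of "minor_hom (monomial_poly B)" "minor_hom (monomial_poly T)" "leading_exponent V"]
        by simp
      \<comment> \<open>\<open>B\<close> and \<open>T\<close> both have coefficient \<open>1\<close>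
        at their common leading exponent and \<open>0\<close> above it, so the difference of their
        images lives strictly below.\<close>
      have "leading_exponent V \<noteq> leading_exponent T"
        using * monic_at_monomial[of B] monic_at_monomial[of T] unfolding B(2) monic_at_def by metis
      moreover have "leading_exponent V \<le> leading_exponent T"
      proof (rule ccontr)
        assume "\<not> leading_exponent V \<le> leading_exponent T"
        then have "leading_exponent V \<notin> Poly_Mapping.keys (minor_hom (monomial_poly B))"
          "leading_exponent V \<notin> Poly_Mapping.keys (minor_hom (monomial_poly T))"
          using monic_at_monomial[of B] monic_at_monomial[of T] unfolding B(2) monic_at_def by blast+
        then show False using * by (simp add: in_keys_iff)
      qed
      ultimately show ?thesis using V(1)[OF that] by (meson le_less_trans order_le_neq_trans)
    qed
    have "mono_comb d \<in> spanned m n (noncrossing_monomials m n)"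
    proof (rule spanned_mono_comb)
      fix U assume U: "U \<in> Poly_Mapping.keys d"
      have "{W \<in> F. leading_exponent W < leading_exponent U} \<subseteq> {W \<in> F. leading_exponent W < leading_exponent T}"
        using lower[OF U] by (auto intro: less_trans)
      moreover have "U \<in> {W \<in> F. leading_exponent W < leading_exponent T}" "U \<notin> {W \<in> F. leading_exponent W < leading_exponent U}"
        using lower[OF U] U dF by auto
      ultimately have "{W \<in> F. leading_exponent W < leading_exponent U} \<subset> {W \<in> F. leading_exponent W < leading_exponent T}"
        by blast
      then show "monomial_poly U \<in> spanned m n (noncrossing_monomials m n)"
        using U dF fin by (intro less.hyps psubset_card_mono) auto
    qed
    then have "monomial_poly B + - mono_comb d \<in> spanned m n (noncrossing_monomials m n)"
      by (intro spanned_add spanned_minus spanned_monomial B(1))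
    moreover have "monomial_poly T - (monomial_poly B + - mono_comb d) \<in> plucker_ideal m n"
      using additive_subgroup_set(2)[OF plucker_ideal_closed(2) additive_subgroup_set(1)[OF plucker_ideal_closed(2)] rel]
      by (simp add: algebra_simps)
    ultimately show ?case by (rule spanned_cong[rotated])
  qed
  then show ?thesis using SF by blast
qed

lemma monomial_spanned_noncrossing:
  assumes "A \<in> plucker_monomials m n" "m \<ge> 1"
  shows "monomial_poly A \<in> spanned m n (noncrossing_monomials m n)"
  by (rule spanned_trans[OF straighten[OF assms(1)]]) (use standard_spanned_noncrossing assms(2) in blast)

lemma monomial_poly_sum:
  "monomial_poly (\<Sum>x\<in>S. f x) = (\<Prod>x\<in>S. monomial_poly (f x))"
  by (induction S rule: infinite_finite_induct) (simp_all add: monomial_poly_def)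

text \<open>Translates an exponent into a multiset of column sets, the form in which monomials are
  straightened.\<close>

lemma single_eq_monomial_poly:
  assumes "Poly_Mapping.keys t \<subseteq> column_sets m n"
  obtains A where "A \<in> plucker_monomials m n" "Poly_Mapping.single t 1 = monomial_poly A"
proof -
  define A where "A = (\<Sum>J\<in>Poly_Mapping.keys t. replicate_mset (Poly_Mapping.lookup t J) J)"
  have pow: "plucker_var J ^ k = Poly_Mapping.single (Poly_Mapping.single J k) 1" for J k
    by (induction k) (simp_all add: plucker_var_def mult_single flip: single_add)
  have "monomial_poly A = (\<Prod>J\<in>Poly_Mapping.keys t. Poly_Mapping.single (Poly_Mapping.single J (Poly_Mapping.lookup t J)) 1)"
    unfolding A_def monomial_poly_sum by (simp add: monomial_poly_def pow)
  also have "\<dots> = Poly_Mapping.single t 1"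
    unfolding prod_single_one by (simp flip: poly_mapping_sum_singles)
  finally have "Poly_Mapping.single t 1 = monomial_poly A" by simp
  moreover have "set_mset A \<subseteq> Poly_Mapping.keys t"
    unfolding A_def by (auto simp: set_mset_sum in_replicate_mset)
  ultimately show thesis using that assms by (auto simp: plucker_monomials_def)
qed

lemma spanned_noncrossing:
  assumes "p \<in> carrier (plucker_poly_ring m n)" and m: "m \<ge> 1"
  shows "p \<in> spanned m n (noncrossing_monomials m n)"
proof -
  have "Poly_Mapping.single t (Poly_Mapping.lookup p t) \<in> spanned m n (noncrossing_monomials m n)"
    if t: "t \<in> Poly_Mapping.keys p" for t
  proof -
    have "Poly_Mapping.keys t \<subseteq> column_sets m n" using assms t by (simp add: in_plucker_poly_ring)
    then obtain A where A: "A \<in> plucker_monomials m n" "Poly_Mapping.single t 1 = monomial_poly A"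
      by (rule single_eq_monomial_poly)
    have "Poly_Mapping.single t (Poly_Mapping.lookup p t) = const_poly (Poly_Mapping.lookup p t) * monomial_poly A"
      by (simp add: const_poly_def mult_single flip: A(2))
    then show ?thesis using spanned_scale[OF monomial_spanned_noncrossing[OF A(1) m]] by simp
  qed
  then show ?thesis by (subst poly_mapping_sum_singles) (rule spanned_sum)
qed

section \<open>Residue classes and linear combinations in the quotient\<close>

lemma residue_class_eq_iff:
  assumes "p \<in> carrier (plucker_poly_ring m n)" "q \<in> carrier (plucker_poly_ring m n)"
  shows "residue_class m n p = residue_class m n q \<longleftrightarrow> p - q \<in> plucker_ideal m n"
proof -
  interpret cring "plucker_poly_ring m n" by (rule plucker_poly_cring)
  have "p \<ominus>\<^bsub>plucker_poly_ring m n\<^esub> q = p - q"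
    using assms by (simp add: a_minus_def plucker_poly_ring_uminus)
  then show ?thesis
    using quotient_eq_iff_same_a_r_cos[OF plucker_ideal_ideal assms] by (simp add: residue_class_def)
qed

lemma residue_class_hom: "residue_class m n \<in> Ring.ring_hom (plucker_poly_ring m n) (grassmannian_ring m n)"
proof -
  interpret ideal "plucker_ideal m n" "plucker_poly_ring m n" by (rule plucker_ideal_ideal)
  show ?thesis
    using rcos_ring_hom by (simp add: residue_class_def[abs_def] grassmannian_ring_def)
qed

lemma residue_class_0: "residue_class m n 0 = \<zero>\<^bsub>grassmannian_ring m n\<^esub>"
proof -
  interpret ideal "plucker_ideal m n" "plucker_poly_ring m n" by (rule plucker_ideal_ideal)
  have "ring (grassmannian_ring m n)"
    unfolding grassmannian_ring_def by (rule quotient_is_ring)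
  then show ?thesis
    using ring_hom_zero[OF residue_class_hom[of m n] ring_axioms] by simp
qed

text \<open>Taking residue classes is a ring homomorphism, so statements about combinations in the
  quotient become congruences of polynomials modulo the ideal.\<close>

lemma lin_comb_eq_residue_class:
  assumes "Poly_Mapping.keys c \<subseteq> plucker_monomials m n"
  shows "lin_comb (grassmannian_ring m n) (scalar_class m n) (monomial_class m n) c = residue_class m n (mono_comb c)"
proof -
  interpret ideal "plucker_ideal m n" "plucker_poly_ring m n" by (rule plucker_ideal_ideal)
  interpret Q: ring "grassmannian_ring m n"
    unfolding grassmannian_ring_def by (rule quotient_is_ring)
  note hom = residue_class_hom[of m n]
  have closed: "const_poly (Poly_Mapping.lookup c A) * monomial_poly A \<in> carrier (plucker_poly_ring m n)"
    if "A \<in> Poly_Mapping.keys c" for A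
    using that assms by (intro plucker_poly_ring_closed monomial_poly_carrier) blast
  have sumQ: "(\<Oplus>\<^bsub>grassmannian_ring m n\<^esub>A\<in>S. residue_class m n (f A)) = residue_class m n (sum f S)"
    if "finite S" "\<And>A. A \<in> S \<Longrightarrow> f A \<in> carrier (plucker_poly_ring m n)" for S and f :: "nat set multiset \<Rightarrow> plucker_poly"
    using that
  proof (induction S)
    case empty
    show ?case by (simp add: residue_class_0)
  next
    case (insert A S)
    have "(\<Oplus>\<^bsub>grassmannian_ring m n\<^esub>A\<in>insert A S. residue_class m n (f A))
      = residue_class m n (f A) \<oplus>\<^bsub>grassmannian_ring m n\<^esub> (\<Oplus>\<^bsub>grassmannian_ring m n\<^esub>A\<in>S. residue_class m n (f A))"
      using insert ring_hom_closed[OF hom] by (intro Q.finsum_insert) auto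
    then show ?case
      using insert ring_hom_add[OF hom, of "f A" "sum f S"] plucker_poly_ring_closed(9)[of S f m n] by simp
  qed
  have "lin_comb (grassmannian_ring m n) (scalar_class m n) (monomial_class m n) c
    = (\<Oplus>\<^bsub>grassmannian_ring m n\<^esub>A\<in>Poly_Mapping.keys c. residue_class m n (const_poly (Poly_Mapping.lookup c A) * monomial_poly A))"
    unfolding lin_comb_def
  proof (rule Q.finsum_cong')
    fix A assume A: "A \<in> Poly_Mapping.keys c"
    then have "monomial_poly A \<in> carrier (plucker_poly_ring m n)" using assms monomial_poly_carrier by blast
    then show "scalar_class m n (Poly_Mapping.lookup c A) \<otimes>\<^bsub>grassmannian_ring m n\<^esub> monomial_class m n A
      = residue_class m n (const_poly (Poly_Mapping.lookup c A) * monomial_poly A)"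
      using ring_hom_mult[OF hom plucker_poly_ring_closed(3)[of "Poly_Mapping.lookup c A"]]
      by (simp add: scalar_class_def monomial_class_def)
  qed (use ring_hom_closed[OF hom] closed in auto)
  also have "\<dots> = residue_class m n (mono_comb c)"
    unfolding mono_comb_def by (rule sumQ[OF finite_keys]) (rule closed)
  finally show ?thesis .
qed

theorem theorem24:
  fixes m n :: nat
  assumes "m \<ge> 1" and "n \<ge> 1"
  shows "(\<forall>A\<in>plucker_monomials m n.
            \<exists>!c. Poly_Mapping.keys c \<subseteq> noncrossing_monomials m n \<and>
                 monomial_class m n A =
                   lin_comb (grassmannian_ring m n) (scalar_class m n) (monomial_class m n) c)
       \<and> is_basis (grassmannian_ring m n) (scalar_class m n) (monomial_class m n)
            (noncrossing_monomials m n)"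
proof -
  let ?N = "noncrossing_monomials m n" and ?R = "grassmannian_ring m n"
  let ?l = "lin_comb ?R (scalar_class m n) (monomial_class m n)"
  have NP: "?N \<subseteq> plucker_monomials m n" by (auto simp: noncrossing_monomials_def)
  have lin: "?l c = residue_class m n (mono_comb c)" "mono_comb c \<in> carrier (plucker_poly_ring m n)"
    if "Poly_Mapping.keys c \<subseteq> ?N" for c
    using lin_comb_eq_residue_class mono_comb_carrier that NP by blast+
  have inj: "inj_on leading_exponent ?N"
    using noncrossing_monomial_unique[OF _ _ assms(1)] by (auto intro: inj_onI)
  \<comment> \<open>Two combinations with the same class differ by a combination of non-crossing
    monomials that lies in the ideal, and these have distinct leading exponents.\<close>
  have eq: "c = d" if "Poly_Mapping.keys c \<subseteq> ?N" "Poly_Mapping.keys d \<subseteq> ?N" "?l c = ?l d" for c d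
  proof -
    have "mono_comb (c - d) \<in> plucker_ideal m n"
      using residue_class_eq_iff lin that by (simp add: mono_comb_diff)
    moreover have "Poly_Mapping.keys (c - d) \<subseteq> ?N"
      using that(1,2) keys_diff[of c d] by blast
    then have "inj_on leading_exponent (Poly_Mapping.keys (c - d))" by (rule inj_on_subset[OF inj])
    ultimately have "c - d = 0" by (rule monomial_poly_independent)
    then show ?thesis by simp
  qed
  have span: "\<exists>c. Poly_Mapping.keys c \<subseteq> ?N \<and> residue_class m n p = ?l c"
    if p: "p \<in> carrier (plucker_poly_ring m n)" for p
  proof -
    obtain c where c: "Poly_Mapping.keys c \<subseteq> ?N" "p - mono_comb c \<in> plucker_ideal m n"
      using spanned_noncrossing[OF p assms(1)] unfolding spanned_def by blast
    then have "residue_class m n p = ?l c"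
      using residue_class_eq_iff[OF p lin(2)[OF c(1)]] lin(1)[OF c(1)] by simp
    then show ?thesis using c(1) by blast
  qed
  have "\<exists>!c. Poly_Mapping.keys c \<subseteq> ?N \<and> monomial_class m n A = ?l c" if "A \<in> plucker_monomials m n" for A
    using span[OF monomial_poly_carrier[OF that]] eq unfolding monomial_class_def by metis
  moreover have "lin_independent ?R (scalar_class m n) (monomial_class m n) ?N"
    unfolding lin_independent_def
  proof (intro allI impI)
    fix c assume c: "Poly_Mapping.keys c \<subseteq> ?N \<and> ?l c = \<zero>\<^bsub>?R\<^esub>"
    \<comment> \<open>Independence is uniqueness of coefficients, compared with the zero
      combination.\<close>
    have "?l 0 = \<zero>\<^bsub>?R\<^esub>"
      using lin(1)[of 0] by (simp add: residue_class_0)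
    then show "c = 0" using c by (intro eq) simp_all
  qed
  moreover have "{?l c | c. Poly_Mapping.keys c \<subseteq> ?N} = carrier ?R"
  proof -
    have carr: "carrier ?R = residue_class m n ` carrier (plucker_poly_ring m n)"
      by (auto simp: grassmannian_ring_def FactRing_def A_RCOSETS_def RCOSETS_def residue_class_def a_r_coset_def)
    show ?thesis
      unfolding carr
    proof (intro equalityI subsetI)
      fix x assume "x \<in> {?l c | c. Poly_Mapping.keys c \<subseteq> ?N}"
      then obtain c where "x = ?l c" "Poly_Mapping.keys c \<subseteq> ?N" by (elim CollectE exE conjE)
      then show "x \<in> residue_class m n ` carrier (plucker_poly_ring m n)" by (simp add: lin)
    next
      fix x assume "x \<in> residue_class m n ` carrier (plucker_poly_ring m n)"
      then obtain p where p: "x = residue_class m n p" "p \<in> carrier (plucker_poly_ring m n)" by (elim imageE)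
      obtain c where "Poly_Mapping.keys c \<subseteq> ?N" "residue_class m n p = ?l c"
        using span[OF p(2)] by (elim exE conjE)
      then show "x \<in> {?l c | c. Poly_Mapping.keys c \<subseteq> ?N}"
        using p(1) by (intro CollectI exI[of _ c]) simp
    qed
  qed
  ultimately show ?thesis by (simp add: is_basis_def)
qed

end
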